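(* For every $n\ge 0$ and every oriented tangle diagram $T$ in a disk with $2n$ endpoints on the boundary of the disk, let $\Delta(T)\in\mathcal{P}'_{2n}$ be the vector defined in the context. Then: (1) (Alexander-Conway skein relation) If $T_+,T_-,T_0$ are oriented tangle diagrams that are identical except in a small disk, where they are respectively a positive crossing, a negative crossing, and the oriented smoothing, then $\Delta(T_+)-\Delta(T_-)=(q-q^{-1})\Delta(T_0)$. (2) (Invariance under Reidemeister II and III) If $T$ and $T'$ are related by any oriented version of a Reidemeister II move or of a Reidemeister III move, then $\Delta(T)=\Delta(T')$. (3) (Behaviour under Reidemeister I) If $T'$ is obtained from $T$ by inserting a kink (a Reidemeister I curl with one crossing, positive or negative) into a strand, then $\Delta(T')=-q^{-1}\Delta(T)$ if the loop of the kink is traversed clockwise, and $\Delta(T')=-q\,\Delta(T)$ if the loop of the kink is traversed counterclockwise.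
   Context: Diagrams. Scalars are taken in $\mathbb{C}(q)$, $q$ a formal variable. A diagram with $m$ boundary endpoints is a finite disjoint union of embedded closed loops and edges in a disk, with $m$ fixed edge endpoints on the boundary circle in total (other edge endpoints, called univalent vertices, lie in the interior of the disk), together with a basepoint on the boundary circle away from the endpoints. Diagrams are considered up to isotopy. $\mathcal{P}_m$ is the vector space of formal linear combinations of diagrams with $m$ boundary endpoints, modulo two relations: any diagram containing a closed loop is zero, and any edge with both endpoints in the interior may be deleted. Thus $\mathcal{P}_m$ has as basis the diagrams in which every component is an edge with one or both endpoints on the boundary. The $\mathcal{P}_m$ form a planar algebra $\mathcal{P}$: diagrams can be connected together in arbitrary planar ways, multilinearly. A dot on a strand is shorthand for a linear combination: (dotted strand) $=$ (undotted strand) $-$ (the strand cut at the dot, leaving two edges each ending in a univalent vertex near the dot). It is extended multilinearly to diagrams with several dots. $\mathcal{P}'$ is the quotient planar algebra of $\mathcal{P}$ by the saddle relation: in a small disk with four boundary points NW, NE, SW, SE, (dotted strand NW–NE together with dotted strand SW–SE) $+$ (dotted strand NW–SW together with dotted strand NE–SE) $=0$. That is, $\mathcal{P}'_m$ is the quotient of $\mathcal{P}_m$ by the span of all elements obtained by inserting this sum of two local pictures into a small disk in a larger diagram. Crossings. Draw a crossing in a small disk so that both strands point upward, with outgoing endpoints NW, NE and incoming endpoints SW, SE. Positive crossing: the strand SW to NE passes over the strand SE to NW. Negative crossing: the strand SE to NW passes over the strand SW to NE. Oriented smoothing: disjoint upward strands SW to NW and SE to NE. Let $[\mathrm{NW\,SW}|\mathrm{NE\,SE}]$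 be the diagram with two disjoint strands joining NW–SW and NE–SE. For endpoints $a,b$, let $[a\,b]$ be the crossingless diagram with a strand joining $a$ to $b$ and each of the other two endpoints attached to a short edge ending in an interior univalent vertex. Let $[\emptyset]$ have all four endpoints attached to such short edges. Define positive crossing $= q[\mathrm{NW\,SW}|\mathrm{NE\,SE}] + q([\mathrm{NW\,SE}]-[\mathrm{NE\,SE}]-[\emptyset])+q^{-1}([\mathrm{SW\,NE}]-[\mathrm{NW\,SW}]-[\emptyset])$, negative crossing $= q^{-1}[\mathrm{NW\,SW}|\mathrm{NE\,SE}] + q([\mathrm{NW\,SE}]-[\mathrm{NE\,SE}]-[\emptyset])+q^{-1}([\mathrm{SW\,NE}]-[\mathrm{NW\,SW}]-[\emptyset])$. $\Delta(T)$ is the element of $\mathcal{P}'_{2n}$ obtained by expanding every crossing of $T$ multilinearly by these rules and forgetting orientations. *)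

theory Defs
  imports
    "HOL-Computational_Algebra.Polynomial"
    "HOL-Computational_Algebra.Fraction_Field"
    "HOL-Library.FuncSet"
    "HOL-Library.Function_Algebras"
    Complex_Main
begin

section \<open>The planar algebra of partial matchings and its quotient\<close>

type_synonym scalar = "complex poly fract"

definition qvar :: scalar where
  "qvar = Fract [:0, 1:] 1"

text \<open>
  The boundary endpoints of a disk are numbered 0, 1, ..., m - 1 counterclockwise, starting at
  the basepoint. A diagram all of whose components are edges with at least one endpoint on the
  boundary is determined up to isotopy by the pairs of boundary endpoints that it joins, that is,
  by a noncrossing partial matching, stored here as a symmetric relation; a boundary endpoint
  outside the domain of the relation carries an edge whose other end is a univalent vertex.
\<close>

type_synonym matching = "(nat \<times> nat) set"

definition matchings :: "nat \<Rightarrow> matching set" where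
  "matchings m = {M. M \<subseteq> {..<m} \<times> {..<m} \<and> sym M \<and> irrefl M \<and> single_valued M \<and>
     (\<forall>i j k l. (i, j) \<in> M \<longrightarrow> (k, l) \<in> M \<longrightarrow> \<not> (i < k \<and> k < j \<and> j < l))}"

type_synonym vec = "matching \<Rightarrow> scalar"

definition basis :: "matching \<Rightarrow> vec" where
  "basis M = (\<lambda>N. if N = M then 1 else 0)"

definition vscale :: "scalar \<Rightarrow> vec \<Rightarrow> vec"  (infixr "\<odot>" 75) where
  "c \<odot> v = (\<lambda>M. c * v M)"

text \<open>The space \<open>P m\<close> of formal linear combinations.\<close>

definition diagram_space :: "nat \<Rightarrow> vec set" where
  "diagram_space m = {v. \<forall>M. v M \<noteq> 0 \<longrightarrow> M \<in> matchings m}"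

text \<open>
  Three operations generate all planar ways of connecting diagrams: placing two disks side by side
  (the endpoints of the second are numbered after those of the first), moving the basepoint past
  the endpoint 0, and joining the endpoints 0 and 1 by an arc outside the disk. Joining creates a
  closed loop if 0 and 1 were already connected, and an interior edge, which is deleted, if both
  were attached to univalent vertices.
\<close>

definition juxt :: "nat \<Rightarrow> vec \<Rightarrow> nat \<Rightarrow> vec \<Rightarrow> vec" where
  "juxt m v k w = (\<Sum>M\<in>matchings m. \<Sum>N\<in>matchings k.
     (v M * w N) \<odot> basis (M \<union> (\<lambda>(i, j). (m + i, m + j)) ` N))"

definition rot :: "nat \<Rightarrow> vec \<Rightarrow> vec" where
  "rot m v = (\<Sum>M\<in>matchings m. v M \<odot>
     basis ((\<lambda>(i, j). (if i = 0 then m - 1 else i - 1, if j = 0 then m - 1 else j - 1)) ` M))"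

definition join_matching :: "matching \<Rightarrow> vec" where
  "join_matching M = (if (0, 1) \<in> M then 0 else
     basis {(i, j). (i + 2, j + 2) \<in> M \<or>
                    (i + 2, 0) \<in> M \<and> (1, j + 2) \<in> M \<or>
                    (i + 2, 1) \<in> M \<and> (0, j + 2) \<in> M})"

definition join :: "nat \<Rightarrow> vec \<Rightarrow> vec" where
  "join m v = (\<Sum>M\<in>matchings m. v M \<odot> join_matching M)"

definition link :: "nat \<Rightarrow> nat \<Rightarrow> matching" where
  "link i j = {(i, j), (j, i)}"

definition dotted_strand :: vec where
  "dotted_strand = basis (link 0 1) - basis {}"

text \<open>
  In a disk with four endpoints the basepoint is on the west side, so that the endpoints
  0, 1, 2, 3 are SW, SE, NE, NW. The first summand of the saddle element is the pair of dotted
  strands SW-SE and NE-NW; moving the basepoint once gives the pair SE-NE and NW-SW.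
\<close>

abbreviation (input) "SW \<equiv> (0::nat)"
abbreviation (input) "SE \<equiv> (1::nat)"
abbreviation (input) "NE \<equiv> (2::nat)"
abbreviation (input) "NW \<equiv> (3::nat)"

definition saddle :: vec where
  "saddle = juxt 2 dotted_strand 2 dotted_strand + rot 4 (juxt 2 dotted_strand 2 dotted_strand)"

text \<open>
  \<open>saddle_insertion m v\<close>: \<open>v\<close> is the result of inserting the saddle element into a small disk of a
  larger diagram with \<open>m\<close> boundary endpoints. Cutting the part of the larger diagram outside the
  small disk along a path from one basepoint to the other turns it into a diagram in a disk, which
  is placed next to the saddle and joined to it.
\<close>

inductive saddle_insertion :: "nat \<Rightarrow> vec \<Rightarrow> bool" where
  saddle: "saddle_insertion 4 saddle"
| juxt: "saddle_insertion m v \<Longrightarrow> M \<in> matchings k \<Longrightarrow>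
    saddle_insertion (m + k) (juxt m v k (basis M))"
| rot: "saddle_insertion m v \<Longrightarrow> saddle_insertion m (rot m v)"
| join: "saddle_insertion (m + 2) v \<Longrightarrow> saddle_insertion m (join (m + 2) v)"

text \<open>Two vectors of \<open>P m\<close> are congruent if they agree in the quotient \<open>P' m\<close>.\<close>

definition saddle_cong :: "nat \<Rightarrow> vec \<Rightarrow> vec \<Rightarrow> bool" where
  "saddle_cong m v w \<longleftrightarrow> v - w \<in> module.span (\<odot>) {u. saddle_insertion m u}"

section \<open>Oriented tangle diagrams\<close>

text \<open>
  A tangle diagram is stored as a graph on points named by natural numbers. A crossing has four
  points SW, SE, NE, NW, in the position in which both of its strands run upwards. Every directed
  arc runs along a strand and connects two points; the points that are neither on the boundary
  nor at a crossing just subdivide a strand. The boundary points are listed counterclockwise from the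
  basepoint, each with the information whether the strand enters or leaves the disk there.
\<close>

datatype sign = Pos | Neg

datatype dir = Inward | Outward

datatype crossing = Crossing (csign: sign) (ports: "nat list")

datatype tangle =
  Tangle (bd: "(nat \<times> dir) list") (arcs: "(nat \<times> nat) set") (crossings: "crossing set")

definition points :: "tangle \<Rightarrow> nat set" where
  "points T = fst ` set (bd T) \<union> Field (arcs T) \<union> (\<Union>c\<in>crossings T. set (ports c))"

definition crossing_tangle :: "sign \<Rightarrow> nat \<Rightarrow> nat \<Rightarrow> nat \<Rightarrow> nat \<Rightarrow> tangle" where
  "crossing_tangle s sw se ne nw =
     Tangle [(sw, Inward), (se, Inward), (ne, Outward), (nw, Outward)] {}
       {Crossing s [sw, se, ne, nw]}"

definition beside :: "tangle \<Rightarrow> tangle \<Rightarrow> tangle" where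
  "beside S T = Tangle (bd S @ bd T) (arcs S \<union> arcs T) (crossings S \<union> crossings T)"

definition move_basepoint :: "tangle \<Rightarrow> tangle" where
  "move_basepoint T = Tangle (rotate1 (bd T)) (arcs T) (crossings T)"

text \<open>
  The next operation connects the first two boundary points by an arc outside the disk; it is only
  meaningful if the strand leaves at one of them and enters at the other.
\<close>

definition joinable :: "tangle \<Rightarrow> bool" where
  "joinable T \<longleftrightarrow> length (bd T) \<ge> 2 \<and> snd (bd T ! 0) \<noteq> snd (bd T ! 1)"

definition join_first :: "tangle \<Rightarrow> tangle" where
  "join_first T = (let p = fst (bd T ! 0); r = fst (bd T ! 1) in
     Tangle (drop 2 (bd T))
       (insert (if snd (bd T ! 0) = Outward then (p, r) else (r, p)) (arcs T))
       (crossings T))"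

text \<open>
  Planarity. In a generic position every diagram in a disk is built up from single strands and
  single crossings by these operations.
\<close>

inductive planar :: "tangle \<Rightarrow> bool" where
  "planar (Tangle [] {} {})"
| "a \<noteq> b \<Longrightarrow> planar (Tangle [(a, Inward), (b, Outward)] {(a, b)} {})"
| "distinct [sw, se, ne, nw] \<Longrightarrow> planar (crossing_tangle s sw se ne nw)"
| "planar S \<Longrightarrow> planar T \<Longrightarrow> points S \<inter> points T = {} \<Longrightarrow> planar (beside S T)"
| "planar T \<Longrightarrow> planar (move_basepoint T)"
| "planar T \<Longrightarrow> joinable T \<Longrightarrow> planar (join_first T)"

definition tangle_diagram :: "nat \<Rightarrow> tangle \<Rightarrow> bool" where
  "tangle_diagram n T \<longleftrightarrow> planar T \<and> length (bd T) = 2 * n"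

text \<open>
  Different graphs can store the same tangle diagram, since the names of the points and the
  subdivision of the strands are irrelevant. What matters are the orientations at the boundary, the
  crossings, how the ends (boundary endpoints and corners of crossings) are connected by the
  strands between crossings, and the number of closed components without crossings. (For
  disconnected diagrams the position of the pieces relative to each other is not recorded.)
\<close>

datatype 'c tend = Boundary nat | Corner 'c nat

definition ends :: "tangle \<Rightarrow> crossing tend set" where
  "ends T = Boundary ` {..<length (bd T)} \<union> {Corner c k | c k. c \<in> crossings T \<and> k < 4}"

fun location :: "tangle \<Rightarrow> crossing tend \<Rightarrow> nat" where
  "location T (Boundary i) = fst (bd T ! i)"
| "location T (Corner c k) = ports c ! k"

definition connected_by :: "(nat \<times> nat) set \<Rightarrow> (nat \<times> nat) set" where
  "connected_by E = (E \<union> E\<inverse>)\<^sup>*"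

definition free_loops :: "tangle \<Rightarrow> nat set set" where
  "free_loops T = {connected_by (arcs T) `` {x} | x.
     x \<in> points T \<and> connected_by (arcs T) `` {x} \<inter> location T ` ends T = {}}"

definition same_diagram :: "tangle \<Rightarrow> tangle \<Rightarrow> bool" where
  "same_diagram T T' \<longleftrightarrow>
     map snd (bd T) = map snd (bd T') \<and>
     card (free_loops T) = card (free_loops T') \<and>
     (\<exists>f. bij_betw f (crossings T) (crossings T') \<and>
        (\<forall>c\<in>crossings T. csign (f c) = csign c) \<and>
        (\<forall>e\<in>ends T. \<forall>e'\<in>ends T.
           (location T e, location T e') \<in> connected_by (arcs T) \<longleftrightarrow>
           (location T' (map_tend f e), location T' (map_tend f e')) \<in> connected_by (arcs T')))"

section \<open>The invariant\<close>

definition crossing_vec :: "sign \<Rightarrow> vec" where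
  "crossing_vec s =
     (case s of Pos \<Rightarrow> qvar | Neg \<Rightarrow> inverse qvar) \<odot> basis (link NW SW \<union> link NE SE)
     + qvar \<odot> (basis (link NW SE) - basis (link NE SE) - basis {})
     + inverse qvar \<odot> (basis (link SW NE) - basis (link NW SW) - basis {})"

text \<open>
  A state \<open>\<sigma>\<close> replaces every crossing by one of the crossingless diagrams with four endpoints. The
  tips are the boundary points and the corners that are attached to a univalent vertex; a component
  of the resulting diagram is a closed loop iff it contains no tip.
\<close>

definition state_conn :: "tangle \<Rightarrow> (crossing \<Rightarrow> matching) \<Rightarrow> (nat \<times> nat) set" where
  "state_conn T \<sigma> = connected_by
     (arcs T \<union> {(ports c ! i, ports c ! j) | c i j. c \<in> crossings T \<and> (i, j) \<in> \<sigma> c})"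

definition state_tips :: "tangle \<Rightarrow> (crossing \<Rightarrow> matching) \<Rightarrow> nat set" where
  "state_tips T \<sigma> = fst ` set (bd T) \<union>
     {ports c ! i | c i. c \<in> crossings T \<and> i < 4 \<and> i \<notin> Domain (\<sigma> c)}"

definition state_diagram :: "tangle \<Rightarrow> (crossing \<Rightarrow> matching) \<Rightarrow> vec" where
  "state_diagram T \<sigma> =
     (if \<exists>x\<in>points T. state_conn T \<sigma> `` {x} \<inter> state_tips T \<sigma> = {} then 0
      else basis {(i, j). i < length (bd T) \<and> j < length (bd T) \<and> i \<noteq> j \<and>
                          (fst (bd T ! i), fst (bd T ! j)) \<in> state_conn T \<sigma>})"

text \<open>A representative in \<open>P m\<close> of the vector \<open>\<Delta>(T)\<close> of \<open>P' m\<close>.\<close>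

definition Delta :: "tangle \<Rightarrow> vec" where
  "Delta T = (\<Sum>\<sigma> \<in> crossings T \<rightarrow>\<^sub>E matchings 4.
     (\<Prod>c\<in>crossings T. crossing_vec (csign c) (\<sigma> c)) \<odot> state_diagram T \<sigma>)"

section \<open>Local moves\<close>

text \<open>
  \<open>surrounding H C\<close>: \<open>C\<close> is a planar tangle diagram from which a small disk has been removed, where
  \<open>H\<close> lists the points on the boundary of this small disk with their directions as seen from
  within the small disk.
\<close>

inductive surrounding :: "(nat \<times> dir) list \<Rightarrow> tangle \<Rightarrow> bool" for H where
  "distinct (map fst H) \<Longrightarrow> surrounding H (Tangle H {} {})"
| "surrounding H C \<Longrightarrow> planar T \<Longrightarrow> points C \<inter> points T = {} \<Longrightarrow> surrounding H (beside C T)"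
| "surrounding H C \<Longrightarrow> surrounding H (move_basepoint C)"
| "surrounding H C \<Longrightarrow> joinable C \<Longrightarrow> surrounding H (join_first C)"

definition fits :: "tangle \<Rightarrow> tangle \<Rightarrow> bool" where
  "fits C L \<longleftrightarrow> surrounding (bd L) C \<and> points C \<inter> points L = fst ` set (bd L)"

definition fill :: "tangle \<Rightarrow> tangle \<Rightarrow> tangle" where
  "fill C L = Tangle (bd C) (arcs C \<union> arcs L) (crossings C \<union> crossings L)"

text \<open>
  The tangle diagrams \<open>Ts\<close> are identical except in a small disk, where they are given by the
  list \<open>Ls\<close>.
\<close>

definition identical_except :: "tangle list \<Rightarrow> tangle list \<Rightarrow> bool" where
  "identical_except Ls Ts \<longleftrightarrow>
     (\<exists>C. list_all2 (\<lambda>L T. fits C L \<and> same_diagram T (fill C L)) Ls Ts)"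

definition skein_triple :: "tangle \<Rightarrow> tangle \<Rightarrow> tangle \<Rightarrow> bool" where
  "skein_triple Tp Tm T0 \<longleftrightarrow> (\<exists>sw se ne nw. distinct [sw, se, ne, nw] \<and>
     identical_except
       [crossing_tangle Pos sw se ne nw,
        crossing_tangle Neg sw se ne nw,
        Tangle [(sw, Inward), (se, Inward), (ne, Outward), (nw, Outward)]
          {(sw, nw), (se, ne)} {}]
       [Tp, Tm, T0])"

text \<open>
  In the pictures below, each strand runs from a bottom endpoint \<open>a\<close> to a top endpoint \<open>b\<close>, and a
  Boolean tells whether this upward direction is its orientation.
\<close>

definition entry :: "bool \<Rightarrow> nat \<Rightarrow> nat \<times> dir" where
  "entry up a = (a, if up then Inward else Outward)"

definition exit :: "bool \<Rightarrow> nat \<Rightarrow> nat \<times> dir" where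
  "exit up b = (b, if up then Outward else Inward)"

definition arc :: "bool \<Rightarrow> nat \<Rightarrow> nat \<Rightarrow> nat \<times> nat" where
  "arc up x y = (if up then (x, y) else (y, x))"

text \<open>
  The crossing with corners \<open>p0\<close>, \<open>p1\<close>, \<open>p2\<close>, \<open>p3\<close> (counterclockwise from the lower left) of a
  strand on \<open>p0\<close>, \<open>p2\<close>, which is over the other one if \<open>over\<close> holds, and a strand on \<open>p1\<close>, \<open>p3\<close>.
  It is turned such that both strands run upwards, which determines its sign.
\<close>

fun cross :: "bool \<Rightarrow> bool \<Rightarrow> bool \<Rightarrow> nat \<Rightarrow> nat \<Rightarrow> nat \<Rightarrow> nat \<Rightarrow> crossing" where
  "cross over True True p0 p1 p2 p3 = Crossing (if over then Pos else Neg) [p0, p1, p2, p3]"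
| "cross over True False p0 p1 p2 p3 = Crossing (if over then Neg else Pos) [p3, p0, p1, p2]"
| "cross over False True p0 p1 p2 p3 = Crossing (if over then Neg else Pos) [p1, p2, p3, p0]"
| "cross over False False p0 p1 p2 p3 = Crossing (if over then Pos else Neg) [p2, p3, p0, p1]"

text \<open>
  Kinks. In the first case the strand runs from SW to NE, turns right and back to SE, and runs on
  to NW, so that its loop is traversed clockwise; in the second case it runs from SE to NW, turns
  left and back to SW, and runs on to NE.
\<close>

definition kink_clockwise :: "tangle \<Rightarrow> tangle \<Rightarrow> bool" where
  "kink_clockwise T T' \<longleftrightarrow> (\<exists>s a b x y. distinct [a, b, x, y] \<and>
     identical_except
       [Tangle [(a, Inward), (b, Outward)] {(a, b)} {},
        Tangle [(a, Inward), (b, Outward)] {(y, x)} {Crossing s [a, x, y, b]}]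
       [T, T'])"

definition kink_counterclockwise :: "tangle \<Rightarrow> tangle \<Rightarrow> bool" where
  "kink_counterclockwise T T' \<longleftrightarrow> (\<exists>s a b x y. distinct [a, b, x, y] \<and>
     identical_except
       [Tangle [(a, Inward), (b, Outward)] {(a, b)} {},
        Tangle [(a, Inward), (b, Outward)] {(y, x)} {Crossing s [x, a, b, y]}]
       [T, T'])"

text \<open>
  Reidemeister II: strand 0 is on the left and strand 1 on the right, and one of them passes over
  the other and back.
\<close>

definition reidemeister_II :: "tangle \<Rightarrow> tangle \<Rightarrow> bool" where
  "reidemeister_II T T' \<longleftrightarrow>
     (\<exists>d0 d1 over a0 a1 b0 b1 u0 u1 v0 v1. distinct [a0, a1, b0, b1, u0, u1, v0, v1] \<and>
       (let H = [entry d0 a0, entry d1 a1, exit d1 b1, exit d0 b0] in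
        identical_except
          [Tangle H {arc d0 a0 b0, arc d1 a1 b1} {},
           Tangle H {arc d0 u0 v0, arc d1 u1 v1}
             {cross over d0 d1 a0 a1 u0 u1, cross (\<not> over) d1 d0 v1 v0 b1 b0}]
          [T, T']))"

text \<open>
  Reidemeister III: the bottom endpoints of the strands 0, 1, 2 are ordered from left to right, the
  top endpoints from right to left. The strands are at different heights \<open>h\<close>. Seen from below, the
  crossings occur in the order 01, 02, 12 on one side of the move and 12, 02, 01 on the other.
\<close>

definition reidemeister_III :: "tangle \<Rightarrow> tangle \<Rightarrow> bool" where
  "reidemeister_III T T' \<longleftrightarrow>
     (\<exists>d0 d1 d2 (h0::nat) (h1::nat) (h2::nat) a0 a1 a2 b0 b1 b2 u0 u1 u2 v0 v1 v2.
       distinct [h0, h1, h2] \<and>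
       distinct [a0, a1, a2, b0, b1, b2, u0, u1, u2, v0, v1, v2] \<and>
       (let H = [entry d0 a0, entry d1 a1, entry d2 a2, exit d0 b0, exit d1 b1, exit d2 b2];
            A = {arc d0 u0 v0, arc d1 u1 v1, arc d2 u2 v2}
        in identical_except
          [Tangle H A
             {cross (h0 > h1) d0 d1 a0 a1 u0 u1,
              cross (h0 > h2) d0 d2 v0 a2 b0 u2,
              cross (h1 > h2) d1 d2 v1 v2 b1 b2},
           Tangle H A
             {cross (h1 > h2) d1 d2 a1 a2 u1 u2,
              cross (h0 > h2) d0 d2 a0 v2 u0 b2,
              cross (h0 > h1) d0 d1 v0 v1 b0 b1}]
          [T, T']))"

end

theory Submission
  imports Defs
begin

text \<open>
  A dotted strand is idempotent, it vanishes if one of its ends is cut, and a closed dotted loop has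
  the value \<open>- 1\<close>. Writing every strand as a dotted strand plus a cut strand splits \<open>P m\<close> according
  to the set \<open>S\<close> of dotted endpoints, and the saddle relation identifies, up to sign, all dotted
  diagrams with the same \<open>S\<close>. So a vector of the quotient is determined by the scalars \<open>Phi m v S\<close>.
  These multiply when disks are placed side by side, change by a sign when the basepoint moves past a
  dotted endpoint, and are contracted when endpoints are joined. Since \<open>Delta\<close> is compatible with the
  planar operations, a relation that holds for \<open>Phi\<close> of the local pictures holds for the whole
  diagrams. For the local pictures it is a finite identity between polynomials in \<open>q\<close> and its
  inverse, an instance of the free-fermion Yang-Baxter equation in the case of Reidemeister III.
\<close>

section \<open>Operations on matchings\<close>

text \<open>Congruence is membership in a span, so the decisive fact is that vanishing of all
  scalars \<open>Phi m v S\<close> puts \<open>v\<close> into the span of the saddle insertions. No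
  dotted basis is constructed for this: undotted matchings are filtered by the number of their
  connected endpoints, and \<open>weight M S\<close> is zero unless \<open>S\<close> lies in
  \<open>Domain M\<close>, so the scalars are triangular for this filtration. The signs rest on one
  consequence of noncrossing: a dotted strand encloses an even number of dotted endpoints. The value
  -1 of a dotted loop is the loop, which is 0, minus the cut loop, an interior edge that is deleted
  and leaves 1. On the side of the state sums the obstacle is to decide when joining two boundary
  points closes a loop. For this the induction over planar diagrams carries an exact count: every
  component of a state has 0 or 2 tips.\<close>

interpretation vec: vector_space "(\<odot>)"
  by unfold_locales (auto simp: vscale_def fun_eq_iff algebra_simps)

lemma sum_fun_apply: "(\<Sum>x\<in>A. f x) y = (\<Sum>x\<in>A. f x y)"
  for f :: "'a \<Rightarrow> 'b \<Rightarrow> 'c::comm_monoid_add"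
  by (induction A rule: infinite_finite_induct) auto

lemma vscale_apply [simp]: "(c \<odot> v) M = c * v M"
  by (simp add: vscale_def)

lemma finite_matchings [simp]: "finite (matchings m)"
  by (rule finite_subset[of _ "Pow ({..<m} \<times> {..<m})"]) (auto simp: matchings_def)

lemma matchingsI:
  assumes "\<And>i j. (i, j) \<in> M \<Longrightarrow> i < m \<and> j < m \<and> i \<noteq> j \<and> (j, i) \<in> M"
    and "\<And>i j k. (i, j) \<in> M \<Longrightarrow> (i, k) \<in> M \<Longrightarrow> j = k"
    and "\<And>i j k l. (i, j) \<in> M \<Longrightarrow> (k, l) \<in> M \<Longrightarrow> i < k \<Longrightarrow> k < j \<Longrightarrow> j < l \<Longrightarrow> False"
  shows "M \<in> matchings m"
  using assms(3) by (auto simp: matchings_def sym_def irrefl_def single_valued_def dest: assms(1,2))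

text \<open>For the last fact: the definition excludes only one crossing pattern. Applying it to
  reversed pairs excludes \<open>l < i\<close>, and uniqueness of partners excludes a common
  endpoint, so a chord that starts under another one also ends under it.\<close>

lemma matchings_sym: "M \<in> matchings m \<Longrightarrow> (i, j) \<in> M \<Longrightarrow> (j, i) \<in> M"
  and matchings_less: "M \<in> matchings m \<Longrightarrow> (i, j) \<in> M \<Longrightarrow> i < m \<and> j < m"
  and matchings_neq: "M \<in> matchings m \<Longrightarrow> (i, j) \<in> M \<Longrightarrow> i \<noteq> j"
  and matchings_unique: "M \<in> matchings m \<Longrightarrow> (i, j) \<in> M \<Longrightarrow> (i, k) \<in> M \<Longrightarrow> j = k"
  and matchings_noncrossing: "M \<in> matchings m \<Longrightarrow> (i, j) \<in> M \<Longrightarrow> (k, l) \<in> M \<Longrightarrow>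
    i < k \<Longrightarrow> k < j \<Longrightarrow> l < j \<and> i < l"
proof -
  show "M \<in> matchings m \<Longrightarrow> (i, j) \<in> M \<Longrightarrow> (j, i) \<in> M"
    and "M \<in> matchings m \<Longrightarrow> (i, j) \<in> M \<Longrightarrow> i < m \<and> j < m"
    and "M \<in> matchings m \<Longrightarrow> (i, j) \<in> M \<Longrightarrow> i \<noteq> j"
    and U: "M \<in> matchings m \<Longrightarrow> (i, j) \<in> M \<Longrightarrow> (i, k) \<in> M \<Longrightarrow> j = k" for i j k
    by (auto simp: matchings_def sym_def irrefl_def single_valued_def)
  assume M: "M \<in> matchings m" and ij: "(i, j) \<in> M" and kl: "(k, l) \<in> M" and less: "i < k" "k < j"
  have nc: "\<not> (i' < k' \<and> k' < j' \<and> j' < l')" if "(i', j') \<in> M" "(k', l') \<in> M" for i' j' k' l'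
    using M that unfolding matchings_def by blast
  have sym: "(j', i') \<in> M" if "(i', j') \<in> M" for i' j'
    using M that unfolding matchings_def sym_def by blast
  have "l \<noteq> j" using U[OF M sym[OF ij], of k] sym[OF kl] less by auto
  moreover have "l \<noteq> i" using U[OF M ij, of k] sym[OF kl] less by auto
  moreover have "\<not> l < i" using nc[OF sym[OF kl] ij] less by auto
  ultimately show "l < j \<and> i < l" using nc[OF ij kl] less by linarith
qed

lemma empty_matching [simp]: "{} \<in> matchings m"
  by (auto simp: matchings_def sym_def irrefl_def single_valued_def)

lemma link_commute: "link i j = link j i"
  by (auto simp: link_def)

lemma link_matching: "i < m \<Longrightarrow> j < m \<Longrightarrow> i \<noteq> j \<Longrightarrow> link i j \<in> matchings m"
  by (rule matchingsI) (auto simp: link_def)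

text \<open>\<open>juxt\<close>, \<open>rot\<close> and \<open>join\<close> are linear extensions of
  operations on single matchings. This common form supplies their linearity and their values on
  basis vectors.\<close>

definition extend :: "nat \<Rightarrow> (matching \<Rightarrow> vec) \<Rightarrow> vec \<Rightarrow> vec" where
  "extend m g v = (\<Sum>M\<in>matchings m. v M \<odot> g M)"

lemma extend_add: "extend m g (v + w) = extend m g v + extend m g w"
  by (simp add: extend_def vec.scale_left_distrib sum.distrib)

lemma extend_diff: "extend m g (v - w) = extend m g v - extend m g w"
  by (simp add: extend_def vec.scale_left_diff_distrib sum_subtractf)

lemma extend_scale: "extend m g (c \<odot> v) = c \<odot> extend m g v"
  by (simp add: extend_def vec.scale_sum_right)

lemma extend_zero: "extend m g 0 = 0"
  by (simp add: extend_def)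

lemma extend_sum: "extend m g (\<Sum>x\<in>A. f x) = (\<Sum>x\<in>A. extend m g (f x))"
  by (induction A rule: infinite_finite_induct) (simp_all only: sum.infinite sum.empty sum.insert extend_zero extend_add simp_thms)

lemma extend_basis: "M \<in> matchings m \<Longrightarrow> extend m g (basis M) = g M"
proof -
  assume M: "M \<in> matchings m"
  have "extend m g (basis M) = (\<Sum>N\<in>matchings m. if N = M then g M else 0)"
    unfolding extend_def basis_def by (rule sum.cong) auto
  then show ?thesis using M by simp
qed

lemma vec_eq_sum_basis: "v \<in> diagram_space m \<Longrightarrow> v = (\<Sum>M\<in>matchings m. v M \<odot> basis M)"
proof (rule ext)
  fix N assume v: "v \<in> diagram_space m"
  have "(\<Sum>M\<in>matchings m. v M \<odot> basis M) N = (\<Sum>M\<in>matchings m. if M = N then v N else 0)"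
    unfolding sum_fun_apply basis_def by (rule sum.cong) auto
  then show "v N = (\<Sum>M\<in>matchings m. v M \<odot> basis M) N"
    using v by (auto simp: diagram_space_def)
qed

lemma subspace_diagram_space: "vec.subspace (diagram_space m)"
  by (rule vec.subspaceI; clarsimp simp: diagram_space_def) (metis add.right_neutral)

lemmas diagram_space_add = vec.subspace_add[OF subspace_diagram_space]
  and diagram_space_diff = vec.subspace_diff[OF subspace_diagram_space]
  and diagram_space_scale = vec.subspace_scale[OF subspace_diagram_space]
  and diagram_space_sum = vec.subspace_sum[OF subspace_diagram_space]
  and diagram_space_zero = vec.subspace_0[OF subspace_diagram_space]

lemma basis_in_diagram_space: "M \<in> matchings m \<Longrightarrow> basis M \<in> diagram_space m"
  by (simp add: diagram_space_def basis_def)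

definition shift :: "nat \<Rightarrow> matching \<Rightarrow> matching" where
  "shift m M = (\<lambda>(i, j). (m + i, m + j)) ` M"

definition cycle :: "nat \<Rightarrow> nat \<Rightarrow> nat" where
  "cycle m i = (if i = 0 then m - 1 else i - 1)"

definition turn :: "nat \<Rightarrow> matching \<Rightarrow> matching" where
  "turn m M = (\<lambda>(i, j). (cycle m i, cycle m j)) ` M"

definition joined :: "matching \<Rightarrow> matching" where
  "joined M = {(i, j). (i + 2, j + 2) \<in> M \<or>
                    (i + 2, 0) \<in> M \<and> (1, j + 2) \<in> M \<or>
                    (i + 2, 1) \<in> M \<and> (0, j + 2) \<in> M}"

lemma join_matching_eq: "join_matching M = (if (0, 1) \<in> M then 0 else basis (joined M))"
  by (simp add: join_matching_def joined_def)

lemma juxt_eq: "juxt m v k w = extend m (\<lambda>M. extend k (\<lambda>N. basis (M \<union> shift m N)) w) v"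
  by (simp add: juxt_def extend_def shift_def vec.scale_sum_right)

lemma rot_eq: "rot m v = extend m (\<lambda>M. basis (turn m M)) v"
  by (simp add: rot_def extend_def turn_def cycle_def)

lemma join_eq: "join m v = extend m join_matching v"
  by (simp add: join_def extend_def)

lemma in_shift: "(i, j) \<in> shift m M \<longleftrightarrow> m \<le> i \<and> m \<le> j \<and> (i - m, j - m) \<in> M"
  unfolding shift_def image_iff by (auto intro: bexI[of _ "(i - m, j - m)"])

lemma juxt_matching:
  assumes "M \<in> matchings m" "N \<in> matchings k"
  shows "M \<union> shift m N \<in> matchings (m + k)"
proof (rule matchingsI)
  fix i j assume "(i, j) \<in> M \<union> shift m N"
  then show "i < m + k \<and> j < m + k \<and> i \<noteq> j \<and> (j, i) \<in> M \<union> shift m N"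
    using matchings_less[OF assms(1), of i j] matchings_less[OF assms(2), of "i - m" "j - m"]
      matchings_sym[OF assms(1), of i j] matchings_sym[OF assms(2), of "i - m" "j - m"]
      matchings_neq[OF assms(1), of i j] matchings_neq[OF assms(2), of "i - m" "j - m"]
    by (auto simp: in_shift)
next
  fix i j l assume "(i, j) \<in> M \<union> shift m N" "(i, l) \<in> M \<union> shift m N"
  then show "j = l"
    using matchings_unique[OF assms(1), of i] matchings_unique[OF assms(2), of "i - m" "j - m" "l - m"]
    by (auto simp: in_shift dest: matchings_less[OF assms(1)])
next
  fix a b c d assume "(a, b) \<in> M \<union> shift m N" "(c, d) \<in> M \<union> shift m N" "a < c" "c < b" "b < d"
  moreover have "b < m" if "(a, b) \<in> M" using matchings_less[OF assms(1) that] by simp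
  moreover have "d < m" if "(c, d) \<in> M" using matchings_less[OF assms(1) that] by simp
  moreover have False if "(a - m, b - m) \<in> N" "(c - m, d - m) \<in> N" "m \<le> a"
    using matchings_noncrossing[OF assms(2) that(1,2)] \<open>a < c\<close> \<open>c < b\<close> \<open>b < d\<close> that(3) by linarith
  ultimately show False
    using matchings_noncrossing[OF assms(1), of a b c d] by (auto simp: in_shift)
qed

lemma cycle_less: "i < m \<Longrightarrow> cycle m i < m"
  by (auto simp: cycle_def)

lemma cycle_inj: "i < m \<Longrightarrow> j < m \<Longrightarrow> cycle m i = cycle m j \<longleftrightarrow> i = j"
  by (auto simp: cycle_def)

lemma in_turn:
  assumes "M \<in> matchings m" "i < m" "j < m"
  shows "(cycle m i, cycle m j) \<in> turn m M \<longleftrightarrow> (i, j) \<in> M"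
proof
  assume "(cycle m i, cycle m j) \<in> turn m M"
  then obtain k l where kl: "(k, l) \<in> M" "cycle m i = cycle m k" "cycle m j = cycle m l"
    by (auto simp: turn_def)
  then show "(i, j) \<in> M"
    using assms matchings_less[OF assms(1) kl(1)] cycle_inj by metis
qed (auto simp: turn_def)

lemma in_turnE:
  assumes "(a, b) \<in> turn m M" "M \<in> matchings m"
  obtains i j where "a = cycle m i" "b = cycle m j" "(i, j) \<in> M" "i < m" "j < m"
  using assms matchings_less[OF assms(2)] by (auto simp: turn_def)

lemma turn_matching:
  assumes "M \<in> matchings m"
  shows "turn m M \<in> matchings m"
proof (rule matchingsI)
  fix a b assume "(a, b) \<in> turn m M"
  then obtain i j where ij: "a = cycle m i" "b = cycle m j" "(i, j) \<in> M" "i < m" "j < m"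
    using assms by (rule in_turnE)
  then show "a < m \<and> b < m \<and> a \<noteq> b \<and> (b, a) \<in> turn m M"
    using assms matchings_sym[OF assms] matchings_neq[OF assms]
    by (auto simp: cycle_less cycle_inj in_turn)
next
  fix a b c assume "(a, b) \<in> turn m M" "(a, c) \<in> turn m M"
  then show "b = c"
    using assms matchings_unique[OF assms] by (auto elim!: in_turnE simp: cycle_inj)
next
  note C = matchings_noncrossing[OF assms] and S = matchings_sym[OF assms]
  fix a b c d assume "(a, b) \<in> turn m M" "(c, d) \<in> turn m M" and less: "a < c" "c < b" "b < d"
  then obtain i j k l where
    ij: "a = cycle m i" "b = cycle m j" "(i, j) \<in> M" "i < m" "j < m" and
    kl: "c = cycle m k" "d = cycle m l" "(k, l) \<in> M" "k < m" "l < m"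
    using assms by (auto elim!: in_turnE)
  \<comment> \<open>Endpoint 0 goes to the last position \<open>m - 1\<close>, and \<open>a\<close>,
    \<open>b\<close>, \<open>c\<close> are smaller than \<open>d\<close>. So only \<open>l\<close>
    can be the moved endpoint, and then the chord from 0 to \<open>k\<close> would cross the one
    from \<open>i\<close> to \<open>j\<close>.\<close>
  have "0 < i" "0 < j" "0 < k"
    using less ij kl by (auto simp: cycle_def split: if_splits)
  have "i < k" "k < j"
    using less(1,2) ij(1,2) kl(1) \<open>0 < i\<close> \<open>0 < j\<close> \<open>0 < k\<close> by (simp_all add: cycle_def)
  show False
  proof (cases "l = 0")
    case True
    then show False
      using C[OF S[OF kl(3)] ij(3)] \<open>0 < i\<close> \<open>i < k\<close> \<open>k < j\<close> by simp
  next
    case False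
    then show False
      using C[OF ij(3) kl(3) \<open>i < k\<close> \<open>k < j\<close>] less(3) ij(2) kl(2) \<open>0 < j\<close>
      by (simp add: cycle_def) linarith
  qed
qed

text \<open>The strands at 0 and 1 do not cross, hence they are nested and the partner of 1 comes
  before the partner of 0. With this order recorded, few combinations of cases remain in the proof
  that joining preserves noncrossing.\<close>

lemma joined_cases:
  assumes "M \<in> matchings m" "(i, j) \<in> joined M"
  obtains "(i + 2, j + 2) \<in> M"
  | "(0, i + 2) \<in> M" "(1, j + 2) \<in> M" "j < i"
  | "(1, i + 2) \<in> M" "(0, j + 2) \<in> M" "i < j"
proof -
  have "j < i" if "(0, i + 2) \<in> M" "(1, j + 2) \<in> M"
    using matchings_noncrossing[OF assms(1) that] by simp
  moreover have "i < j" if "(1, i + 2) \<in> M" "(0, j + 2) \<in> M"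
    using matchings_noncrossing[OF assms(1) that(2,1)] by simp
  ultimately show thesis
    using assms matchings_sym[OF assms(1)] that unfolding joined_def by blast
qed

lemma joined_matching:
  assumes "M \<in> matchings (m + 2)"
  shows "joined M \<in> matchings m"
proof (rule matchingsI)
  fix i j assume ij: "(i, j) \<in> joined M"
  have "(j, i) \<in> joined M"
    using ij matchings_sym[OF assms] unfolding joined_def by blast
  moreover from assms ij have "i < m \<and> j < m \<and> i \<noteq> j"
    by (cases rule: joined_cases) (use matchings_less[OF assms] matchings_neq[OF assms] in fastforce)+
  ultimately show "i < m \<and> j < m \<and> i \<noteq> j \<and> (j, i) \<in> joined M" by blast
next
  note S = matchings_sym[OF assms] and U = matchings_unique[OF assms]
  fix i j k assume ij: "(i, j) \<in> joined M" and ik: "(i, k) \<in> joined M"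
  have U1: False if "(0, x) \<in> M" "(1, x) \<in> M" for x
    using U[OF S[OF that(1)] S[OF that(2)]] by simp
  have U2: False if "(x, y + 2) \<in> M" "(0, x) \<in> M \<or> (1, x) \<in> M" for x y
    using that U[OF that(1) S] by fastforce
  from assms ij show "j = k"
  proof (cases rule: joined_cases)
    case 1 note ij = this
    from assms ik show ?thesis
      by (cases rule: joined_cases) (use U[of "i + 2" "j + 2" "k + 2"] U2 ij in auto)
  next
    case 2 note ij = this
    from assms ik show ?thesis
      by (cases rule: joined_cases) (use U[of 1 "j + 2" "k + 2"] U1 U2 ij in auto)
  next
    case 3 note ij = this
    from assms ik show ?thesis
      by (cases rule: joined_cases) (use U[of 0 "j + 2" "k + 2"] U1 U2 ij in auto)
  qed
next
  note C = matchings_noncrossing[OF assms]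
  fix a b c d assume ab: "(a, b) \<in> joined M" and cd: "(c, d) \<in> joined M"
    and less: "a < c" "c < b" "b < d"
  from assms ab show False
  proof (cases rule: joined_cases)
    case 1 note ab = this
    from assms cd show ?thesis
    proof (cases rule: joined_cases)
      case 1
      then show ?thesis using C[OF ab 1] less by simp
    next
      case 3
      then show ?thesis using C[OF ab matchings_sym[OF assms 3(1)]] less by simp
    qed (use less in simp)
  next
    case 3 note ab = this
    from assms cd show ?thesis
    proof (cases rule: joined_cases)
      case 1
      then show ?thesis using C[OF ab(2) 1] less by simp
    next
      case 3
      then show ?thesis using matchings_unique[OF assms 3(1) ab(1)]
          matchings_unique[OF assms 3(2) ab(2)] less by simp
    qed (use less in simp)
  qed (use less in simp)
qed

section \<open>Weights of dotted strands\<close>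

text \<open>
  Every strand of a matching is the sum of a dotted strand and a cut strand; \<open>S\<close> is the set of the
  endpoints of the dotted ones. Modulo saddles a dotted diagram is \<open>\<plusminus>\<close> the diagram that joins the
  endpoints in \<open>S\<close> in consecutive pairs. The sign is the product over all dotted strands of the
  parity of the rank in \<open>S\<close> of their first endpoint.
\<close>

definition opens :: "matching \<Rightarrow> nat set \<Rightarrow> nat set" where
  "opens M S = {i \<in> S. \<exists>j\<in>S. (i, j) \<in> M \<and> i < j}"

definition covers :: "matching \<Rightarrow> nat set \<Rightarrow> bool" where
  "covers M S \<longleftrightarrow> (\<forall>i\<in>S. \<exists>j\<in>S. (i, j) \<in> M)"

definition weight :: "matching \<Rightarrow> nat set \<Rightarrow> scalar" where
  "weight M S = (if covers M S then \<Prod>i\<in>opens M S. (- 1) ^ card (S \<inter> {..<i}) else 0)"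

text \<open>Passing to the partner is an involution of \<open>S\<close> without fixed points that
  exchanges the first and second endpoints of the dotted strands. The evenness of
  \<open>card S\<close> is the source of the sign cancellations below.\<close>

lemma card_covers:
  assumes M: "M \<in> matchings m" and "finite S" "covers M S"
  shows "card S = 2 * card (opens M S)"
proof -
  define p where "p i = (SOME j. j \<in> S \<and> (i, j) \<in> M)" for i
  have p: "p i \<in> S \<and> (i, p i) \<in> M" if "i \<in> S" for i
    unfolding p_def by (rule someI_ex) (use assms(3) that in \<open>auto simp: covers_def\<close>)
  have pp: "p (p i) = i" if "i \<in> S" for i
    using p[OF that] p[of "p i"] matchings_unique[OF M] matchings_sym[OF M] by blast
  have "i < p i \<or> p i < i" if "i \<in> S" for i
    using p[OF that] matchings_neq[OF M, of i "p i"] by linarith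
  moreover have opens: "i \<in> opens M S \<longleftrightarrow> i \<in> S \<and> i < p i" for i
    unfolding opens_def using p matchings_unique[OF M] by blast
  ultimately have "bij_betw p (opens M S) (S - opens M S)"
    by (intro bij_betw_byWitness[where f' = p]) (use p pp in fastforce)+
  then have "card (S - opens M S) = card (opens M S)"
    using bij_betw_same_card by metis
  moreover have "opens M S \<subseteq> S" by (auto simp: opens_def)
  ultimately show ?thesis
    using assms(2) by (metis card_Diff_subset card_mono finite_subset le_add_diff_inverse mult_2)
qed

text \<open>The sign only sees the order and the pairing of the dotted endpoints. This settles the
  cases in which an operation renumbers the endpoints without touching a dotted strand.\<close>

lemma weight_reindex:
  assumes less: "\<And>i j. i \<in> S \<Longrightarrow> j \<in> S \<Longrightarrow> i < j \<Longrightarrow> f i < f j"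
    and mem: "\<And>i j. i \<in> S \<Longrightarrow> j \<in> S \<Longrightarrow> (f i, f j) \<in> M' \<longleftrightarrow> (i, j) \<in> M"
  shows "weight M' (f ` S) = weight M S"
proof -
  have less_iff: "f i < f j \<longleftrightarrow> i < j" if "i \<in> S" "j \<in> S" for i j
    using less[OF that] less[OF that(2,1)] by (cases i j rule: linorder_cases) auto
  have inj: "inj_on f S"
    by (rule inj_onI) (metis less_iff linorder_cases order_less_irrefl)
  have "covers M' (f ` S) = covers M S"
    using mem by (auto simp: covers_def)
  moreover have "opens M' (f ` S) = f ` opens M S"
    unfolding opens_def by (auto simp: mem less_iff intro!: imageI)
  moreover have "f ` S \<inter> {..<f i} = f ` (S \<inter> {..<i})" if "i \<in> S" for i
    using that less_iff by auto
  then have "card (f ` S \<inter> {..<f i}) = card (S \<inter> {..<i})" if "i \<in> S" for i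
    using that inj by (simp add: card_image inj_on_Int)
  moreover have "opens M S \<subseteq> S" by (auto simp: opens_def)
  ultimately show ?thesis
    unfolding weight_def
    by (auto simp: prod.reindex inj_on_subset[OF inj] intro!: prod.cong)
qed

lemma weight_juxt:
  assumes M: "M \<in> matchings m" and A: "A \<subseteq> {..<m}" and B: "finite B"
  shows "weight (M \<union> shift m N) (A \<union> (+) m ` B) = weight M A * weight N B"
proof -
  let ?S = "A \<union> (+) m ` B"
  have fin: "finite A" using A finite_subset by blast
  have less: "i < m" "j < m" if "(i, j) \<in> M" for i j
    using matchings_less[OF M that] by auto
  have covers: "covers (M \<union> shift m N) ?S \<longleftrightarrow> covers M A \<and> covers N B"
  proof
    assume L: "covers (M \<union> shift m N) ?S"
    have "\<exists>j\<in>A. (i, j) \<in> M" if "i \<in> A" for i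
    proof -
      have "i \<in> ?S" using that by (rule UnI1)
      from bspec[OF L[unfolded covers_def] this] obtain j
        where "j \<in> ?S" "(i, j) \<in> M \<union> shift m N" by (rule bexE)
      then show ?thesis using A that less[of i j] by (auto simp: in_shift)
    qed
    moreover have "\<exists>j\<in>B. (i, j) \<in> N" if "i \<in> B" for i
    proof -
      have "m + i \<in> ?S" using that by simp
      from bspec[OF L[unfolded covers_def] this] obtain j
        where "j \<in> ?S" "(m + i, j) \<in> M \<union> shift m N" by (rule bexE)
      then show ?thesis using A less[of "m + i" j] by (auto simp: in_shift)
    qed
    ultimately show "covers M A \<and> covers N B" by (simp add: covers_def)
  next
    assume R: "covers M A \<and> covers N B"
    show "covers (M \<union> shift m N) ?S"
      unfolding covers_def
    proof
      fix i assume "i \<in> ?S"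
      then consider "i \<in> A" | k where "i = m + k" "k \<in> B" by blast
      then show "\<exists>j\<in>?S. (i, j) \<in> M \<union> shift m N"
      proof cases
        case 1
        then show ?thesis using R unfolding covers_def by blast
      next
        case 2
        then obtain l where "l \<in> B" "(k, l) \<in> N" using R unfolding covers_def by blast
        then show ?thesis using 2 by (intro bexI[of _ "m + l"]) (auto simp: in_shift)
      qed
    qed
  qed
  have opens: "opens (M \<union> shift m N) ?S = opens M A \<union> (+) m ` opens N B"
  proof (intro equalityI subsetI)
    fix i assume "i \<in> opens (M \<union> shift m N) ?S"
    then show "i \<in> opens M A \<union> (+) m ` opens N B"
      using A less unfolding opens_def by (fastforce simp: in_shift)
  next
    fix i assume "i \<in> opens M A \<union> (+) m ` opens N B"
    then consider "i \<in> opens M A" | k where "i = m + k" "k \<in> opens N B" by blast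
    then show "i \<in> opens (M \<union> shift m N) ?S"
    proof cases
      case 2
      then obtain l where "k \<in> B" "l \<in> B" "(k, l) \<in> N" "k < l" by (auto simp: opens_def)
      then show ?thesis using 2(1) by (auto simp: opens_def in_shift intro!: bexI[of _ "m + l"])
    qed (auto simp: opens_def)
  qed
  show ?thesis
  proof (cases "covers M A \<and> covers N B")
    case True
    \<comment> \<open>The ranks in the second disk are raised by \<open>card A\<close>. As this
      number is even, no sign arises between the disks.\<close>
    have "even (card A)"
      using card_covers[OF M fin] True by simp
    have "finite (opens M A)" "finite (opens N B)"
      using fin B by (auto simp: opens_def)
    moreover have "opens M A \<inter> (+) m ` opens N B = {}"
      using A by (auto simp: opens_def)
    moreover have "(\<Prod>i\<in>opens M A. (- 1) ^ card (?S \<inter> {..<i}) :: scalar)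
        = (\<Prod>i\<in>opens M A. (- 1) ^ card (A \<inter> {..<i}))"
    proof (rule prod.cong[OF refl])
      fix i assume "i \<in> opens M A"
      then have "?S \<inter> {..<i} = A \<inter> {..<i}"
        using A by (auto simp: opens_def)
      then show "(- 1) ^ card (?S \<inter> {..<i}) = ((- 1) ^ card (A \<inter> {..<i}) :: scalar)" by simp
    qed
    moreover have "(- 1) ^ card (?S \<inter> {..<m + i}) = ((- 1) ^ card (B \<inter> {..<i}) :: scalar)" for i
    proof -
      have "?S \<inter> {..<m + i} = A \<union> (+) m ` (B \<inter> {..<i})"
        using A by auto
      moreover have "A \<inter> (+) m ` (B \<inter> {..<i}) = {}"
        using A by auto
      ultimately have "card (?S \<inter> {..<m + i}) = card A + card (B \<inter> {..<i})"
        using fin B by (simp add: card_Un_disjoint card_image)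
      then show ?thesis using \<open>even (card A)\<close> by (simp add: power_add)
    qed
    ultimately show ?thesis
      using True covers
      by (simp add: weight_def opens prod.union_disjoint prod.reindex)
  qed (auto simp: weight_def covers)
qed

text \<open>Moving a dotted endpoint 0 to the end lowers the rank of every other first endpoint by
  one. This gives a factor -1 for each dotted strand except the one at 0, hence
  \<open>(card S - 1) div 2\<close> factors, as \<open>card S\<close> is even. The strand at 0 now
  starts at its former partner \<open>p\<close>; its rank was 0 and becomes the number of dotted
  endpoints strictly under the strand, which is even.\<close>

lemma weight_turn:
  assumes M: "M \<in> matchings m" and S: "S \<subseteq> {..<m}"
  shows "weight (turn m M) (cycle m ` S) =
    (if 0 \<in> S then (- 1) ^ ((card S - 1) div 2) else 1) * weight M S"
proof (cases "0 \<in> S")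
  case False
  have "weight (turn m M) (cycle m ` S) = weight M S"
  proof (rule weight_reindex)
    fix i j assume "i \<in> S" "j \<in> S"
    then show "(cycle m i, cycle m j) \<in> turn m M \<longleftrightarrow> (i, j) \<in> M"
      using in_turn[OF M] S by auto
    assume "i < j"
    moreover have "0 < i" using False \<open>i \<in> S\<close> by (cases i) auto
    ultimately show "cycle m i < cycle m j" by (simp add: cycle_def)
  qed
  then show ?thesis using False by simp
next
  case True
  let ?S = "cycle m ` S"
  have fin: "finite S" using S finite_subset by blast
  have inj: "inj_on (cycle m) S"
    using S cycle_inj by (intro inj_onI) (metis lessThan_iff subsetD)
  have mem: "(cycle m i, cycle m j) \<in> turn m M \<longleftrightarrow> (i, j) \<in> M" if "i \<in> S" "j \<in> S" for i j
    using in_turn[OF M] S that by auto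
  have covers: "covers (turn m M) ?S = covers M S"
    using mem by (auto simp: covers_def)
  show ?thesis
  proof (cases "covers M S")
    case cov: True
    then obtain p where p: "p \<in> S" "(0, p) \<in> M"
      using True by (auto simp: covers_def)
    have "p \<noteq> 0" using matchings_neq[OF M p(2)] by simp
    have p0: "(p, 0) \<in> M" using matchings_sym[OF M p(2)] .
    have U: "j = p" if "(0, j) \<in> M" for j using matchings_unique[OF M p(2) that] by simp
    have U0: "j = 0" if "(p, j) \<in> M" for j using matchings_unique[OF M p0 that] by simp
    let ?O = "opens M S - {0}"
    have O: "opens M S = insert 0 ?O" "p \<notin> ?O" "?O \<subseteq> S"
      using True p \<open>p \<noteq> 0\<close> U0 by (auto simp: opens_def)
    have cyc: "cycle m i = i - 1" if "i \<noteq> 0" for i using that by (simp add: cycle_def)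
    have c0: "cycle m i < m - 1" if "i \<noteq> 0" "i \<in> S" for i using that S by (auto simp: cycle_def)
    have "opens (turn m M) ?S = cycle m ` insert p ?O"
    proof (intro equalityI subsetI)
      fix a assume "a \<in> opens (turn m M) ?S"
      then obtain i j where ij: "i \<in> S" "j \<in> S" "a = cycle m i" "(i, j) \<in> M" "cycle m i < cycle m j"
        using mem by (auto simp: opens_def)
      have "i \<noteq> 0" using c0[of j] ij matchings_neq[OF M ij(4)] by (auto simp: cycle_def split: if_splits)
      show "a \<in> cycle m ` insert p ?O"
      proof (cases "j = 0")
        case True
        then have "i = p" using U matchings_sym[OF M ij(4)] by simp
        then show ?thesis using ij by simp
      next
        case False
        then have "i < j" using ij(5) \<open>i \<noteq> 0\<close> by (simp add: cyc)
        then show ?thesis using ij \<open>i \<noteq> 0\<close> by (auto simp: opens_def)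
      qed
    next
      fix a assume "a \<in> cycle m ` insert p ?O"
      then consider "a = cycle m p" | i where "a = cycle m i" "i \<in> ?O" by blast
      then show "a \<in> opens (turn m M) ?S"
      proof cases
        case 1
        moreover have "cycle m p < cycle m 0" using c0[OF \<open>p \<noteq> 0\<close> p(1)] by (simp add: cycle_def)
        moreover have "(cycle m p, cycle m 0) \<in> turn m M" using mem p True p0 by simp
        ultimately show ?thesis using p True unfolding opens_def by blast
      next
        case 2
        then obtain j where j: "i \<in> S" "j \<in> S" "(i, j) \<in> M" "i < j" "i \<noteq> 0" by (auto simp: opens_def)
        moreover have "cycle m i < cycle m j" using j by (simp add: cyc)
        moreover have "(cycle m i, cycle m j) \<in> turn m M" using mem j by simp
        ultimately show ?thesis using 2 unfolding opens_def by blast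
      qed
    qed
    moreover have "inj_on (cycle m) (insert p ?O)"
      using inj p by (rule_tac inj_on_subset) (auto simp: opens_def)
    ultimately have "(\<Prod>i\<in>opens (turn m M) ?S. (- 1) ^ card (?S \<inter> {..<i}) :: scalar)
       = (\<Prod>i\<in>insert p ?O. (- 1) ^ card (?S \<inter> {..<cycle m i}))"
      by (simp only: prod.reindex comp_def)
    also have "\<dots> = (- 1) ^ card (?S \<inter> {..<cycle m p}) * (\<Prod>i\<in>?O. (- 1) ^ card (?S \<inter> {..<cycle m i}))"
      using O(2) finite_subset[OF O(3) fin] by (simp add: prod.insert)
    also have "(\<Prod>i\<in>?O. (- 1) ^ card (?S \<inter> {..<cycle m i}) :: scalar)
       = (\<Prod>i\<in>?O. - 1 * (- 1) ^ card (S \<inter> {..<i}))"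
    proof (rule prod.cong[OF refl])
      fix i assume i: "i \<in> ?O"
      then have "i \<in> S" "i \<noteq> 0" using O(3) by auto
      have "?S \<inter> {..<cycle m i} = cycle m ` (S \<inter> {..<i} - {0})"
      proof (intro equalityI subsetI)
        fix a assume "a \<in> cycle m ` (S \<inter> {..<i} - {0})"
        then obtain j where j: "j \<in> S" "a = cycle m j" "j < i" "j \<noteq> 0" by auto
        then have "cycle m j < cycle m i" using \<open>i \<noteq> 0\<close> by (simp add: cyc diff_less_mono)
        then show "a \<in> ?S \<inter> {..<cycle m i}" using j by blast
      next
        fix a assume "a \<in> ?S \<inter> {..<cycle m i}"
        then obtain j where j: "j \<in> S" "a = cycle m j" "cycle m j < cycle m i" by auto
        then have "j \<noteq> 0" using c0[OF \<open>i \<noteq> 0\<close> \<open>i \<in> S\<close>] by (auto simp: cycle_def split: if_splits)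
        then show "a \<in> cycle m ` (S \<inter> {..<i} - {0})" using j \<open>i \<noteq> 0\<close> by (auto simp: cyc)
      qed
      then have "card (?S \<inter> {..<cycle m i}) = card (S \<inter> {..<i} - {0})"
        using inj by (simp add: card_image inj_on_Int inj_on_diff)
      moreover have "card (S \<inter> {..<i}) = Suc (card (S \<inter> {..<i} - {0}))"
        using True \<open>i \<noteq> 0\<close> fin by (intro card.remove) auto
      ultimately show "(- 1) ^ card (?S \<inter> {..<cycle m i}) = (- 1 * (- 1) ^ card (S \<inter> {..<i}) :: scalar)"
        by simp
    qed
    also have "\<dots> = (- 1) ^ card ?O * (\<Prod>i\<in>?O. (- 1) ^ card (S \<inter> {..<i}))"
      by (simp only: prod.distrib prod_constant)
    also have "(\<Prod>i\<in>?O. (- 1) ^ card (S \<inter> {..<i}) :: scalar) = (\<Prod>i\<in>opens M S. (- 1) ^ card (S \<inter> {..<i}))"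
      using O finite_subset[OF O(3) fin] by (subst O(1), subst prod.insert) auto
    also have "card ?O = (card S - 1) div 2"
    proof -
      have "card (opens M S) = Suc (card ?O)"
        using O finite_subset[OF O(3) fin] by (subst O(1), subst card_insert_disjoint) auto
      then show ?thesis using card_covers[OF M fin cov] by simp
    qed
    also have "((- 1) ^ card (?S \<inter> {..<cycle m p}) :: scalar) = 1"
    proof -
      \<comment> \<open>By noncrossing, the dotted endpoints strictly between 0 and \<open>p\<close>
        are paired among themselves.\<close>
      let ?X = "S \<inter> {0<..<p}"
      have "?S \<inter> {..<cycle m p} = cycle m ` ?X"
      proof (intro equalityI subsetI)
        fix a assume "a \<in> cycle m ` ?X"
        then obtain j where j: "j \<in> S" "a = cycle m j" "j < p" "j \<noteq> 0" by auto
        then have "cycle m j < cycle m p" using \<open>p \<noteq> 0\<close> by (simp add: cyc diff_less_mono)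
        then show "a \<in> ?S \<inter> {..<cycle m p}" using j by blast
      next
        fix a assume "a \<in> ?S \<inter> {..<cycle m p}"
        then obtain j where j: "j \<in> S" "a = cycle m j" "cycle m j < cycle m p" by auto
        then have "j \<noteq> 0" using c0[OF \<open>p \<noteq> 0\<close> p(1)] by (auto simp: cycle_def split: if_splits)
        then show "a \<in> cycle m ` ?X" using j \<open>p \<noteq> 0\<close> by (auto simp: cyc)
      qed
      then have "card (?S \<inter> {..<cycle m p}) = card ?X"
        using inj by (simp add: card_image inj_on_Int)
      moreover have "covers M ?X"
        unfolding covers_def
      proof
        fix i assume i: "i \<in> ?X"
        then obtain j where j: "j \<in> S" "(i, j) \<in> M" using cov by (auto simp: covers_def)
        then show "\<exists>j\<in>?X. (i, j) \<in> M"
          using matchings_noncrossing[OF M p(2) j(2)] i by auto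
      qed
      then have "even (card ?X)" using card_covers[OF M] fin by simp
      ultimately show ?thesis by simp
    qed
    finally show ?thesis using True cov covers by (simp add: weight_def)
  qed (use covers in \<open>simp add: weight_def\<close>)
qed

text \<open>If 0 and 1 are joined to each other, both terms on the right agree and cancel, as a
  closed loop requires. If their partners \<open>a\<close> and \<open>b\<close> are both dotted,
  only the second term survives: its first endpoints 0 and 1 have ranks 0 and 1, while the joined
  strand starts at \<open>b\<close>, which has even rank, so one factor -1 remains. In all other
  cases the second term is zero.\<close>

lemma weight_joined:
  assumes M: "M \<in> matchings (m + 2)" and fin: "finite S"
  shows "(if (0, 1) \<in> M then 0 else weight (joined M) S) =
    weight M ((+) 2 ` S) - weight M ({0, 1} \<union> (+) 2 ` S)"
proof (cases "(0, 1) \<in> M")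
  case True
  \<comment> \<open>A strand from 0 to 1 splits off as the left factor of a juxtaposition, so
    \<open>weight_juxt\<close> evaluates both terms.\<close>
  have "M = link 0 1 \<union> shift 2 {(i, j). (i + 2, j + 2) \<in> M}" (is "_ = _ \<union> shift 2 ?N")
  proof (intro equalityI subrelI)
    fix i j assume ij: "(i, j) \<in> M"
    have e1: "j = 1" if "i = 0" using that matchings_unique[OF M True] ij by simp
    have e2: "j = 0" if "i = 1" using that matchings_unique[OF M matchings_sym[OF M True]] ij by simp
    have e3: "i = 1" if "j = 0"
      using that matchings_unique[OF M True] matchings_sym[OF M ij] by simp
    have e4: "i = 0" if "j = 1"
      using that matchings_unique[OF M matchings_sym[OF M True]] matchings_sym[OF M ij] by simp
    consider "i = 0" | "i = 1" | "j = 0" | "j = 1" | "2 \<le> i \<and> 2 \<le> j" by linarith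
    then show "(i, j) \<in> link 0 1 \<union> shift 2 ?N"
    proof cases
      case 5
      then show ?thesis using ij by (simp add: in_shift del: add_2_eq_Suc')
    next
      case 1
      then show ?thesis using e1 by (simp add: link_def)
    next
      case 2
      then show ?thesis using e2 by (simp add: link_def)
    next
      case 3
      then show ?thesis using e3 by (simp add: link_def)
    next
      case 4
      then show ?thesis using e4 by (simp add: link_def)
    qed
  next
    fix i j assume "(i, j) \<in> link 0 1 \<union> shift 2 ?N"
    then show "(i, j) \<in> M" using True matchings_sym[OF M True]
      by (auto simp: link_def in_shift simp del: add_2_eq_Suc')
  qed
  moreover have "link 0 1 \<in> matchings 2" by (rule link_matching) auto
  ultimately have "weight M ((+) 2 ` S) = weight (link 0 1) {} * weight ?N S"
    and "weight M ({0, 1} \<union> (+) 2 ` S) = weight (link 0 1) {0, 1} * weight ?N S"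
    using weight_juxt[of "link 0 1" 2 "{}" S ?N] weight_juxt[of "link 0 1" 2 "{0, 1}" S ?N] fin
    by auto
  moreover have "weight (link 0 1) {} = 1" by (simp add: weight_def covers_def opens_def)
  moreover have "weight (link 0 1) {0, 1} = 1"
  proof -
    have "opens (link 0 1) {0, 1} = {0}" by (auto simp: opens_def link_def)
    then show ?thesis by (auto simp: weight_def covers_def link_def)
  qed
  ultimately show ?thesis using True by simp
next
  case False
  note U = matchings_unique[OF M] and Sy = matchings_sym[OF M]
  let ?S2 = "(+) 2 ` S" and ?T = "{0, 1} \<union> (+) 2 ` S"
  have neq: "(0, 0) \<notin> M" "(1, 1) \<notin> M" "(1, 0) \<notin> M"
    using matchings_neq[OF M] Sy False by blast+
  show ?thesis
  proof (cases "\<exists>a\<in>S. \<exists>b\<in>S. (0, a + 2) \<in> M \<and> (1, b + 2) \<in> M")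
    case True
    then obtain a b where ab: "a \<in> S" "b \<in> S" "(0, a + 2) \<in> M" "(1, b + 2) \<in> M" by blast
    have "b < a" using matchings_noncrossing[OF M ab(3,4)] by simp
    have U0: "j = a + 2" if "(0, j) \<in> M" for j using U[OF ab(3) that] by simp
    have U1: "j = b + 2" if "(1, j) \<in> M" for j using U[OF ab(4) that] by simp
    have Ua: "j = 0" if "(a + 2, j) \<in> M" for j using U[OF Sy[OF ab(3)] that] by simp
    have Ub: "j = 1" if "(b + 2, j) \<in> M" for j using U[OF Sy[OF ab(4)] that] by simp
    have J: "(i, j) \<in> joined M \<longleftrightarrow> (i + 2, j + 2) \<in> M \<or> i = a \<and> j = b \<or> i = b \<and> j = a" for i j
    proof -
      have "(0, k + 2) \<in> M \<longleftrightarrow> k = a" "(1, k + 2) \<in> M \<longleftrightarrow> k = b" for k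
        using ab U0 U1 by auto
      moreover from this have "(k + 2, 0) \<in> M \<longleftrightarrow> k = a" "(k + 2, 1) \<in> M \<longleftrightarrow> k = b" for k
        using Sy by blast+
      ultimately show ?thesis by (simp add: joined_def)
    qed
    have "\<not> covers M ?S2"
      using ab(1) Ua unfolding covers_def by (fastforce simp: add.commute)
    then have 0: "weight M ?S2 = 0" by (simp add: weight_def)
    have covers: "covers (joined M) S \<longleftrightarrow> covers M ?T"
    proof
      assume L: "covers (joined M) S"
      show "covers M ?T" unfolding covers_def
      proof
        fix i assume "i \<in> ?T"
        then consider "i = 0" | "i = 1" | k where "i = k + 2" "k \<in> S" by auto
        then show "\<exists>j\<in>?T. (i, j) \<in> M"
        proof cases
          case 3
          then obtain l where "l \<in> S" "(k, l) \<in> joined M" using L by (auto simp: covers_def)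
          then have "(i, l + 2) \<in> M \<or> (i, 0) \<in> M \<or> (i, 1) \<in> M"
            using J 3 Sy[OF ab(3)] Sy[OF ab(4)] by auto
          moreover have "l + 2 \<in> ?T" "0 \<in> ?T" "1 \<in> ?T" using \<open>l \<in> S\<close> by simp_all
          ultimately show ?thesis by blast
        qed (use ab in \<open>auto simp: add.commute\<close>)
      qed
    next
      assume R: "covers M ?T"
      show "covers (joined M) S" unfolding covers_def
      proof
        fix i assume i: "i \<in> S"
        then have "i + 2 \<in> ?T" by simp
        from bspec[OF R[unfolded covers_def] this]
        obtain j where j: "j \<in> ?T" "(i + 2, j) \<in> M" by (rule bexE)
        consider "j = 0" | "j = 1" | k where "j = k + 2" "k \<in> S" using j(1) by auto
        then show "\<exists>j\<in>S. (i, j) \<in> joined M"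
        proof cases
          case 1
          then have "(i + 2, 0) \<in> M" using j(2) by simp
          from U0[OF Sy[OF this]] have "i = a" by simp
          then show ?thesis using J ab by auto
        next
          case 2
          then have "(i + 2, 1) \<in> M" using j(2) by simp
          from U1[OF Sy[OF this]] have "i = b" by simp
          then show ?thesis using J ab by auto
        qed (use J j in auto)
      qed
    qed
    show ?thesis
    proof (cases "covers M ?T")
      case cov: True
      let ?O = "opens (joined M) S - {b}"
      have O: "opens (joined M) S = insert b ?O" using ab J \<open>b < a\<close> by (auto simp: opens_def)
      have T: "opens M ?T = {0, 1} \<union> (+) 2 ` ?O"
      proof (intro equalityI subsetI)
        fix i assume i: "i \<in> opens M ?T"
        then obtain j where j: "j \<in> ?T" "(i, j) \<in> M" "i < j" by (auto simp: opens_def)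
        show "i \<in> {0, 1} \<union> (+) 2 ` ?O"
        proof (cases "i \<le> 1")
          case False
          then obtain k l where kl: "i = k + 2" "j = l + 2" "k \<in> S" "l \<in> S"
            using i j by (auto simp: opens_def)
          moreover have "k \<noteq> b" using Ub[of j] j kl by auto
          ultimately have "k \<in> ?O" using j J by (auto simp: opens_def)
          then show ?thesis using kl by auto
        qed auto
      next
        fix i assume "i \<in> {0, 1} \<union> (+) 2 ` ?O"
        then consider "i = 0" | "i = 1" | k where "i = 2 + k" "k \<in> ?O" by blast
        then show "i \<in> opens M ?T"
        proof cases
          case 3
          then obtain l where kl: "k \<in> S" "l \<in> S" "(k, l) \<in> joined M" "k < l" "k \<noteq> b"
            by (auto simp: opens_def)
          then have "(k + 2, l + 2) \<in> M" using J \<open>b < a\<close> by auto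
          then show ?thesis using 3 kl unfolding opens_def by (fastforce simp: add.commute)
        qed (use ab in \<open>fastforce simp: opens_def add.commute\<close>)+
      qed
      have fO: "finite ?O" using fin by (auto simp: opens_def)
      have c: "card (?T \<inter> {..<2 + i}) = 2 + card (S \<inter> {..<i})" for i
      proof -
        have "?T \<inter> {..<2 + i} = {0, 1} \<union> (+) 2 ` (S \<inter> {..<i})" by auto
        moreover have "{0, 1} \<inter> (+) 2 ` (S \<inter> {..<i}) = {}" by auto
        ultimately show ?thesis using fin by (simp add: card_Un_disjoint card_image inj_on_def)
      qed
      have split: "prod f ({0, 1} \<union> (+) 2 ` ?O) = f 0 * f 1 * (\<Prod>i\<in>?O. f (2 + i))" for f :: "nat \<Rightarrow> scalar"
      proof -
        have "prod f ({0, 1} \<union> (+) 2 ` ?O) = prod f {0, 1} * prod f ((+) 2 ` ?O)"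
          by (rule prod.union_disjoint) (use fO in auto)
        moreover have "prod f ((+) 2 ` ?O) = (\<Prod>i\<in>?O. f (2 + i))"
          by (subst prod.reindex) (simp_all add: inj_on_def comp_def)
        ultimately show ?thesis by simp
      qed
      have "((- 1) ^ card (?T \<inter> {..<2 + i}) :: scalar) = (- 1) ^ card (S \<inter> {..<i})" for i
        by (simp only: c power_add) simp
      then have "(\<Prod>i\<in>opens M ?T. (- 1) ^ card (?T \<inter> {..<i}) :: scalar)
        = (- 1) ^ card (?T \<inter> {..<0}) * (- 1) ^ card (?T \<inter> {..<1}) * (\<Prod>i\<in>?O. (- 1) ^ card (S \<inter> {..<i}))"
        by (simp only: T split)
      moreover have "?T \<inter> {..<1} = {0}" "?T \<inter> {..<0} = {}" by auto
      then have "((- 1) ^ card (?T \<inter> {..<0}) * (- 1) ^ card (?T \<inter> {..<1}) :: scalar) = - 1"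
        by (simp only:) simp
      moreover have "(\<Prod>i\<in>opens (joined M) S. (- 1) ^ card (S \<inter> {..<i}) :: scalar)
        = (- 1) ^ card (S \<inter> {..<b}) * (\<Prod>i\<in>?O. (- 1) ^ card (S \<inter> {..<i}))"
        using prod.insert[OF fO, of b "\<lambda>i. (- 1) ^ card (S \<inter> {..<i}) :: scalar"]
        by (simp only: O[symmetric]) simp
      moreover have "((- 1) ^ card (S \<inter> {..<b}) :: scalar) = 1"
      proof -
        \<comment> \<open>The strand at 1 encloses an even number of dotted endpoints. Up to the
          shift by 2 these are the ones counted by the rank of \<open>b\<close>.\<close>
        let ?X = "?T \<inter> {1<..<b + 2}"
        have "covers M ?X"
          unfolding covers_def
        proof
          fix i assume i: "i \<in> ?X"
          then obtain j where j: "j \<in> ?T" "(i, j) \<in> M" using cov unfolding covers_def by blast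
          then show "\<exists>j\<in>?X. (i, j) \<in> M"
            using matchings_noncrossing[OF M ab(4) j(2)] i by auto
        qed
        then have "even (card ?X)" using card_covers[OF M] fin by simp
        moreover have "?X = (+) 2 ` (S \<inter> {..<b})" by auto
        ultimately show ?thesis by (simp add: card_image inj_on_def)
      qed
      ultimately show ?thesis using False 0 cov covers by (simp add: weight_def)
    qed (use False 0 covers in \<open>simp add: weight_def\<close>)
  next
    case nab: False
    have "\<not> covers M ?T"
    proof
      assume "covers M ?T"
      then obtain i j where "i \<in> ?T" "(0, i) \<in> M" "j \<in> ?T" "(1, j) \<in> M"
        unfolding covers_def by (meson UnI1 insertCI)
      then show False using nab neq False by (auto simp: add.commute)
    qed
    moreover have "weight (joined M) S = weight M ?S2"
    proof (cases "\<exists>a\<in>S. (0, a + 2) \<in> M \<or> (1, a + 2) \<in> M")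
      case True
      then obtain a where a: "a \<in> S" "(0, a + 2) \<in> M \<or> (1, a + 2) \<in> M" by blast
      have "\<not> covers M ?S2"
      proof
        assume "covers M ?S2"
        then obtain j where "j \<in> S" "(a + 2, j + 2) \<in> M" using a(1) by (fastforce simp: covers_def add.commute)
        then show False using a(2) U[OF Sy] by fastforce
      qed
      moreover have "\<not> covers (joined M) S"
      proof
        assume "covers (joined M) S"
        then obtain j where j: "j \<in> S" "(a, j) \<in> joined M" using a(1) by (auto simp: covers_def)
        from M j(2) show False
        proof (cases rule: joined_cases)
          case 1
          then show ?thesis using a(2) U[OF Sy] by fastforce
        qed (use nab a j in blast)+
      qed
      ultimately show ?thesis by (simp add: weight_def)
    next
      case none: False
      have "weight M ?S2 = weight (joined M) S"
      proof (rule weight_reindex)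
        fix i j assume "i \<in> S" "j \<in> S"
        then show "(2 + i, 2 + j) \<in> M \<longleftrightarrow> (i, j) \<in> joined M"
          using none Sy unfolding joined_def by (auto simp: add.commute)
      qed simp
      then show ?thesis by simp
    qed
    ultimately show ?thesis using False by (simp add: weight_def)
  qed
qed

section \<open>The quotient by the saddle relation\<close>

text \<open>The coefficient of the class on the standard dotted diagram that joins consecutive
  points of \<open>S\<close>. That diagram has weight 1, since its first endpoints have even
  ranks.\<close>

definition Phi :: "nat \<Rightarrow> vec \<Rightarrow> nat set \<Rightarrow> scalar" where
  "Phi m v S = (\<Sum>M\<in>matchings m. v M * weight M S)"

lemma Phi_add: "Phi m (v + w) S = Phi m v S + Phi m w S"
  by (simp add: Phi_def distrib_right sum.distrib)

lemma Phi_diff: "Phi m (v - w) S = Phi m v S - Phi m w S"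
  by (simp add: Phi_def left_diff_distrib sum_subtractf)

lemma Phi_scale: "Phi m (c \<odot> v) S = c * Phi m v S"
  by (simp add: Phi_def sum_distrib_left mult.assoc)

lemma Phi_zero: "Phi m 0 S = 0"
  by (simp add: Phi_def)

lemma Phi_sum: "Phi m (\<Sum>x\<in>A. f x) S = (\<Sum>x\<in>A. Phi m (f x) S)"
  by (induction A rule: infinite_finite_induct)
    (simp_all only: sum.infinite sum.empty sum.insert Phi_zero Phi_add simp_thms)

lemma Phi_basis: "M \<in> matchings m \<Longrightarrow> Phi m (basis M) S = weight M S"
proof -
  assume "M \<in> matchings m"
  have "Phi m (basis M) S = (\<Sum>N\<in>matchings m. if N = M then weight M S else 0)"
    unfolding Phi_def basis_def by (rule sum.cong) auto
  then show ?thesis using \<open>M \<in> matchings m\<close> by simp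
qed

lemma Phi_extend: "Phi k (extend m g v) S = (\<Sum>M\<in>matchings m. v M * Phi k (g M) S)"
  by (simp add: extend_def Phi_sum Phi_scale)

lemma Phi_juxt:
  assumes "A \<subseteq> {..<m}" "B \<subseteq> {..<k}"
  shows "Phi (m + k) (juxt m v k w) (A \<union> (+) m ` B) = Phi m v A * Phi k w B"
proof -
  have "finite B" using assms(2) finite_subset by blast
  have "Phi (m + k) (juxt m v k w) (A \<union> (+) m ` B) =
    (\<Sum>M\<in>matchings m. \<Sum>N\<in>matchings k. v M * (w N * (weight M A * weight N B)))"
    unfolding juxt_eq Phi_extend sum_distrib_left
    by (intro sum.cong refl) (simp add: Phi_basis juxt_matching weight_juxt[OF _ assms(1) \<open>finite B\<close>])
  also have "\<dots> = Phi m v A * Phi k w B"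
    unfolding Phi_def sum_product by (intro sum.cong refl) (simp add: mult_ac)
  finally show ?thesis .
qed

lemma Phi_rot:
  assumes "S \<subseteq> {..<m}"
  shows "Phi m (rot m v) (cycle m ` S) =
    (if 0 \<in> S then (- 1) ^ ((card S - 1) div 2) else 1) * Phi m v S"
proof -
  let ?c = "if 0 \<in> S then (- 1) ^ ((card S - 1) div 2) else 1 :: scalar"
  have "Phi m (rot m v) (cycle m ` S) = (\<Sum>M\<in>matchings m. v M * (?c * weight M S))"
    unfolding rot_eq Phi_extend
    by (intro sum.cong refl) (simp only: Phi_basis turn_matching weight_turn[OF _ assms])
  then show ?thesis
    unfolding Phi_def sum_distrib_left by (simp only: mult_ac)
qed

lemma Phi_join:
  assumes "S \<subseteq> {..<m}"
  shows "Phi m (join (m + 2) v) S =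
    Phi (m + 2) v ((+) 2 ` S) - Phi (m + 2) v ({0, 1} \<union> (+) 2 ` S)"
proof -
  have "finite S" using assms finite_subset by blast
  have "Phi m (join_matching M) S = weight M ((+) 2 ` S) - weight M ({0, 1} \<union> (+) 2 ` S)"
    if "M \<in> matchings (m + 2)" for M
    using weight_joined[OF that \<open>finite S\<close>] joined_matching[OF that]
    by (auto simp: join_matching_eq Phi_basis Phi_zero)
  then have "Phi m (join (m + 2) v) S = (\<Sum>M\<in>matchings (m + 2).
      v M * (weight M ((+) 2 ` S) - weight M ({0, 1} \<union> (+) 2 ` S)))"
    unfolding join_eq Phi_extend by (intro sum.cong refl) simp
  then show ?thesis
    unfolding Phi_def by (simp only: right_diff_distrib sum_subtractf)
qed

text \<open>\<open>Phi_rot\<close> evaluates only images under \<open>cycle m\<close>. As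
  \<open>cycle m\<close> permutes the endpoints, this reaches every set of endpoints.\<close>

lemma cycle_subset:
  assumes "S \<subseteq> {..<m}"
  obtains S' where "S' \<subseteq> {..<m}" "S = cycle m ` S'"
proof
  show "{i. i < m \<and> cycle m i \<in> S} \<subseteq> {..<m}" by auto
  show "S = cycle m ` {i. i < m \<and> cycle m i \<in> S}"
  proof (intro equalityI subsetI)
    fix a assume a: "a \<in> S"
    let ?i = "if a = m - 1 then 0 else a + 1"
    have "a < m" using a assms by auto
    then have "cycle m ?i = a" "?i < m" by (auto simp: cycle_def)
    then show "a \<in> cycle m ` {i. i < m \<and> cycle m i \<in> S}"
      using a by (intro image_eqI[of _ _ ?i]) simp_all
  qed auto
qed

lemma split_subset:
  fixes m k :: nat
  assumes "S \<subseteq> {..<m + k}"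
  obtains A B where "A \<subseteq> {..<m}" "B \<subseteq> {..<k}" "S = A \<union> (+) m ` B"
proof
  show "S \<inter> {..<m} \<subseteq> {..<m}" by auto
  show "{i. m + i \<in> S} \<subseteq> {..<k}"
  proof
    fix i assume "i \<in> {i. m + i \<in> S}"
    then have "m + i < m + k" using assms by blast
    then show "i \<in> {..<k}" by simp
  qed
  show "S = S \<inter> {..<m} \<union> (+) m ` {i. m + i \<in> S}"
  proof (intro equalityI subsetI)
    fix a assume "a \<in> S"
    then show "a \<in> S \<inter> {..<m} \<union> (+) m ` {i. m + i \<in> S}"
      by (cases "a < m") (auto simp: image_iff intro!: exI[of _ "a - m"])
  qed auto
qed

section \<open>Vanishing of the scalars on saddle insertions\<close>

lemma link01: "link 0 1 \<in> matchings 2"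
  by (rule link_matching) auto

lemma subset_2: "S \<subseteq> {..<2::nat} \<Longrightarrow> S = {} \<or> S = {0} \<or> S = {1} \<or> S = {0, 1}"
proof -
  assume "S \<subseteq> {..<2::nat}"
  then have "S \<in> Pow {0, 1}" by (auto simp: less_2_cases_iff)
  then show ?thesis by (simp add: Pow_insert) blast
qed

lemma weight_empty_matching: "weight {} S = (if S = {} then 1 else 0)"
  by (auto simp: weight_def covers_def opens_def)

lemma weight_link01:
  "S \<subseteq> {..<2} \<Longrightarrow> weight (link 0 1) S = (if S = {} \<or> S = {0, 1} then 1 else 0)"
proof -
  have "opens (link 0 1) {0, 1} = {0}" by (auto simp: opens_def link_def)
  moreover assume "S \<subseteq> {..<2}"
  ultimately show ?thesis
    using subset_2[of S] by (auto simp: weight_def covers_def link_def opens_def)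
qed

lemma Phi_dotted_strand:
  "S \<subseteq> {..<2} \<Longrightarrow> Phi 2 dotted_strand S = (if S = {0, 1} then 1 else 0)"
  by (simp only: dotted_strand_def Phi_diff Phi_basis link01 empty_matching weight_link01
      weight_empty_matching) auto

text \<open>Only the full set of four endpoints detects the two dotted pairings. The first pairing
  has value 1 there; the second is its rotation and gets the sign
  \<open>(- 1) ^ ((4 - 1) div 2)\<close>, which is -1.\<close>

lemma Phi_saddle:
  assumes "S \<subseteq> {..<4}"
  shows "Phi 4 saddle S = 0"
proof -
  let ?d = "juxt 2 dotted_strand 2 dotted_strand"
  have d: "Phi 4 ?d S = (if S = {..<4} then 1 else 0)" if S: "S \<subseteq> {..<4}" for S
  proof -
    obtain A B where AB: "A \<subseteq> {..<2}" "B \<subseteq> {..<2}" "S = A \<union> (+) 2 ` B"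
      using split_subset[of S 2 2] S by auto
    have "S = {..<4} \<longleftrightarrow> A = {0, 1} \<and> B = {0, 1}"
    proof
      assume "S = {..<4}"
      then have "0 \<in> S" "1 \<in> S" "2 \<in> S" "3 \<in> S" by auto
      then have "0 \<in> A" "1 \<in> A" "0 \<in> B" "1 \<in> B" using AB by auto
      then show "A = {0, 1} \<and> B = {0, 1}" using subset_2[OF AB(1)] subset_2[OF AB(2)] by auto
    next
      assume "A = {0, 1} \<and> B = {0, 1}"
      then show "S = {..<4}" using AB(3) by auto
    qed
    then show ?thesis
      using Phi_juxt[OF AB(1,2), of dotted_strand dotted_strand] AB by (simp add: Phi_dotted_strand)
  qed
  obtain S' where S': "S' \<subseteq> {..<4}" "S = cycle 4 ` S'" using cycle_subset[OF assms] .
  have "S = {..<4} \<longleftrightarrow> S' = {..<4}"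
  proof -
    have "inj_on (cycle 4) {..<4}" by (auto simp: inj_on_def cycle_inj)
    then have "card S = card S'" using S' by (simp add: card_image inj_on_subset)
    then show ?thesis
      using assms S'(1) by (metis card_subset_eq finite_lessThan)
  qed
  then have "Phi 4 (rot 4 ?d) S = (if S = {..<4} then - 1 else 0)"
    using Phi_rot[OF S'(1), of ?d] d[OF S'(1)] S'(2) by auto
  then show ?thesis
    using d[OF assms] by (simp add: saddle_def Phi_add)
qed

text \<open>Every planar operation expresses the scalars of its result through those of its
  argument, so the vanishing spreads from the saddle to all its insertions.\<close>

lemma Phi_saddle_insertion:
  "saddle_insertion m v \<Longrightarrow> S \<subseteq> {..<m} \<Longrightarrow> Phi m v S = 0"
proof (induction arbitrary: S rule: saddle_insertion.induct)
  case saddle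
  then show ?case by (rule Phi_saddle)
next
  case (juxt m v M k)
  obtain A B where "A \<subseteq> {..<m}" "B \<subseteq> {..<k}" "S = A \<union> (+) m ` B"
    using split_subset[OF juxt.prems] .
  then show ?case using juxt by (simp add: Phi_juxt)
next
  case (rot m v)
  obtain S' where "S' \<subseteq> {..<m}" "S = cycle m ` S'" using cycle_subset[OF rot.prems] .
  then show ?case using rot by (simp add: Phi_rot)
next
  case (join m v)
  have "(+) 2 ` S \<subseteq> {..<m + 2}" "{0, 1} \<union> (+) 2 ` S \<subseteq> {..<m + 2}"
    using join.prems by auto
  then show ?case using join by (simp add: Phi_join del: add_2_eq_Suc')
qed

subsection \<open>Saddles and smaller diagrams\<close>

text \<open>
  In terms of undotted strands a saddle relates two diagrams only up to diagrams with fewer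
  strands.
\<close>

definition lower :: "nat \<Rightarrow> nat \<Rightarrow> vec set" where
  "lower m c = vec.span ({u. saddle_insertion m u} \<union>
     {basis K | K. K \<in> matchings m \<and> card (Domain K) < c})"

lemma lower_subspace: "vec.subspace (lower m c)"
  by (simp add: lower_def)

lemmas lower_add = vec.subspace_add[OF lower_subspace]
  and lower_diff = vec.subspace_diff[OF lower_subspace]
  and lower_scale = vec.subspace_scale[OF lower_subspace]
  and lower_zero = vec.subspace_0[OF lower_subspace]

lemma saddle_lower: "saddle_insertion m u \<Longrightarrow> u \<in> lower m c"
  by (simp add: lower_def vec.span_base)

lemma basis_lower: "K \<in> matchings m \<Longrightarrow> card (Domain K) < c \<Longrightarrow> basis K \<in> lower m c"
  unfolding lower_def by (rule vec.span_base) blast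

lemma lower_induct [consumes 1, case_names saddle basis add scale zero]:
  assumes "v \<in> lower m c"
    and "\<And>u. saddle_insertion m u \<Longrightarrow> P u"
    and "\<And>K. K \<in> matchings m \<Longrightarrow> card (Domain K) < c \<Longrightarrow> P (basis K)"
    and "\<And>u w. P u \<Longrightarrow> P w \<Longrightarrow> P (u + w)"
    and "\<And>a u. P u \<Longrightarrow> P (a \<odot> u)"
    and "P 0"
  shows "P v"
proof -
  have "vec.subspace {u. P u}"
    using assms(4-6) by (intro vec.subspaceI) auto
  then show ?thesis
    using vec.span_induct[OF assms(1)[unfolded lower_def], of P] assms(2,3) by blast
qed

lemma finite_matching: "M \<in> matchings m \<Longrightarrow> finite M"
  by (rule finite_subset[of _ "{..<m} \<times> {..<m}"]) (auto simp: matchings_def)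

lemma Domain_less: "M \<in> matchings m \<Longrightarrow> Domain M \<subseteq> {..<m}"
  by (auto dest: matchings_less)

lemma Domain_turn: "Domain (turn m M) = cycle m ` Domain M"
  by (force simp: turn_def)

lemma card_Domain_turn: "M \<in> matchings m \<Longrightarrow> card (Domain (turn m M)) = card (Domain M)"
  unfolding Domain_turn
  using Domain_less by (intro card_image inj_onI) (metis cycle_inj lessThan_iff subsetD)

lemma Domain_juxt: "Domain (M \<union> shift m N) = Domain M \<union> (+) m ` Domain N"
  by (force simp: shift_def)

lemma card_Domain_juxt:
  assumes "M \<in> matchings m" "N \<in> matchings k"
  shows "card (Domain (M \<union> shift m N)) = card (Domain M) + card (Domain N)"
  unfolding Domain_juxt using assms finite_matching[OF assms(1)] finite_matching[OF assms(2)]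
    Domain_less[OF assms(1)]
  by (subst card_Un_disjoint) (auto simp: card_image finite_Domain)

lemma rot_basis: "M \<in> matchings m \<Longrightarrow> rot m (basis M) = basis (turn m M)"
  by (simp add: rot_eq extend_basis)

lemma juxt_basis: "M \<in> matchings m \<Longrightarrow> N \<in> matchings k \<Longrightarrow>
    juxt m (basis M) k (basis N) = basis (M \<union> shift m N)"
  by (simp add: juxt_eq extend_basis)

lemma join_basis: "M \<in> matchings m \<Longrightarrow> join m (basis M) = join_matching M"
  by (simp add: join_eq extend_basis)

lemma rot_lower: "v \<in> lower m c \<Longrightarrow> rot m v \<in> lower m c"
proof (induction rule: lower_induct)
  case (saddle u)
  then show ?case by (intro saddle_lower saddle_insertion.rot)
next
  case (basis K)
  then show ?case by (simp add: rot_basis basis_lower turn_matching card_Domain_turn)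
next
  case (add u w)
  then show ?case unfolding rot_eq extend_add by (rule lower_add)
next
  case (scale a u)
  then show ?case unfolding rot_eq extend_scale by (rule lower_scale)
next
  case zero
  then show ?case unfolding rot_eq extend_zero by (rule lower_zero)
qed

text \<open>Placing \<open>N\<close> beside a diagram adds exactly the connected endpoints of
  \<open>N\<close>, which determines the shift of the filtration level.\<close>

lemma juxt_lower:
  assumes "v \<in> lower m c" and N: "N \<in> matchings k"
  shows "juxt m v k (basis N) \<in> lower (m + k) (c + card (Domain N))"
  using assms(1)
proof (induction rule: lower_induct)
  case (saddle u)
  then show ?case using N by (intro saddle_lower saddle_insertion.juxt)
next
  case (basis K)
  then show ?case using N by (simp add: juxt_basis basis_lower juxt_matching card_Domain_juxt)
next
  case (add u w)
  then show ?case unfolding juxt_eq extend_add by (rule lower_add)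
next
  case (scale a u)
  then show ?case unfolding juxt_eq extend_scale by (rule lower_scale)
next
  case zero
  then show ?case unfolding juxt_eq extend_zero by (rule lower_zero)
qed

section \<open>Inserting a saddle at the endpoints 0 and 1 of a matching\<close>

lemma turn_power_matching: "M \<in> matchings m \<Longrightarrow> (turn m ^^ k) M \<in> matchings m"
  by (induction k) (auto intro: turn_matching)

lemma rot_power_basis: "M \<in> matchings m \<Longrightarrow> (rot m ^^ k) (basis M) = basis ((turn m ^^ k) M)"
  by (induction k) (auto simp: rot_basis turn_power_matching)

lemma in_turn_power:
  "M \<in> matchings m \<Longrightarrow> i < m \<Longrightarrow> j < m \<Longrightarrow>
    (i, j) \<in> (turn m ^^ k) M \<longleftrightarrow> ((i + k) mod m, (j + k) mod m) \<in> M"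
proof (induction k arbitrary: i j)
  case (Suc k)
  have c: "cycle m ((a + 1) mod m) = a" if "a < m" for a
    using that by (cases "a + 1 = m") (auto simp: cycle_def)
  have "(i, j) \<in> (turn m ^^ Suc k) M \<longleftrightarrow> ((i + 1) mod m, (j + 1) mod m) \<in> (turn m ^^ k) M"
    using in_turn[OF turn_power_matching[OF Suc.prems(1)], of "(i + 1) mod m" "(j + 1) mod m"] Suc.prems
      c[OF Suc.prems(2)] c[OF Suc.prems(3)] by simp
  then show ?case using Suc by (simp add: mod_add_left_eq mod_add_right_eq add.commute add.left_commute)
qed simp

lemma matching_eqI:
  assumes "M \<in> matchings m" "N \<subseteq> {..<m} \<times> {..<m}"
    and "\<And>i j. i < m \<Longrightarrow> j < m \<Longrightarrow> (i, j) \<in> M \<longleftrightarrow> (i, j) \<in> N"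
  shows "M = N"
  using assms(2,3) matchings_less[OF assms(1)] by fast

lemma turn_power_self: "M \<in> matchings m \<Longrightarrow> (turn m ^^ m) M = M"
proof (rule matching_eqI[OF turn_power_matching])
  assume M: "M \<in> matchings m"
  then show "M \<subseteq> {..<m} \<times> {..<m}" by (simp add: matchings_def)
  show "(i, j) \<in> (turn m ^^ m) M \<longleftrightarrow> (i, j) \<in> M" if "i < m" "j < m" for i j
    using that by (simp add: in_turn_power[OF M])
qed

lemma rot_power_diff:
  "(rot m ^^ k) (v - w) = (rot m ^^ k) v - (rot m ^^ k) w"
  by (induction k) (simp_all only: funpow.simps comp_apply id_apply rot_eq extend_diff)

lemma rot_power_add:
  "(rot m ^^ k) (v + w) = (rot m ^^ k) v + (rot m ^^ k) w"
  by (induction k) (simp_all only: funpow.simps comp_apply id_apply rot_eq extend_add)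

text \<open>Expanding the dots leaves two leading terms with four connected endpoints, both with
  coefficient 1. The other terms connect at most two endpoints and will be absorbed in
  \<open>lower\<close>.\<close>

lemma saddle_expand:
  "saddle = basis (link 0 1 \<union> link 2 3) - basis (link 0 1) - (basis (link 2 3) - basis {})
     + (basis (link 0 3 \<union> link 1 2) - basis (link 0 3) - (basis (link 1 2) - basis {}))"
proof -
  have s: "shift 2 (link 0 1) = link 2 3" "shift 2 {} = {}"
    by (auto simp: shift_def link_def)
  have d: "juxt 2 dotted_strand 2 dotted_strand =
      basis (link 0 1 \<union> link 2 3) - basis (link 0 1) - (basis (link 2 3) - basis {})"
    by (simp only: dotted_strand_def juxt_eq extend_diff extend_basis link01 empty_matching s
        Un_empty_left Un_empty_right)
  have l: "link 0 1 \<in> matchings 4" "link 2 3 \<in> matchings 4" "link 0 1 \<union> link 2 3 \<in> matchings 4"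
    using juxt_matching[OF link01 link01] s by (auto intro: link_matching)
  have t: "turn 4 (link 0 1) = link 0 3" "turn 4 (link 2 3) = link 1 2" "turn 4 {} = {}"
    "turn 4 (link 0 1 \<union> link 2 3) = link 0 3 \<union> link 1 2"
    by (auto simp: turn_def link_def cycle_def)
  show ?thesis
    by (simp only: saddle_def d rot_eq extend_diff extend_basis l empty_matching t)
qed

text \<open>
  The result of connecting the endpoints 2 and 3 of a diagram \<open>K\<close> with four endpoints to the
  endpoints 1 and 0 of \<open>N\<close>, whose partners are \<open>b\<close> and \<open>a\<close>.
\<close>

definition graft :: "nat \<Rightarrow> nat \<Rightarrow> matching \<Rightarrow> matching \<Rightarrow> matching" where
  "graft a b N K = {(i, j).
     i < 2 \<and> j < 2 \<and> (i, j) \<in> K \<or> 2 \<le> i \<and> 2 \<le> j \<and> (i, j) \<in> N \<or>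
     i < 2 \<and> (i, 3) \<in> K \<and> j = a \<or> i = a \<and> j < 2 \<and> (3, j) \<in> K \<or>
     (i < 2 \<and> (i, 2) \<in> K \<or> i = a \<and> (3, 2) \<in> K) \<and> j = b \<or>
     i = b \<and> (j < 2 \<and> (2, j) \<in> K \<or> j = a \<and> (2, 3) \<in> K)}"

text \<open>The numbers of rotations bring the pair to be joined to the front. After
  \<open>juxt\<close> the endpoints of \<open>N\<close> are numbered from 4 on. Three rotations
  bring 3 and 4 to the front. After their joining the order is 5, ..., \<open>m + 3\<close>, 0, 1,
  2, and \<open>m + 1\<close> rotations, one less than a full turn, put 2 before 5. The last
  \<open>m - 2\<close> rotations make the endpoints 0 and 1 of \<open>v\<close> the first ones of
  the result.\<close>

definition compose :: "nat \<Rightarrow> matching \<Rightarrow> vec \<Rightarrow> vec" where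
  "compose m N v = (rot m ^^ (m - 2)) (join (m + 2) ((rot (m + 2) ^^ (m + 1))
     (join (m + 4) ((rot (m + 4) ^^ 3) (juxt 4 v m (basis N))))))"

lemma compose_add: "compose m N (v + w) = compose m N v + compose m N w"
  by (simp only: compose_def juxt_eq join_eq extend_add rot_power_add)

lemma compose_diff: "compose m N (v - w) = compose m N v - compose m N w"
  by (simp only: compose_def juxt_eq join_eq extend_diff rot_power_diff)

lemma saddle_insertion_rot_power: "saddle_insertion m v \<Longrightarrow> saddle_insertion m ((rot m ^^ k) v)"
  by (induction k) (auto intro: saddle_insertion.rot)

lemma compose_saddle:
  assumes "N \<in> matchings m"
  shows "saddle_insertion m (compose m N saddle)"
proof -
  have m4: "m + 2 + 2 = m + 4" by simp
  have "saddle_insertion (m + 4) (juxt 4 saddle m (basis N))"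
    using saddle_insertion.juxt[OF saddle_insertion.saddle assms] by (simp add: add.commute)
  then have "saddle_insertion (m + 2 + 2) ((rot (m + 4) ^^ 3) (juxt 4 saddle m (basis N)))"
    unfolding m4 by (rule saddle_insertion_rot_power)
  from saddle_insertion.join[OF this] show ?thesis
    unfolding compose_def m4
    by (intro saddle_insertion_rot_power saddle_insertion.join)
qed

text \<open>Membership in the result is pulled back through all rotations and joins to the
  juxtaposed matching \<open>R0\<close>. In terms of the labels of \<open>R0\<close> it becomes the
  disjunction that defines \<open>graft\<close>.\<close>

lemma compose_basis:
  assumes N: "N \<in> matchings m" and a: "(0, a) \<in> N" "2 \<le> a" and b: "(1, b) \<in> N"
    and K: "K \<in> matchings 4"
  shows "compose m N (basis K) = basis (graft a b N K) \<and> graft a b N K \<in> matchings m"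
proof -
  note U = matchings_unique[OF N] and S = matchings_sym[OF N]
  have "2 \<le> b" using matchings_noncrossing[OF N a(1) b] a(2) matchings_neq[OF N b]
    U[OF a(1) S[of 1 0]] b by (cases "b = 0") auto
  have m: "a < m" "b < m" using matchings_less[OF N a(1)] matchings_less[OF N b] by auto
  have n0: "(0, j) \<in> N \<longleftrightarrow> j = a" "(j, 0) \<in> N \<longleftrightarrow> j = a" for j using a U S by blast+
  have n1: "(1, j) \<in> N \<longleftrightarrow> j = b" "(j, 1) \<in> N \<longleftrightarrow> j = b" for j using b U S by blast+
  have K4: "i < 4 \<and> j < 4" if "(i, j) \<in> K" for i j using matchings_less[OF K that] .
  define R0 where "R0 = K \<union> shift 4 N"
  define R1 where "R1 = (turn (m + 4) ^^ 3) R0"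
  define R2 where "R2 = joined R1"
  define R3 where "R3 = (turn (m + 2) ^^ (m + 1)) R2"
  define R4 where "R4 = joined R3"
  define R5 where "R5 = (turn m ^^ (m - 2)) R4"
  have R0: "R0 \<in> matchings (m + 4)" unfolding R0_def using juxt_matching[OF K N] by (simp add: add.commute)
  have m4: "m + 2 + 2 = m + 4" by simp
  have R1: "R1 \<in> matchings (m + 2 + 2)" unfolding m4 R1_def by (rule turn_power_matching[OF R0])
  have R2: "R2 \<in> matchings (m + 2)" unfolding R2_def by (rule joined_matching[OF R1])
  have R3: "R3 \<in> matchings (m + 2)" unfolding R3_def by (rule turn_power_matching[OF R2])
  have R4: "R4 \<in> matchings m" unfolding R4_def by (rule joined_matching[OF R3])
  have R5: "R5 \<in> matchings m" unfolding R5_def by (rule turn_power_matching[OF R4])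
  have in0: "(x, y) \<in> R0 \<longleftrightarrow> (x, y) \<in> K \<or> 4 \<le> x \<and> 4 \<le> y \<and> (x - 4, y - 4) \<in> N" for x y
    by (auto simp: R0_def in_shift)
  \<comment> \<open>\<open>u i\<close> is the label in \<open>R0\<close> of the endpoint in position
    \<open>i\<close> after the first join: three rotations and two removed endpoints shift it by
    5.\<close>
  define u where "u i = (i + 5) mod (m + 4)" for i
  have in1: "(i, j) \<in> R1 \<longleftrightarrow> ((i + 3) mod (m + 4), (j + 3) mod (m + 4)) \<in> R0"
    if "i < m + 4" "j < m + 4" for i j
    unfolding R1_def using in_turn_power[OF R0 that] by simp
  have u5: "(i + 2 + 3) mod (m + 4) = u i" for i
    by (simp add: u_def add.commute)
  have in2: "(i, j) \<in> R2 \<longleftrightarrow> (u i, u j) \<in> R0 \<or> (u i, 3) \<in> R0 \<and> (4, u j) \<in> R0 \<or>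
      (u i, 4) \<in> R0 \<and> (3, u j) \<in> R0" if "i < m + 2" "j < m + 2" for i j
    using that m unfolding R2_def joined_def by (simp add: in1 u5[simplified] u_def add.commute)
  have in3: "(i, j) \<in> R3 \<longleftrightarrow> ((i + (m + 1)) mod (m + 2), (j + (m + 1)) mod (m + 2)) \<in> R2"
    if "i < m + 2" "j < m + 2" for i j
    unfolding R3_def by (rule in_turn_power[OF R2 that])
  have "(i + 2 + (m + 1)) mod (m + 2) = i + 1" if "i < m" for i
    using that by (simp add: mod_if)
  moreover have "(1 + (m + 1)) mod (m + 2) = 0" by simp
  ultimately have in4: "(i, j) \<in> R4 \<longleftrightarrow> (i + 1, j + 1) \<in> R2 \<or> (i + 1, m + 1) \<in> R2 \<and> (0, j + 1) \<in> R2 \<or>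
      (i + 1, 0) \<in> R2 \<and> (m + 1, j + 1) \<in> R2" if "i < m" "j < m" for i j
    using that m unfolding R4_def joined_def by (simp add: in3 del: add_2_eq_Suc')
  \<comment> \<open>\<open>lab i\<close> is the label in \<open>R0\<close> of the endpoint
    \<open>i\<close> of the final disk. The endpoints 0 and 1 belong to \<open>K\<close>; the others
    are endpoints of \<open>N\<close>, shifted by 4.\<close>
  define lab where "lab i = (if i < 2 then i else i + 4)" for i :: nat
  have lab: "u ((i + (m - 2)) mod m + 1) = lab i" if "i < m" for i
  proof (cases "i < 2")
    case True
    then have "(i + (m - 2)) mod m + 1 + 5 = i + (m + 4)" using m a(2) by simp
    then show ?thesis using True by (simp only: u_def lab_def) simp
  next
    case False
    then have "i + (m - 2) = (i - 2) + m" using m a(2) by simp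
    then have "(i + (m - 2)) mod m = i - 2" using that by (simp only: mod_add_self2 mod_less less_imp_diff_less)
    then show ?thesis using False that by (simp add: u_def lab_def)
  qed
  have u: "u 0 = 5" "u (m + 1) = 2" using m a(2) by (simp_all add: u_def mod_if)
  \<comment> \<open>Connection of two labels when the first arc, from 3 to 4, is present. The second
    arc joins 2 and 5.\<close>
  let ?C = "\<lambda>x y. (x, y) \<in> R0 \<or> (x, 3) \<in> R0 \<and> (4, y) \<in> R0 \<or> (x, 4) \<in> R0 \<and> (3, y) \<in> R0"
  have in5: "(i, j) \<in> R5 \<longleftrightarrow> ?C (lab i) (lab j) \<or> ?C (lab i) 2 \<and> ?C 5 (lab j) \<or>
      ?C (lab i) 5 \<and> ?C 2 (lab j)" if "i < m" "j < m" for i j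
  proof -
    have "(i, j) \<in> R5 \<longleftrightarrow> ((i + (m - 2)) mod m, (j + (m - 2)) mod m) \<in> R4"
      unfolding R5_def using in_turn_power[OF R4 that] .
    moreover have lt: "(i + (m - 2)) mod m < m" "(j + (m - 2)) mod m < m" using that by simp_all
    ultimately show ?thesis
      using that by (simp only: in4[OF lt] in2 lab u add_less_mono lt less_add_same_cancel1)
  qed
  have K_lab: "(lab i, y) \<in> K \<longleftrightarrow> i < 2 \<and> (i, y) \<in> K" "(y, lab i) \<in> K \<longleftrightarrow> i < 2 \<and> (y, i) \<in> K" for i y
    using K4 by (auto simp: lab_def)
  have K_ge: "(x, y) \<in> K \<longleftrightarrow> False" if "4 \<le> x \<or> 4 \<le> y" for x y
    using K4[of x y] that by auto
  have "R5 = graft a b N K"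
  proof (rule matching_eqI[OF R5])
    show "graft a b N K \<subseteq> {..<m} \<times> {..<m}"
      using m a(2) \<open>2 \<le> b\<close> matchings_less[OF N] by (auto simp: graft_def)
    fix i j assume ij: "i < m" "j < m"
    have 1: "(lab i, lab j) \<in> R0 \<longleftrightarrow> i < 2 \<and> j < 2 \<and> (i, j) \<in> K \<or> 2 \<le> i \<and> 2 \<le> j \<and> (i, j) \<in> N"
      unfolding in0 K_lab by (auto simp: lab_def)
    have 2: "(lab i, 3) \<in> R0 \<longleftrightarrow> i < 2 \<and> (i, 3) \<in> K" "(lab i, 2) \<in> R0 \<longleftrightarrow> i < 2 \<and> (i, 2) \<in> K"
       "(3, lab j) \<in> R0 \<longleftrightarrow> j < 2 \<and> (3, j) \<in> K" "(2, lab j) \<in> R0 \<longleftrightarrow> j < 2 \<and> (2, j) \<in> K"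
      unfolding in0 K_lab by auto
    have 3: "(lab i, 4) \<in> R0 \<longleftrightarrow> i = a" "(lab i, 5) \<in> R0 \<longleftrightarrow> i = b"
       "(4, lab j) \<in> R0 \<longleftrightarrow> j = a" "(5, lab j) \<in> R0 \<longleftrightarrow> j = b"
      unfolding in0 K_lab using a(2) \<open>2 \<le> b\<close> n0 n1 by (auto simp: lab_def K_ge)
    have 4: "(4, 2) \<notin> R0" "(4, 5) \<notin> R0" "(5, 3) \<notin> R0" "(5, 4) \<notin> R0" "(2, 4) \<notin> R0" "(3, 5) \<notin> R0"
      "(4, 3) \<notin> R0" "(2, 5) \<notin> R0" "(3, 4) \<notin> R0" "(5, 2) \<notin> R0"
      "(3, 2) \<in> R0 \<longleftrightarrow> (3, 2) \<in> K" "(2, 3) \<in> R0 \<longleftrightarrow> (2, 3) \<in> K"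
      unfolding in0 using n0(1)[of 1] n0(2)[of 1] a(2) by (auto simp: K_ge)
    show "(i, j) \<in> R5 \<longleftrightarrow> (i, j) \<in> graft a b N K"
      unfolding in5[OF ij] 1 2 3 graft_def using 4 by auto
  qed
  moreover have "compose m N (basis K) = basis R5"
  proof -
    \<comment> \<open>No join closes a loop: 3 and 4 belong to different diagrams, and 2 could reach
      5 only through a strand of \<open>N\<close> from 0 to 1, which \<open>2 \<le> a\<close>
      excludes.\<close>
    have "(0, 1) \<notin> R1"
    proof -
      have "(3 mod (m + 4), 4 mod (m + 4)) \<notin> R0" using m by (simp add: in0 K_ge)
      then show ?thesis using in1[of 0 1] by simp
    qed
    moreover have "(0, 1) \<notin> R3"
    proof -
      have "(0, 1) \<in> R3 \<longleftrightarrow> (m + 1, 0) \<in> R2" by (simp add: in3)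
      also have "\<dots> \<longleftrightarrow> False"
        using n0(1)[of 1] a(2) by (simp add: in2 u[simplified] in0 K_ge)
      finally show ?thesis by simp
    qed
    ultimately show ?thesis
      unfolding compose_def
      using juxt_basis[OF K N] rot_power_basis[OF R0, of 3] join_basis[OF R1]
        rot_power_basis[OF R2, of "m + 1"] join_basis[OF R3] rot_power_basis[OF R4, of "m - 2"]
      by (simp add: join_matching_eq R5_def R4_def R3_def R2_def R1_def R0_def eval_nat_numeral)
  qed
  ultimately show ?thesis using R5 by simp
qed

text \<open>As \<open>K\<close> pairs 2 with 3, the strands of \<open>N\<close> that arrive there
  are connected into one strand from \<open>a\<close> to \<open>b\<close>. The pairing is given by
  the partners of single endpoints, so that each clause of \<open>graft\<close> can be rewritten
  directly.\<close>

lemma graft_link01_link23: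
  assumes "2 \<le> a" "2 \<le> b"
    and K: "\<And>i. (i, 3) \<in> K \<longleftrightarrow> i = 2" "\<And>i. (i, 2) \<in> K \<longleftrightarrow> i = 3"
          "\<And>j. (3, j) \<in> K \<longleftrightarrow> j = 2" "\<And>j. (2, j) \<in> K \<longleftrightarrow> j = 3"
          "\<And>i j. i < 2 \<Longrightarrow> j < 2 \<Longrightarrow> (i, j) \<in> K \<longleftrightarrow> i = 0 \<and> j = 1 \<or> i = 1 \<and> j = 0"
  shows "(i, j) \<in> graft a b N K \<longleftrightarrow> i = 0 \<and> j = 1 \<or> i = 1 \<and> j = 0 \<or> 2 \<le> i \<and> 2 \<le> j \<and> (i, j) \<in> N \<or>
          i = a \<and> j = b \<or> i = b \<and> j = a"
proof -
  consider "i < 2" "j < 2" | "i < 2" "2 \<le> j" | "2 \<le> i" "j < 2" | "2 \<le> i" "2 \<le> j" by linarith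
  then show ?thesis
  proof cases
    case 1
    then have "i \<noteq> a" "i \<noteq> b" "j \<noteq> a" "j \<noteq> b" using assms by auto
    with 1 show ?thesis unfolding graft_def by (simp add: K)
  next
    case 2
    then have "i \<noteq> a" "i \<noteq> b" "j \<noteq> 0" "j \<noteq> 1" "i \<noteq> 2" "i \<noteq> 3" "\<not> j < 2" "\<not> 2 \<le> i" using assms by auto
    with 2 show ?thesis unfolding graft_def mem_Collect_eq case_prod_conv by (simp only: K simp_thms)
  next
    case 3
    then have "j \<noteq> a" "j \<noteq> b" "i \<noteq> 0" "i \<noteq> 1" "j \<noteq> 2" "j \<noteq> 3" "\<not> i < 2" "\<not> 2 \<le> j" using assms by auto
    with 3 show ?thesis unfolding graft_def mem_Collect_eq case_prod_conv by (simp only: K simp_thms)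
  next
    case 4
    then have "j \<noteq> 0" "j \<noteq> 1" "i \<noteq> 0" "i \<noteq> 1" "\<not> i < 2" "\<not> j < 2" by auto
    with 4 show ?thesis unfolding graft_def mem_Collect_eq case_prod_conv by (simp only: K simp_thms)
  qed
qed

text \<open>Here \<open>K\<close> consists of the through strands 0-3 and 1-2, and grafting merely
  prolongs the strands of \<open>N\<close>. This is how \<open>N\<close> itself is recovered as one
  resolution of the saddle.\<close>

lemma graft_link03_link12:
  assumes "2 \<le> a" "2 \<le> b"
    and K: "\<And>i. (i, 3) \<in> K \<longleftrightarrow> i = 0" "\<And>i. (i, 2) \<in> K \<longleftrightarrow> i = 1"
          "\<And>j. (3, j) \<in> K \<longleftrightarrow> j = 0" "\<And>j. (2, j) \<in> K \<longleftrightarrow> j = 1"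
          "\<And>i j. i < 2 \<Longrightarrow> j < 2 \<Longrightarrow> (i, j) \<notin> K"
  shows "(i, j) \<in> graft a b N K \<longleftrightarrow> 2 \<le> i \<and> 2 \<le> j \<and> (i, j) \<in> N \<or>
          i = 0 \<and> j = a \<or> i = a \<and> j = 0 \<or> i = 1 \<and> j = b \<or> i = b \<and> j = 1"
proof -
  consider "i < 2" "j < 2" | "i < 2" "2 \<le> j" | "2 \<le> i" "j < 2" | "2 \<le> i" "2 \<le> j" by linarith
  then show ?thesis
  proof cases
    case 1
    then have "i \<noteq> a" "i \<noteq> b" "j \<noteq> a" "j \<noteq> b" using assms by auto
    with 1 show ?thesis unfolding graft_def by (simp add: K)
  next
    case 2
    then have "i \<noteq> a" "i \<noteq> b" "j \<noteq> 0" "j \<noteq> 1" "\<not> j < 2" "\<not> 2 \<le> i" using assms by auto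
    with 2 show ?thesis unfolding graft_def mem_Collect_eq case_prod_conv by (simp only: K simp_thms)
  next
    case 3
    then have "j \<noteq> a" "j \<noteq> b" "i \<noteq> 0" "i \<noteq> 1" "\<not> i < 2" "\<not> 2 \<le> j" using assms by auto
    with 3 show ?thesis unfolding graft_def mem_Collect_eq case_prod_conv by (simp only: K simp_thms)
  next
    case 4
    then have "j \<noteq> 0" "j \<noteq> 1" "i \<noteq> 0" "i \<noteq> 1" "\<not> i < 2" "\<not> j < 2" "3 \<noteq> (0::nat)" "3 \<noteq> (1::nat)" "2 \<noteq> (0::nat)" "2 \<noteq> (1::nat)" by auto
    with 4 show ?thesis unfolding graft_def mem_Collect_eq case_prod_conv by (simp only: K simp_thms)
  qed
qed

text \<open>A saddle is inserted on the strands at 0 and 1. Its through pairing reproduces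
  \<open>N\<close>; its other pairing joins 0 to 1 and \<open>a\<close> to \<open>b\<close>. Both
  have coefficient 1, which is why the sum and not the difference is small. The remaining terms of
  the expanded saddle cut strands and lose endpoints.\<close>

lemma exchange:
  assumes N: "N \<in> matchings m" and a: "(0, a) \<in> N" "2 \<le> a" and b: "(1, b) \<in> N"
  obtains N' where "N' \<in> matchings m" "(0, 1) \<in> N'" "Domain N' = Domain N"
    "basis N + basis N' \<in> lower m (card (Domain N))"
proof
  note U = matchings_unique[OF N] and S = matchings_sym[OF N]
  let ?g = "graft a b N"
  have b2: "2 \<le> b" using matchings_noncrossing[OF N a(1) b] a(2) matchings_neq[OF N b]
    U[OF a(1) S[of 1 0]] b by (cases "b = 0") auto
  have n0: "(0, j) \<in> N \<longleftrightarrow> j = a" "(j, 0) \<in> N \<longleftrightarrow> j = a" for j using a U S by blast+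
  have n1: "(1, j) \<in> N \<longleftrightarrow> j = b" "(j, 1) \<in> N \<longleftrightarrow> j = b" for j using b U S by blast+
  have cases: "i \<ge> 2 \<and> j \<ge> 2 \<or> i = 0 \<and> j = a \<or> i = a \<and> j = 0 \<or> i = 1 \<and> j = b \<or> i = b \<and> j = 1"
    if "(i, j) \<in> N" for i j
  proof -
    consider "i = 0" | "i = 1" | "j = 0" | "j = 1" | "i \<ge> 2 \<and> j \<ge> 2" by linarith
    then show ?thesis by cases (use that n0 n1 in auto)
  qed
  have nab: "(a, j) \<in> N \<longleftrightarrow> j = 0" "(b, j) \<in> N \<longleftrightarrow> j = 1" for j
    using U S a b by blast+
  let ?P = "link 0 1 \<union> link 2 3" and ?Q = "link 0 3 \<union> link 1 2"
  have K: "?P \<in> matchings 4" "?Q \<in> matchings 4" "link 0 1 \<in> matchings 4" "link 2 3 \<in> matchings 4"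
    "link 0 3 \<in> matchings 4" "link 1 2 \<in> matchings 4" "{} \<in> matchings 4"
    by (rule matchingsI; auto simp: link_def)+
  note g = compose_basis[OF N a b]
  show "?g ?P \<in> matchings m" using g[OF K(1)] by simp
  show "(0, 1) \<in> ?g ?P" by (simp add: graft_def link_def)
  have P: "?g ?P = {(i, j). i = 0 \<and> j = 1 \<or> i = 1 \<and> j = 0 \<or> 2 \<le> i \<and> 2 \<le> j \<and> (i, j) \<in> N \<or>
      i = a \<and> j = b \<or> i = b \<and> j = a}"
  proof -
    have "(i, j) \<in> ?g ?P \<longleftrightarrow> i = 0 \<and> j = 1 \<or> i = 1 \<and> j = 0 \<or> 2 \<le> i \<and> 2 \<le> j \<and> (i, j) \<in> N \<or>
      i = a \<and> j = b \<or> i = b \<and> j = a" for i j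
      by (rule graft_link01_link23[OF a(2) b2]) (auto simp: link_def)
    then show ?thesis
      by (simp only: set_eq_iff split_paired_All mem_Collect_eq case_prod_conv simp_thms)
  qed
  show "Domain (?g ?P) = Domain N"
  proof (intro equalityI subsetI)
    fix i assume "i \<in> Domain (?g ?P)"
    then show "i \<in> Domain N" using S a b unfolding P by blast
  next
    fix i assume "i \<in> Domain N"
    then obtain j where "(i, j) \<in> N" by blast
    then show "i \<in> Domain (?g ?P)" using cases[of i j] unfolding P by blast
  qed
  have Q: "?g ?Q = N"
  proof -
    have "(i, j) \<in> ?g ?Q \<longleftrightarrow> 2 \<le> i \<and> 2 \<le> j \<and> (i, j) \<in> N \<or>
      i = 0 \<and> j = a \<or> i = a \<and> j = 0 \<or> i = 1 \<and> j = b \<or> i = b \<and> j = 1" for i j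
      by (rule graft_link03_link12[OF a(2) b2]) (auto simp: link_def)
    then have "?g ?Q = {(i, j). 2 \<le> i \<and> 2 \<le> j \<and> (i, j) \<in> N \<or>
      i = 0 \<and> j = a \<or> i = a \<and> j = 0 \<or> i = 1 \<and> j = b \<or> i = b \<and> j = 1}"
      by (simp only: set_eq_iff split_paired_All mem_Collect_eq case_prod_conv simp_thms)
    also have "\<dots> = N"
      using cases a(1) b S by blast
    finally show ?thesis .
  qed
  \<comment> \<open>It suffices that a resolution connects no new endpoint and leaves some endpoint
    \<open>x\<close> of \<open>N\<close> unconnected.\<close>
  have low: "basis (?g K) \<in> lower m (card (Domain N))"
    if K: "K \<in> matchings 4" and sub: "Domain (?g K) \<subseteq> Domain N - {x}" and x: "x \<in> Domain N" for K x
  proof (rule basis_lower)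
    show "?g K \<in> matchings m" using g[OF K] by simp
    have "finite (Domain N)" using finite_matching[OF N] by (simp add: finite_Domain)
    then show "card (Domain (?g K)) < card (Domain N)"
      using sub x by (intro psubset_card_mono) blast+
  qed
  have dom: "0 \<in> Domain N" "1 \<in> Domain N" "a \<in> Domain N" "b \<in> Domain N" using a b S by blast+
  have "basis (?g {}) \<in> lower m (card (Domain N))"
    by (rule low[OF K(7) _ dom(1)]) (auto simp: graft_def)
  moreover have "basis (?g (link 0 1)) \<in> lower m (card (Domain N))"
    by (rule low[OF K(3) _ dom(3)]) (use a(2) b2 dom nab in \<open>auto simp: graft_def link_def\<close>)
  moreover have "basis (?g (link 2 3)) \<in> lower m (card (Domain N))"
    by (rule low[OF K(4) _ dom(1)]) (use a(2) b2 dom in \<open>auto simp: graft_def link_def\<close>)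
  moreover have "basis (?g (link 1 2)) \<in> lower m (card (Domain N))"
    by (rule low[OF K(6) _ dom(1)]) (use a(2) b2 dom in \<open>auto simp: graft_def link_def\<close>)
  moreover have "basis (?g (link 0 3)) \<in> lower m (card (Domain N))"
    by (rule low[OF K(5) _ dom(2)]) (use a(2) b2 dom in \<open>auto simp: graft_def link_def\<close>)
  moreover have "compose m N saddle \<in> lower m (card (Domain N))"
    by (rule saddle_lower[OF compose_saddle[OF N]])
  moreover have "basis N + basis (?g ?P) = compose m N saddle + basis (?g (link 0 1))
      + basis (?g (link 2 3)) - basis (?g {}) + basis (?g (link 1 2)) + basis (?g (link 0 3)) - basis (?g {})"
    unfolding saddle_expand compose_add compose_diff conjunct1[OF g[OF K(1)]] conjunct1[OF g[OF K(2)]]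
      conjunct1[OF g[OF K(3)]] conjunct1[OF g[OF K(4)]] conjunct1[OF g[OF K(5)]]
      conjunct1[OF g[OF K(6)]] conjunct1[OF g[OF K(7)]] Q
    by (simp only: algebra_simps)
  ultimately show "basis N + basis (?g ?P) \<in> lower m (card (Domain N))"
    by (simp only: lower_add lower_diff)
qed

section \<open>Matchings with the same connected endpoints agree up to sign and smaller
  diagrams\<close>

definition proportional :: "nat \<Rightarrow> matching \<Rightarrow> matching \<Rightarrow> bool" where
  "proportional m M N \<longleftrightarrow>
    (\<exists>e. (e = 1 \<or> e = - 1) \<and> basis M - e \<odot> basis N \<in> lower m (card (Domain M)))"

lemma rot_power_lower: "v \<in> lower m c \<Longrightarrow> (rot m ^^ k) v \<in> lower m c"
  by (induction k) (auto intro: rot_lower)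

lemma rot_power_scale: "(rot m ^^ k) (c \<odot> v) = c \<odot> (rot m ^^ k) v"
  by (induction k) (simp_all only: funpow.simps comp_apply id_apply rot_eq extend_scale)

lemma card_Domain_turn_power:
  "M \<in> matchings m \<Longrightarrow> card (Domain ((turn m ^^ k) M)) = card (Domain M)"
  by (induction k) (auto simp: card_Domain_turn turn_power_matching)

lemma Domain_turn_power: "Domain ((turn m ^^ k) M) = (cycle m ^^ k) ` Domain M"
  by (induction k) (auto simp: Domain_turn image_comp)

lemma proportional_turn:
  assumes M: "M \<in> matchings m" and N: "N \<in> matchings m"
    and p: "proportional m (turn m M) (turn m N)"
  shows "proportional m M N"
proof -
  from p obtain e where e: "e = 1 \<or> e = - 1"
    and l: "basis (turn m M) - e \<odot> basis (turn m N) \<in> lower m (card (Domain M))"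
    by (auto simp: proportional_def card_Domain_turn[OF M])
  \<comment> \<open>One turn and \<open>m - 1\<close> further ones make a full turn. For
    \<open>m = 0\<close> the subtraction is truncated, but then the matching is empty.\<close>
  have return: "(rot m ^^ (m - 1)) (basis (turn m K)) = basis K" if K: "K \<in> matchings m" for K
  proof (cases m)
    case 0
    then show ?thesis using K by (auto simp: matchings_def turn_def)
  next
    case (Suc n)
    then show ?thesis
      using rot_power_basis[OF turn_matching[OF K], of n] turn_power_self[OF K]
      by (simp add: funpow_swap1)
  qed
  have "basis M - e \<odot> basis N \<in> lower m (card (Domain M))"
    using rot_power_lower[OF l, of "m - 1"]
    by (simp only: rot_power_diff rot_power_scale return[OF M] return[OF N])
  then show ?thesis using e by (auto simp: proportional_def)
qed

lemma proportional_turn_power: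
  "M \<in> matchings m \<Longrightarrow> N \<in> matchings m \<Longrightarrow>
    proportional m ((turn m ^^ k) M) ((turn m ^^ k) N) \<Longrightarrow> proportional m M N"
  by (induction k) (auto intro: proportional_turn turn_power_matching)

lemma proportional_juxt:
  assumes "proportional m M N" "M \<in> matchings m" "N \<in> matchings m" and K: "K \<in> matchings k"
  shows "proportional (m + k) (M \<union> shift m K) (N \<union> shift m K)"
proof -
  from assms(1) obtain e where e: "e = 1 \<or> e = - 1"
    and l: "basis M - e \<odot> basis N \<in> lower m (card (Domain M))"
    by (auto simp: proportional_def)
  have "juxt m (basis M - e \<odot> basis N) k (basis K) =
      basis (M \<union> shift m K) - e \<odot> basis (N \<union> shift m K)"
    unfolding juxt_eq extend_diff extend_scale
    by (simp only: extend_basis assms(2,3) K)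
  then show ?thesis
    using juxt_lower[OF l K] e unfolding proportional_def card_Domain_juxt[OF assms(2) K] by auto
qed

text \<open>A strand with minimal distance between its endpoints works: by noncrossing, an endpoint
  strictly under it would be connected to another one under it, at smaller distance.\<close>

lemma adjacent_pair:
  assumes M: "M \<in> matchings m" and full: "Domain M = {..<m}" and "0 < m"
  obtains i where "(i, i + 1) \<in> M"
proof -
  define D where "D = {j - i | i j. (i, j) \<in> M \<and> i < j}"
  have "\<exists>j. (0, j) \<in> M" using full \<open>0 < m\<close> by auto
  then obtain j where j: "(0, j) \<in> M" by blast
  then have "j \<in> D" using matchings_neq[OF M j] by (force simp: D_def)
  define d where "d = (LEAST d. d \<in> D)"
  have "d \<in> D" unfolding d_def by (rule LeastI[of _ j]) fact
  then obtain i k where ik: "(i, k) \<in> M" "i < k" "d = k - i" by (auto simp: D_def)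
  have least: "d \<le> y - x" if "(x, y) \<in> M" "x < y" for x y
    unfolding d_def by (rule Least_le) (use that in \<open>auto simp: D_def\<close>)
  have "k = i + 1"
  proof (rule ccontr)
    assume "k \<noteq> i + 1"
    then have "i + 1 < k" using ik by simp
    moreover have "k < m" using matchings_less[OF M ik(1)] by simp
    ultimately obtain l where l: "(i + 1, l) \<in> M" using full by (metis DomainE lessThan_iff less_trans)
    have "l < k \<and> i < l" using matchings_noncrossing[OF M ik(1) l] \<open>i + 1 < k\<close> by simp
    moreover have "l \<noteq> i + 1" using matchings_neq[OF M l] by simp
    ultimately show False using least[OF l] ik by linarith
  qed
  then show thesis using ik that by simp
qed

lemma restrict_matching:
  "M \<in> matchings m \<Longrightarrow> (\<And>i j. (i, j) \<in> M \<Longrightarrow> i < k \<and> j < k) \<Longrightarrow> M \<in> matchings k"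
  by (auto simp: matchings_def)

text \<open>Induction on the number of endpoints. An unconnected endpoint can be rotated to the end
  and dropped. Otherwise \<open>M\<close> has a strand between neighbours, which is rotated to 0 and
  1; if \<open>N\<close> lacks this strand, a saddle produces it at the price of a sign. The common
  strand is then split off from both.\<close>

lemma same_domain_proportional:
  "M \<in> matchings m \<Longrightarrow> N \<in> matchings m \<Longrightarrow> Domain M = Domain N \<Longrightarrow> proportional m M N"
proof (induction m arbitrary: M N rule: less_induct)
  case (less m)
  note M = less.prems(1) and N = less.prems(2) and dom = less.prems(3)
  show ?case
  proof (cases "Domain M = {..<m}")
    case False
    then obtain i where i: "i < m" "i \<notin> Domain M"
      using Domain_less[OF M] by auto
    \<comment> \<open>After \<open>i + 1\<close> turns the unconnected endpoint \<open>i\<close> is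
      in the last position, so that the diagram is one with \<open>m - 1\<close> endpoints beside an
      empty disk with one endpoint.\<close>
    have drop: "(turn m ^^ (i + 1)) K \<in> matchings (m - 1)" if K: "K \<in> matchings m" "i \<notin> Domain K" for K
    proof (rule restrict_matching[OF turn_power_matching[OF K(1)]])
      fix x y assume xy: "(x, y) \<in> (turn m ^^ (i + 1)) K"
      note T = turn_power_matching[OF K(1), of "i + 1"]
      have last: "z \<noteq> m - 1" if "(z, w) \<in> (turn m ^^ (i + 1)) K" for z w
      proof
        assume "z = m - 1"
        then have "((m - 1 + (i + 1)) mod m, (w + (i + 1)) mod m) \<in> K"
          using in_turn_power[OF K(1)] matchings_less[OF T that] that by blast
        moreover have "(m - 1 + (i + 1)) mod m = i" using i(1) by (simp add: mod_if)
        ultimately show False using K(2) by auto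
      qed
      show "x < m - 1 \<and> y < m - 1"
        using last[OF xy] last[OF matchings_sym[OF T xy]] matchings_less[OF T xy] by linarith
    qed
    have "proportional (m - 1) ((turn m ^^ (i + 1)) M) ((turn m ^^ (i + 1)) N)"
      using i dom drop[OF M] drop[OF N]
      by (intro less.IH) (simp_all only: Domain_turn_power dom, auto)
    from proportional_juxt[OF this _ _ empty_matching[of 1]] drop[OF M] drop[OF N] i dom
    have "proportional m ((turn m ^^ (i + 1)) M) ((turn m ^^ (i + 1)) N)"
      by (simp add: shift_def)
    then show ?thesis by (rule proportional_turn_power[OF M N])
  next
    case True
    show ?thesis
    proof (cases "m = 0")
      case True
      then have "M = N" using M N by (auto simp: matchings_def)
      then show ?thesis
        unfolding proportional_def
        by (intro exI[of _ 1]) (simp only: vec.scale_one diff_self lower_zero simp_thms)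
    next
      case False
      obtain i where i: "(i, i + 1) \<in> M"
        using adjacent_pair[OF M True] False by blast
      let ?M = "(turn m ^^ i) M" and ?N = "(turn m ^^ i) N"
      have M': "?M \<in> matchings m" and N': "?N \<in> matchings m"
        using M N by (auto intro: turn_power_matching)
      have im: "i + 1 < m" using matchings_less[OF M i] by simp
      have M01: "(0, 1) \<in> ?M"
        using in_turn_power[OF M, of 0 1 i] i im by simp
      have dom': "Domain ?M = Domain ?N" by (simp add: Domain_turn_power dom)
      have both: "proportional m ?M N2"
        if N2: "N2 \<in> matchings m" "(0, 1) \<in> N2" "Domain N2 = Domain ?M" for N2
      proof -
        \<comment> \<open>Two turns move the strand from 0 and 1 to the last two positions. There it
          is the right factor of a juxtaposition, the side on which \<open>proportional_juxt\<close>
          adds a fixed diagram.\<close>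
        have split: "\<exists>K'\<in>matchings (m - 2). (turn m ^^ 2) K = K' \<union> shift (m - 2) (link 0 1)"
          if K: "K \<in> matchings m" "(0, 1) \<in> K" for K
        proof
          let ?T = "(turn m ^^ 2) K"
          let ?K' = "{(x, y) \<in> ?T. x < m - 2 \<and> y < m - 2}"
          have T: "?T \<in> matchings m" by (rule turn_power_matching[OF K(1)])
          show "?K' \<in> matchings (m - 2)"
            using T by (auto simp: matchings_def sym_def irrefl_def single_valued_def)
          have "(m - 2 + 2) mod m = 0" "(m - 1 + 2) mod m = 1"
            using im by (simp_all add: mod_if)
          then have top: "(m - 2, m - 1) \<in> ?T"
            using in_turn_power[OF K(1), of "m - 2" "m - 1" 2] K(2) im by simp
          have "(x, y) \<in> ?K' \<union> shift (m - 2) (link 0 1)" if xy: "(x, y) \<in> ?T" for x y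
          proof -
            have "x < m" "y < m" using matchings_less[OF T xy] by auto
            moreover have "y = m - 1" if "x = m - 2"
              using matchings_unique[OF T top] xy that by blast
            moreover have "y = m - 2" if "x = m - 1"
              using matchings_unique[OF T matchings_sym[OF T top]] xy that by blast
            moreover have "x = m - 1" if "y = m - 2"
              using matchings_unique[OF T top] matchings_sym[OF T xy] that by blast
            moreover have "x = m - 2" if "y = m - 1"
              using matchings_unique[OF T matchings_sym[OF T top]] matchings_sym[OF T xy] that by blast
            ultimately have "x = m - 2 \<and> y = m - 1 \<or> x = m - 1 \<and> y = m - 2 \<or> x < m - 2 \<and> y < m - 2"
              by linarith
            then show ?thesis
              using xy im by (elim disjE) (simp_all add: in_shift link_def)
          qed
          moreover have "(x, y) \<in> ?T" if "(x, y) \<in> shift (m - 2) (link 0 1)" for x y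
          proof -
            have "x = m - 2 \<and> y = m - 1 \<or> x = m - 1 \<and> y = m - 2"
              using that im by (auto simp: in_shift link_def)
            then show ?thesis using top matchings_sym[OF T top] by auto
          qed
          ultimately show "?T = ?K' \<union> shift (m - 2) (link 0 1)" by auto
        qed
        obtain A B where AB: "A \<in> matchings (m - 2)" "B \<in> matchings (m - 2)"
          "(turn m ^^ 2) ?M = A \<union> shift (m - 2) (link 0 1)"
          "(turn m ^^ 2) N2 = B \<union> shift (m - 2) (link 0 1)"
          using split[OF M' M01] split[OF N2(1,2)] by blast
        have "Domain ((turn m ^^ 2) ?M) = Domain ((turn m ^^ 2) N2)"
          unfolding Domain_turn_power N2(3) ..
        then have D: "Domain A \<union> (+) (m - 2) ` Domain (link 0 1) = Domain B \<union> (+) (m - 2) ` Domain (link 0 1)"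
          unfolding AB Domain_juxt .
        have "Domain A = Domain B"
        proof -
          have disj: "Domain C \<inter> (+) (m - 2) ` Y = {}" if "C \<in> matchings (m - 2)" for C Y
          proof (rule equals0I)
            fix x assume "x \<in> Domain C \<inter> (+) (m - 2) ` Y"
            then obtain y where "x \<in> Domain C" "x = m - 2 + y" by (elim IntE imageE)
            moreover from this(1) have "x < m - 2" using Domain_less[OF that] by blast
            ultimately show False by simp
          qed
          have "P = Q" if "P \<union> X = Q \<union> X" "P \<inter> X = {}" "Q \<inter> X = {}" for P Q X :: "nat set"
            using that by blast
          from this[OF D disj[OF AB(1)] disj[OF AB(2)]] show ?thesis .
        qed
        then have "proportional (m - 2) A B"
          using im AB by (intro less.IH) auto
        from proportional_juxt[OF this AB(1,2) link01]
        have "proportional m ((turn m ^^ 2) ?M) ((turn m ^^ 2) N2)"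
        proof -
          have "m - 2 + 2 = m" using im by simp
          then show ?thesis
            using \<open>proportional (m - 2 + 2) _ _\<close> by (simp only: AB)
        qed
        then show ?thesis by (rule proportional_turn_power[OF M' N2(1)])
      qed
      have "proportional m ?M ?N"
      proof (cases "(0, 1) \<in> ?N")
        case True
        then show ?thesis using both[OF N'] dom' by simp
      next
        case False
        have full: "Domain ?N = {..<m}"
        proof -
          have "card (Domain ?N) = m"
            using card_Domain_turn_power[OF N, of i] dom True by (metis card_lessThan)
          then show ?thesis
            using Domain_less[OF N'] by (metis card_lessThan card_subset_eq finite_lessThan)
        qed
        have "0 \<in> Domain ?N" "1 \<in> Domain ?N" using full im by simp_all
        then obtain a b where ab: "(0, a) \<in> ?N" "(1, b) \<in> ?N" by (elim DomainE)
        have "a \<noteq> 0" using matchings_neq[OF N' ab(1)] by simp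
        moreover have "a \<noteq> 1" using False ab(1) by (rule_tac notI) simp
        ultimately have "2 \<le> a" by simp
        obtain N2 where N2: "N2 \<in> matchings m" "(0, 1) \<in> N2" "Domain N2 = Domain ?N"
          and l: "basis ?N + basis N2 \<in> lower m (card (Domain ?N))"
          using exchange[OF N' ab(1) \<open>2 \<le> a\<close> ab(2)] .
        obtain e where e: "e = 1 \<or> e = - 1"
          and l2: "basis ?M - e \<odot> basis N2 \<in> lower m (card (Domain ?M))"
          using both[OF N2(1,2)] N2(3) dom' unfolding proportional_def by auto
        \<comment> \<open>The passage through \<open>N2\<close> reverses the sign, because
          \<open>exchange\<close> controls the sum of the two basis vectors.\<close>
        have "basis ?M - (- e) \<odot> basis ?N = (basis ?M - e \<odot> basis N2) + e \<odot> (basis ?N + basis N2)"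
          by (simp add: fun_eq_iff algebra_simps)
        also have "\<dots> \<in> lower m (card (Domain ?M))"
          using lower_add[OF l2[unfolded dom'] lower_scale[OF l]] unfolding dom' .
        finally show ?thesis using e unfolding proportional_def by (intro exI[of _ "- e"]) auto
      qed
      then show ?thesis by (rule proportional_turn_power[OF M N])
    qed
  qed
qed

section \<open>The common kernel of the scalars\<close>

lemma weight_not_subset: "\<not> S \<subseteq> Domain M \<Longrightarrow> weight M S = 0"
  by (auto simp: weight_def covers_def)

lemma weight_Domain:
  assumes "M \<in> matchings m"
  shows "weight M (Domain M) \<noteq> 0"
proof -
  have "covers M (Domain M)"
    using matchings_sym[OF assms] unfolding covers_def by blast
  moreover have "finite (opens M (Domain M))"
    using finite_matching[OF assms] by (simp add: opens_def finite_Domain)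
  ultimately show ?thesis by (simp add: weight_def)
qed

text \<open>Descent along the filtration. Modulo level \<open>c\<close>, a vector of level
  \<open>Suc c\<close> is a combination of one representative for each set of \<open>c\<close>
  connected endpoints. The scalar at such a set \<open>S\<close> vanishes on saddles, on smaller
  diagrams and on all other representatives, but not on the one with domain \<open>S\<close>; hence
  all coefficients are zero. Level \<open>Suc m\<close> contains every diagram, and at level 0 only
  saddle insertions are left.\<close>

theorem Phi_kernel:
  assumes v: "v \<in> diagram_space m" and zero: "\<And>S. S \<subseteq> {..<m} \<Longrightarrow> Phi m v S = 0"
  shows "v \<in> vec.span {u. saddle_insertion m u}"
proof -
  have step: "v \<in> lower m c" if "v \<in> lower m (Suc c)" for c
  proof -
    define D where "D = Domain ` {K \<in> matchings m. card (Domain K) = c}"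
    define rep where "rep S = (SOME K. K \<in> matchings m \<and> Domain K = S)" for S
    have rep: "rep S \<in> matchings m \<and> Domain (rep S) = S" if "S \<in> D" for S
      unfolding rep_def by (rule someI_ex) (use that in \<open>auto simp: D_def\<close>)
    have finD: "finite D" by (simp add: D_def)
    have cardD: "card S = c" "S \<subseteq> {..<m}" if "S \<in> D" for S
      using that Domain_less by (auto simp: D_def)
    have "\<exists>f. w - (\<Sum>S\<in>D. f S \<odot> basis (rep S)) \<in> lower m c" if "w \<in> lower m (Suc c)" for w
      using that
    proof (induction rule: lower_induct)
      case (saddle u)
      show ?case
        by (rule exI[of _ "\<lambda>_. 0"]) (simp only: vec.scale_zero_left sum.neutral_const diff_0_right saddle_lower[OF saddle])
    next
      case (basis K)
      show ?case
      proof (cases "card (Domain K) = c")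
        case True
        then have "Domain K \<in> D" using basis by (auto simp: D_def)
        then obtain e where e: "basis K - e \<odot> basis (rep (Domain K)) \<in> lower m c"
          using same_domain_proportional[OF basis(1), of "rep (Domain K)"] rep True
          by (auto simp: proportional_def)
        have "(\<Sum>S\<in>D. (if S = Domain K then e else 0) \<odot> basis (rep S))
          = (\<Sum>S\<in>D. if S = Domain K then e \<odot> basis (rep (Domain K)) else 0)"
          by (intro sum.cong) (auto simp: fun_eq_iff)
        also have "\<dots> = e \<odot> basis (rep (Domain K))"
          using finD \<open>Domain K \<in> D\<close> by simp
        finally show ?thesis using e by (intro exI[of _ "\<lambda>S. if S = Domain K then e else 0"]) (simp only:)
      next
        case False
        then have "basis K \<in> lower m c" using basis by (intro basis_lower) auto
        then show ?thesis
          by (intro exI[of _ "\<lambda>_. 0"]) (simp only: vec.scale_zero_left sum.neutral_const diff_0_right)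
      qed
    next
      case (add u w)
      then obtain f g where "u - (\<Sum>S\<in>D. f S \<odot> basis (rep S)) \<in> lower m c"
        "w - (\<Sum>S\<in>D. g S \<odot> basis (rep S)) \<in> lower m c" by blast
      from lower_add[OF this] show ?case
        by (intro exI[of _ "\<lambda>S. f S + g S"])
          (simp only: vec.scale_left_distrib sum.distrib add_diff_add)
    next
      case (scale a u)
      then obtain f where "u - (\<Sum>S\<in>D. f S \<odot> basis (rep S)) \<in> lower m c" by blast
      from lower_scale[OF this, of a] show ?case
        by (intro exI[of _ "\<lambda>S. a * f S"])
          (simp only: vec.scale_right_diff_distrib vec.scale_sum_right vec.scale_scale)
    next
      case zero
      show ?case
        by (rule exI[of _ "\<lambda>_. 0"]) (simp only: vec.scale_zero_left sum.neutral_const diff_0_right lower_zero)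
    qed
    then obtain f where f: "v - (\<Sum>S\<in>D. f S \<odot> basis (rep S)) \<in> lower m c"
      using \<open>v \<in> lower m (Suc c)\<close> by blast
    have Phi_lower: "Phi m w S = 0" if "w \<in> lower m c" "S \<in> D" for w S
      using that(1)
    proof (induction rule: lower_induct)
      case (saddle u)
      then show ?case using cardD[OF that(2)] by (intro Phi_saddle_insertion)
    next
      case (basis K)
      have "\<not> S \<subseteq> Domain K"
        using card_mono[of "Domain K" S] finite_matching[OF basis(1)] basis(2) cardD[OF that(2)]
        by (auto simp: finite_Domain)
      then show ?case using basis by (simp add: Phi_basis weight_not_subset)
    qed (simp_all only: Phi_add Phi_scale Phi_zero mult_zero_right add_0)
    have "f S = 0" if S: "S \<in> D" for S
    proof -
      \<comment> \<open>\<open>S\<close> and \<open>T\<close> have the same size, so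
        \<open>S\<close> is not contained in \<open>T\<close> unless they are equal.\<close>
      have "weight (rep T) S = 0" if "T \<in> D" "T \<noteq> S" for T
      proof (rule weight_not_subset)
        have "finite T" using cardD[OF that(1)] finite_subset by blast
        then show "\<not> S \<subseteq> Domain (rep T)"
          using rep[OF that(1)] cardD[OF that(1)] cardD[OF S] that(2) by (metis card_subset_eq)
      qed
      then have "(\<Sum>T\<in>D. f T * weight (rep T) S) = (\<Sum>T\<in>D. if T = S then f S * weight (rep S) S else 0)"
        by (intro sum.cong) auto
      also have "\<dots> = f S * weight (rep S) S" using finD S by simp
      moreover have "(\<Sum>T\<in>D. f T * weight (rep T) S) = (\<Sum>T\<in>D. Phi m (f T \<odot> basis (rep T)) S)"
        using rep by (intro sum.cong) (auto simp: Phi_scale Phi_basis)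
      moreover have "\<dots> = 0"
        using Phi_lower[OF f S] zero[OF cardD(2)[OF S]] by (simp only: Phi_diff Phi_sum) simp
      ultimately show ?thesis using weight_Domain[of "rep S" m] rep[OF S] by simp
    qed
    then have "(\<Sum>S\<in>D. f S \<odot> basis (rep S)) = 0"
      by (intro sum.neutral) (simp add: fun_eq_iff)
    then show ?thesis using f by (simp only: diff_0_right)
  qed
  have "v \<in> lower m (Suc m)"
  proof -
    have "(\<Sum>M\<in>matchings m. v M \<odot> basis M) \<in> lower m (Suc m)"
    proof (intro vec.subspace_sum[OF lower_subspace] lower_scale basis_lower)
      fix M assume "M \<in> matchings m"
      then show "card (Domain M) < Suc m"
        using card_mono[OF finite_lessThan Domain_less] by (metis card_lessThan le_imp_less_Suc)
    qed
    then show ?thesis using vec_eq_sum_basis[OF v] by simp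
  qed
  moreover have "v \<in> lower m 0" if "v \<in> lower m k" for k
    using that by (induction k) (auto intro: step)
  ultimately have "v \<in> lower m 0" by blast
  then show ?thesis by (simp add: lower_def)
qed

section \<open>State sums are compatible with planar operations\<close>

lemma connected_refl [simp]: "(x, x) \<in> connected_by E"
  by (simp add: connected_by_def)

lemma connected_sym: "(x, y) \<in> connected_by E \<Longrightarrow> (y, x) \<in> connected_by E"
proof -
  have "sym ((E \<union> E\<inverse>)\<^sup>*)" by (intro sym_rtrancl) (auto simp: sym_def)
  then show "(x, y) \<in> connected_by E \<Longrightarrow> (y, x) \<in> connected_by E"
    unfolding connected_by_def by (rule symD)
qed

lemma connected_trans:
  "(x, y) \<in> connected_by E \<Longrightarrow> (y, z) \<in> connected_by E \<Longrightarrow> (x, z) \<in> connected_by E"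
  unfolding connected_by_def by (rule rtrancl_trans)

lemma connected_edge: "(x, y) \<in> E \<Longrightarrow> (x, y) \<in> connected_by E"
  by (auto simp: connected_by_def)

lemma connected_mono: "(x, y) \<in> connected_by E \<Longrightarrow> E \<subseteq> F \<Longrightarrow> (x, y) \<in> connected_by F"
  unfolding connected_by_def using rtrancl_mono[of "E \<union> E\<inverse>" "F \<union> F\<inverse>"] by blast

lemma connected_induct [consumes 1, case_names refl step back_step]:
  assumes "(x, y) \<in> connected_by E" "P x"
    and "\<And>y z. (x, y) \<in> connected_by E \<Longrightarrow> (y, z) \<in> E \<Longrightarrow> P y \<Longrightarrow> P z"
    and "\<And>y z. (x, y) \<in> connected_by E \<Longrightarrow> (z, y) \<in> E \<Longrightarrow> P y \<Longrightarrow> P z"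
  shows "P y"
  using assms(1) unfolding connected_by_def
  by (induction rule: rtrancl_induct) (use assms(2-) in \<open>auto simp: connected_by_def\<close>)

lemma connected_Un:
  assumes "E \<subseteq> P \<times> P" "F \<subseteq> Q \<times> Q" "P \<inter> Q = {}" "x \<notin> Q"
  shows "(x, y) \<in> connected_by (E \<union> F) \<longleftrightarrow> (x, y) \<in> connected_by E"
proof
  assume "(x, y) \<in> connected_by (E \<union> F)"
  then have "(x, y) \<in> connected_by E \<and> y \<notin> Q"
  proof (induction rule: connected_induct)
    case (step y z)
    then have "(y, z) \<in> E" "z \<notin> Q" using assms by auto
    then show ?case using connected_trans[OF conjunct1[OF step.IH] connected_edge] by simp
  next
    case (back_step y z)
    then have "(z, y) \<in> E" "z \<notin> Q" using assms by auto
    then show ?case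
      using connected_trans[OF conjunct1[OF back_step.IH] connected_sym[OF connected_edge]] by simp
  qed (use assms in auto)
  then show "(x, y) \<in> connected_by E" by blast
qed (auto intro: connected_mono)

text \<open>A walk that uses the new edge repeatedly can be shortened, so one passage in either
  direction suffices. The three alternatives match those of \<open>joined\<close>.\<close>

lemma connected_insert:
  "(x, y) \<in> connected_by (insert (p, r) E) \<longleftrightarrow> (x, y) \<in> connected_by E \<or>
     (x, p) \<in> connected_by E \<and> (r, y) \<in> connected_by E \<or>
     (x, r) \<in> connected_by E \<and> (p, y) \<in> connected_by E" (is "_ \<longleftrightarrow> ?R y")
proof
  note T = connected_trans[of _ _ E] and S = connected_sym[of _ _ E] and Ed = connected_edge[of _ _ E]
  assume "(x, y) \<in> connected_by (insert (p, r) E)"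
  then show "?R y"
  proof (induction rule: connected_induct)
    case (step y z)
    then consider "y = p" "z = r" | "(y, z) \<in> connected_by E" using Ed by blast
    then show ?case by cases (use step.IH T S connected_refl in blast)+
  next
    case (back_step y z)
    then consider "y = r" "z = p" | "(y, z) \<in> connected_by E" using Ed S by blast
    then show ?case by cases (use back_step.IH T S connected_refl in blast)+
  qed simp
next
  have m: "(u, v) \<in> connected_by E \<Longrightarrow> (u, v) \<in> connected_by (insert (p, r) E)" for u v
    by (erule connected_mono) auto
  have e: "(p, r) \<in> connected_by (insert (p, r) E)" by (rule connected_edge) simp
  assume "?R y"
  then consider "(x, y) \<in> connected_by E" | "(x, p) \<in> connected_by E" "(r, y) \<in> connected_by E"
    | "(x, r) \<in> connected_by E" "(p, y) \<in> connected_by E" by blast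
  then show "(x, y) \<in> connected_by (insert (p, r) E)"
  proof cases
    case 2
    show ?thesis by (rule connected_trans[OF m[OF 2(1)] connected_trans[OF e m[OF 2(2)]]])
  next
    case 3
    show ?thesis by (rule connected_trans[OF m[OF 3(1)] connected_trans[OF connected_sym[OF e] m[OF 3(2)]]])
  qed (rule m)
qed

lemma connected_insert_commute: "connected_by (insert (p, r) E) = connected_by (insert (r, p) E)"
  by (auto simp: connected_insert)

definition states :: "tangle \<Rightarrow> (crossing \<Rightarrow> matching) set" where
  "states T = crossings T \<rightarrow>\<^sub>E matchings 4"

definition edges :: "tangle \<Rightarrow> (crossing \<Rightarrow> matching) \<Rightarrow> (nat \<times> nat) set" where
  "edges T \<sigma> = arcs T \<union> {(ports c ! i, ports c ! j) | c i j. c \<in> crossings T \<and> (i, j) \<in> \<sigma> c}"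

definition bpoints :: "tangle \<Rightarrow> nat set" where
  "bpoints T = fst ` set (bd T)"

definition cuts :: "tangle \<Rightarrow> (crossing \<Rightarrow> matching) \<Rightarrow> nat set" where
  "cuts T \<sigma> = {ports c ! i | c i. c \<in> crossings T \<and> i < 4 \<and> i \<notin> Domain (\<sigma> c)}"

definition comp :: "tangle \<Rightarrow> (crossing \<Rightarrow> matching) \<Rightarrow> nat \<Rightarrow> nat set" where
  "comp T \<sigma> x = connected_by (edges T \<sigma>) `` {x}"

text \<open>
  A corner of a crossing can also be a boundary point, and then it counts as two tips.
\<close>

definition tip_count :: "tangle \<Rightarrow> (crossing \<Rightarrow> matching) \<Rightarrow> nat \<Rightarrow> nat" where
  "tip_count T \<sigma> x = card (comp T \<sigma> x \<inter> bpoints T) + card (comp T \<sigma> x \<inter> cuts T \<sigma>)"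

definition has_loop :: "tangle \<Rightarrow> (crossing \<Rightarrow> matching) \<Rightarrow> bool" where
  "has_loop T \<sigma> \<longleftrightarrow> (\<exists>x\<in>points T. comp T \<sigma> x \<inter> (bpoints T \<union> cuts T \<sigma>) = {})"

definition state_matching :: "tangle \<Rightarrow> (crossing \<Rightarrow> matching) \<Rightarrow> matching" where
  "state_matching T \<sigma> = {(i, j). i < length (bd T) \<and> j < length (bd T) \<and> i \<noteq> j \<and>
     (fst (bd T ! i), fst (bd T ! j)) \<in> connected_by (edges T \<sigma>)}"

definition coefficient :: "tangle \<Rightarrow> (crossing \<Rightarrow> matching) \<Rightarrow> scalar" where
  "coefficient T \<sigma> = (\<Prod>c\<in>crossings T. crossing_vec (csign c) (\<sigma> c))"

lemma state_diagram_eq: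
  "state_diagram T \<sigma> = (if has_loop T \<sigma> then 0 else basis (state_matching T \<sigma>))"
  by (simp add: state_diagram_def has_loop_def state_matching_def comp_def state_conn_def
      edges_def state_tips_def bpoints_def cuts_def)

lemma Delta_eq: "Delta T = (\<Sum>\<sigma>\<in>states T. coefficient T \<sigma> \<odot> state_diagram T \<sigma>)"
  by (simp add: Delta_def states_def coefficient_def)

text \<open>The invariant for the induction over planar diagrams; noncrossing enters through
  \<open>matchings\<close>. A component with 2 tips is a strand, one with 0 tips is a closed loop or
  a number that names no point. The exact count shows whether joining two boundary points leaves any
  tip.\<close>

definition good :: "tangle \<Rightarrow> bool" where
  "good T \<longleftrightarrow> finite (points T) \<and> finite (crossings T) \<and> distinct (map fst (bd T)) \<and>
     (\<forall>c\<in>crossings T. length (ports c) = 4) \<and>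
     (\<forall>\<sigma>\<in>states T. state_matching T \<sigma> \<in> matchings (length (bd T)) \<and>
        (\<forall>x. tip_count T \<sigma> x = 0 \<or> tip_count T \<sigma> x = 2))"

lemma goodD:
  assumes "good T"
  shows "finite (points T)" "finite (crossings T)" "distinct (map fst (bd T))"
    "c \<in> crossings T \<Longrightarrow> length (ports c) = 4"
    "\<sigma> \<in> states T \<Longrightarrow> state_matching T \<sigma> \<in> matchings (length (bd T))"
    "\<sigma> \<in> states T \<Longrightarrow> tip_count T \<sigma> x = 0 \<or> tip_count T \<sigma> x = 2"
  using assms unfolding good_def by blast+

lemma bpoints_points: "bpoints T \<subseteq> points T"
  by (auto simp: bpoints_def points_def)

lemma port_point: "c \<in> crossings T \<Longrightarrow> length (ports c) = 4 \<Longrightarrow> i < 4 \<Longrightarrow> ports c ! i \<in> points T"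
  unfolding points_def by (metis UN_I UnI2 nth_mem)

lemma states_less: "\<sigma> \<in> states T \<Longrightarrow> c \<in> crossings T \<Longrightarrow> (i, j) \<in> \<sigma> c \<Longrightarrow> i < 4 \<and> j < 4"
  unfolding states_def by (blast dest: PiE_mem matchings_less)

lemma edges_points:
  assumes "good T" "\<sigma> \<in> states T"
  shows "edges T \<sigma> \<subseteq> points T \<times> points T"
proof -
  have "arcs T \<subseteq> points T \<times> points T" by (auto simp: points_def Field_def)
  then show ?thesis
    using states_less[OF assms(2)] port_point goodD(4)[OF assms(1)] unfolding edges_def by blast
qed

lemma cuts_points:
  assumes "good T"
  shows "cuts T \<sigma> \<subseteq> points T"
  using port_point goodD(4)[OF assms(1)] unfolding cuts_def by blast

subsection \<open>Single pieces\<close>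

text \<open>A port has at most one partner, and the partner leads back only to it, so a walk never
  gets further.\<close>

lemma connected_ports:
  assumes P: "distinct P" "length P = 4" and M: "M \<in> matchings 4" and "i < 4"
  shows "connected_by {(P ! i, P ! j) | i j. (i, j) \<in> M} `` {P ! i} = {P ! i} \<union> {P ! j | j. (i, j) \<in> M}"
proof (intro equalityI subsetI)
  let ?E = "{(P ! i, P ! j) | i j. (i, j) \<in> M}"
  have E: "(P ! k, y) \<in> ?E \<Longrightarrow> k < 4 \<Longrightarrow> \<exists>l. y = P ! l \<and> (k, l) \<in> M" for k y
    using P matchings_less[OF M] by (auto simp: nth_eq_iff_index_eq)
  fix y assume "y \<in> connected_by ?E `` {P ! i}"
  then have "(P ! i, y) \<in> connected_by ?E" by simp
  then show "y \<in> {P ! i} \<union> {P ! j | j. (i, j) \<in> M}"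
  proof (induction rule: connected_induct)
    case (step y z)
    then obtain k where k: "y = P ! k" "k < 4" "k = i \<or> (i, k) \<in> M"
      using \<open>i < 4\<close> matchings_less[OF M] by blast
    then obtain l where "z = P ! l" "(k, l) \<in> M" using E step by blast
    then show ?case using k(3) matchings_unique[OF M] matchings_sym[OF M] by blast
  next
    case (back_step y z)
    then have "(y, z) \<in> ?E" using matchings_sym[OF M] by blast
    obtain k where k: "y = P ! k" "k < 4" "k = i \<or> (i, k) \<in> M"
      using \<open>i < 4\<close> matchings_less[OF M] back_step by blast
    then obtain l where "z = P ! l" "(k, l) \<in> M" using E \<open>(y, z) \<in> ?E\<close> by blast
    then show ?case using k(3) matchings_unique[OF M] matchings_sym[OF M] by blast
  qed simp
next
  let ?E = "{(P ! i, P ! j) | i j. (i, j) \<in> M}"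
  fix y assume "y \<in> {P ! i} \<union> {P ! j | j. (i, j) \<in> M}"
  then have "y = P ! i \<or> (P ! i, y) \<in> ?E" by blast
  then have "(P ! i, y) \<in> connected_by ?E" 
    by (elim disjE) (simp only: connected_refl, rule connected_edge)
  then show "y \<in> connected_by ?E `` {P ! i}" by (rule ImageI) simp
qed

lemma connected_isolated: "x \<notin> Field E \<Longrightarrow> connected_by E `` {x} = {x}"
proof -
  assume x: "x \<notin> Field E"
  have "y = x" if "(x, y) \<in> connected_by E" for y
    using that by (induction rule: connected_induct) (use x in \<open>auto simp: Field_def\<close>)
  then show ?thesis by auto
qed

context
  fixes s :: sign and sw se ne nw :: nat
  assumes dist: "distinct [sw, se, ne, nw]"
begin

private abbreviation "P \<equiv> [sw, se, ne, nw]"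
private abbreviation "T \<equiv> crossing_tangle s sw se ne nw"
private abbreviation "c \<equiv> Crossing s P"

private lemma crossing_simps:
  "bd T = [(sw, Inward), (se, Inward), (ne, Outward), (nw, Outward)]" "crossings T = {c}"
  "edges T \<sigma> = {(P ! i, P ! j) | i j. (i, j) \<in> \<sigma> c}"
  "bpoints T = set P" "points T = set P" "cuts T \<sigma> = {P ! i | i. i < 4 \<and> i \<notin> Domain (\<sigma> c)}"
  by (auto simp: crossing_tangle_def edges_def bpoints_def points_def cuts_def)

private lemma fst_nth: "i < 4 \<Longrightarrow> fst (bd T ! i) = P ! i"
  unfolding crossing_simps by (auto simp: less_Suc_eq eval_nat_numeral)

lemma crossing_state:
  assumes M: "\<sigma> c \<in> matchings 4"
  shows "state_matching T \<sigma> = \<sigma> c" "tip_count T \<sigma> x = 0 \<or> tip_count T \<sigma> x = 2" "\<not> has_loop T \<sigma>"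
proof -
  have eq: "P ! i = P ! j \<longleftrightarrow> i = j" if "i < 4" "j < 4" for i j
    using that dist by (simp add: nth_eq_iff_index_eq)
  have comp: "comp T \<sigma> (P ! i) = {P ! i} \<union> {P ! j | j. (i, j) \<in> \<sigma> c}" if "i < 4" for i
    unfolding comp_def crossing_simps(3) using connected_ports[OF dist _ M that] by simp
  show "state_matching T \<sigma> = \<sigma> c"
  proof (rule sym, rule matching_eqI[OF M])
    show "state_matching T \<sigma> \<subseteq> {..<4} \<times> {..<4}"
      by (auto simp: state_matching_def crossing_simps(1))
    fix i j :: nat assume ij: "i < 4" "j < 4"
    have "(i, j) \<in> state_matching T \<sigma> \<longleftrightarrow> i \<noteq> j \<and> P ! j \<in> comp T \<sigma> (P ! i)"
      using ij fst_nth by (simp add: state_matching_def comp_def crossing_tangle_def)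
    also have "\<dots> \<longleftrightarrow> i \<noteq> j \<and> (i, j) \<in> \<sigma> c"
      using ij eq matchings_less[OF M] unfolding comp[OF ij(1)] by blast
    finally show "(i, j) \<in> \<sigma> c \<longleftrightarrow> (i, j) \<in> state_matching T \<sigma>"
      using matchings_neq[OF M] by blast
  qed
  \<comment> \<open>Here all corners are boundary points. A connected corner and its partner are the
    two tips of their component; a cut corner is a tip in both roles.\<close>
  have count: "tip_count T \<sigma> (P ! i) = 2" if i: "i < 4" for i
  proof (cases "i \<in> Domain (\<sigma> c)")
    case True
    then obtain j where j: "(i, j) \<in> \<sigma> c" by blast
    have "j < 4" "i \<noteq> j" using matchings_less[OF M j] matchings_neq[OF M j] by auto
    have "comp T \<sigma> (P ! i) = {P ! i, P ! j}"
      unfolding comp[OF i] using j matchings_unique[OF M] by blast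
    moreover have "{P ! i, P ! j} \<inter> cuts T \<sigma> = {}"
    proof -
      have "P ! k \<notin> cuts T \<sigma>" if "k \<in> Domain (\<sigma> c)" "k < 4" for k
        unfolding crossing_simps(6) using that eq by blast
      then show ?thesis using i \<open>j < 4\<close> j matchings_sym[OF M j] by blast
    qed
    moreover have "{P ! i, P ! j} \<inter> bpoints T = {P ! i, P ! j}"
    proof -
      have "P ! i \<in> set P" "P ! j \<in> set P" using i \<open>j < 4\<close> by (intro nth_mem; simp)+
      then show ?thesis unfolding crossing_simps(4) by blast
    qed
    moreover have "P ! i \<noteq> P ! j" using eq[OF i \<open>j < 4\<close>] \<open>i \<noteq> j\<close> by simp
    ultimately show ?thesis by (simp add: tip_count_def)
  next
    case False
    have "comp T \<sigma> (P ! i) = {P ! i}"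
      unfolding comp[OF i] using False by blast
    moreover have "{P ! i} \<inter> cuts T \<sigma> = {P ! i}"
      unfolding crossing_simps(6) using False i by blast
    moreover have "{P ! i} \<inter> bpoints T = {P ! i}"
    proof -
      have "P ! i \<in> set P" using i by (intro nth_mem) simp
      then show ?thesis unfolding crossing_simps(4) by blast
    qed
    ultimately show ?thesis by (simp add: tip_count_def)
  qed
  have points: "\<exists>i<4. x = P ! i" if "x \<in> set P" for x
  proof -
    have "\<exists>i<length P. P ! i = x" using that unfolding in_set_conv_nth .
    moreover have "length P = 4" by simp
    ultimately show ?thesis by metis
  qed
  show "tip_count T \<sigma> x = 0 \<or> tip_count T \<sigma> x = 2"
  proof (cases "x \<in> set P")
    case True
    then show ?thesis using points count by blast
  next
    case False
    have "Field (edges T \<sigma>) \<subseteq> set P"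
    proof -
      have "P ! k \<in> set P" if "k < 4" for k using that by (intro nth_mem) simp
      then show ?thesis
        using matchings_less[OF M] unfolding crossing_simps(3) Field_def by blast
    qed
    then have "comp T \<sigma> x = {x}" unfolding comp_def using False by (intro connected_isolated) blast
    moreover have "x \<notin> cuts T \<sigma>"
    proof -
      have "P ! k \<in> set P" if "k < 4" for k using that by (intro nth_mem) simp
      then show ?thesis using False unfolding crossing_simps(6) by blast
    qed
    ultimately show ?thesis using False by (simp add: tip_count_def crossing_simps(4))
  qed
  show "\<not> has_loop T \<sigma>"
  proof
    assume "has_loop T \<sigma>"
    then obtain x where "x \<in> set P" "comp T \<sigma> x \<inter> (bpoints T \<union> cuts T \<sigma>) = {}"
      unfolding has_loop_def crossing_simps(5) by blast
    moreover have "x \<in> comp T \<sigma> x" by (simp add: comp_def)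
    ultimately show False unfolding crossing_simps(4) by blast
  qed
qed

lemma good_crossing: "good T"
  unfolding good_def
proof (intro conjI ballI allI)
  fix \<sigma> assume "\<sigma> \<in> states T"
  then have M: "\<sigma> c \<in> matchings 4" by (auto simp: states_def crossing_simps)
  show "state_matching T \<sigma> \<in> matchings (length (bd T))"
    using crossing_state(1)[where \<sigma> = \<sigma>, OF M] M by (simp add: crossing_simps(1) eval_nat_numeral)
  show "tip_count T \<sigma> x = 0 \<or> tip_count T \<sigma> x = 2" for x
    using crossing_state(2)[where \<sigma> = \<sigma>, OF M] .
qed (use dist in \<open>auto simp: crossing_simps\<close>)

lemma crossing_vec_closed: "crossing_vec s \<in> diagram_space 4"
proof -
  have "link NW SW \<union> link NE SE \<in> matchings 4" "link NW SE \<in> matchings 4" "link NE SE \<in> matchings 4"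
    "link SW NE \<in> matchings 4" "link NW SW \<in> matchings 4" "{} \<in> matchings 4"
    by (rule matchingsI; auto simp: link_def)+
  then show ?thesis
    unfolding crossing_vec_def
    by (intro diagram_space_add diagram_space_scale diagram_space_diff basis_in_diagram_space)
qed

lemma Delta_crossing: "Delta T = crossing_vec s"
proof -
  have "Delta T = (\<Sum>\<sigma>\<in>{c} \<rightarrow>\<^sub>E matchings 4. crossing_vec s (\<sigma> c) \<odot> basis (\<sigma> c))"
    unfolding Delta_eq states_def crossing_simps(2)
  proof (rule sum.cong[OF refl])
    fix \<sigma> assume "\<sigma> \<in> {c} \<rightarrow>\<^sub>E matchings 4"
    then have "\<sigma> c \<in> matchings 4" by auto
    then show "coefficient T \<sigma> \<odot> state_diagram T \<sigma> = crossing_vec s (\<sigma> c) \<odot> basis (\<sigma> c)"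
      using crossing_state by (simp add: coefficient_def state_diagram_eq crossing_simps(2))
  qed
  also have "\<dots> = (\<Sum>M\<in>matchings 4. crossing_vec s M \<odot> basis M)"
    \<comment> \<open>A state of a single crossing is the same as a matching of its four
      corners.\<close>
    by (rule sum.reindex_bij_witness[of _ "\<lambda>M. \<lambda>x\<in>{c}. M" "\<lambda>\<sigma>. \<sigma> c"]) (auto simp: PiE_iff extensional_def restrict_def fun_eq_iff)
  also have "\<dots> = crossing_vec s"
    using vec_eq_sum_basis[OF crossing_vec_closed] by simp
  finally show ?thesis .
qed

end

lemma states_no_crossings: "crossings T = {} \<Longrightarrow> states T = {\<lambda>_. undefined}"
  by (simp add: states_def)

lemma good_empty: "good (Tangle [] {} {})"
  by (auto simp: good_def points_def state_matching_def tip_count_def bpoints_def cuts_def)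

lemma strand_state:
  fixes a b :: nat
  assumes "a \<noteq> b"
  defines "T \<equiv> Tangle [(a, Inward), (b, Outward)] {(a, b)} {}"
  shows "state_matching T \<sigma> = link 0 1" "tip_count T \<sigma> x = 0 \<or> tip_count T \<sigma> x = 2" "\<not> has_loop T \<sigma>"
proof -
  have e: "edges T \<sigma> = {(a, b)}" "bpoints T = {a, b}" "cuts T \<sigma> = {}" "points T = {a, b}"
    by (auto simp: T_def edges_def bpoints_def cuts_def points_def)
  have conn: "(x, y) \<in> connected_by {(a, b)} \<longleftrightarrow> x = y \<or> x = a \<and> y = b \<or> x = b \<and> y = a" for x y
  proof -
    have "(x, y) \<in> connected_by {} \<longleftrightarrow> x = y" for x y :: nat by (auto simp: connected_by_def)
    then show ?thesis using connected_insert[of x y a b "{}"] by auto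
  qed
  then have c: "comp T \<sigma> x = (if x = a \<or> x = b then {a, b} else {x})" for x
    unfolding comp_def e by auto
  have "state_matching T \<sigma> = {(i, j). i < 2 \<and> j < 2 \<and> i \<noteq> j \<and> ([a, b] ! i, [a, b] ! j) \<in> connected_by {(a, b)}}"
  proof -
    have "fst (bd T ! i) = [a, b] ! i" if "i < 2" for i
      using that by (auto simp: T_def less_2_cases_iff)
    moreover have "length (bd T) = 2" by (simp add: T_def)
    ultimately show ?thesis unfolding state_matching_def e by (auto simp only:)
  qed
  also have "\<dots> = link 0 1" unfolding conn by (auto simp: link_def less_2_cases_iff)
  finally show "state_matching T \<sigma> = link 0 1" .
  show "tip_count T \<sigma> x = 0 \<or> tip_count T \<sigma> x = 2"
    using assms(1) by (simp add: tip_count_def c e)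
  show "\<not> has_loop T \<sigma>" unfolding has_loop_def c e by auto
qed

lemma good_strand: "a \<noteq> b \<Longrightarrow> good (Tangle [(a, Inward), (b, Outward)] {(a, b)} {})"
  using strand_state link01
  by (auto simp: good_def points_def eval_nat_numeral)

lemma Delta_strand:
  assumes "a \<noteq> b"
  shows "Delta (Tangle [(a, Inward), (b, Outward)] {(a, b)} {}) = basis (link 0 1)"
  using strand_state[OF assms]
  by (simp add: Delta_eq states_no_crossings state_diagram_eq coefficient_def)

subsection \<open>Disks side by side\<close>

locale beside_tangles =
  fixes S T :: tangle
  assumes S: "good S" and T: "good T" and disj: "points S \<inter> points T = {}"
begin

abbreviation "U \<equiv> beside S T"

lemma beside_simps: "bd U = bd S @ bd T" "arcs U = arcs S \<union> arcs T"
    "crossings U = crossings S \<union> crossings T"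
  by (simp_all add: beside_def)

text \<open>A crossing carries its ports, so a common crossing would be a common point. The
  splitting of the coefficients into products depends on this.\<close>

lemma crossings_disj: "crossings S \<inter> crossings T = {}"
proof (rule equals0I)
  fix c assume c: "c \<in> crossings S \<inter> crossings T"
  then have "ports c ! 0 \<in> points S" "ports c ! 0 \<in> points T"
    using port_point goodD(4)[OF S] goodD(4)[OF T] by auto
  then show False using disj by blast
qed

lemma points_beside: "points U = points S \<union> points T"
  unfolding points_def beside_simps Field_Un by auto

lemma bpoints_beside: "bpoints U = bpoints S \<union> bpoints T"
  by (auto simp: bpoints_def beside_simps)

definition left :: "(crossing \<Rightarrow> matching) \<Rightarrow> crossing \<Rightarrow> matching" where
  "left \<sigma> = restrict \<sigma> (crossings S)"

definition right :: "(crossing \<Rightarrow> matching) \<Rightarrow> crossing \<Rightarrow> matching" where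
  "right \<sigma> = restrict \<sigma> (crossings T)"

lemma left_right_states: "\<sigma> \<in> states U \<Longrightarrow> left \<sigma> \<in> states S \<and> right \<sigma> \<in> states T"
  by (auto simp: states_def left_def right_def beside_simps)

lemma edges_beside: "edges U \<sigma> = edges S (left \<sigma>) \<union> edges T (right \<sigma>)"
  unfolding edges_def beside_simps left_def right_def by auto

lemma cuts_beside: "cuts U \<sigma> = cuts S (left \<sigma>) \<union> cuts T (right \<sigma>)"
  unfolding cuts_def beside_simps left_def right_def by auto

context
  fixes \<sigma> assumes \<sigma>: "\<sigma> \<in> states U"
begin

private lemma l: "left \<sigma> \<in> states S" and r: "right \<sigma> \<in> states T"
  using left_right_states[OF \<sigma>] by auto

private lemma connected_left: "x \<in> points S \<Longrightarrow>
    (x, y) \<in> connected_by (edges U \<sigma>) \<longleftrightarrow> (x, y) \<in> connected_by (edges S (left \<sigma>))"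
  unfolding edges_beside
  by (rule connected_Un[OF edges_points[OF S l] edges_points[OF T r] disj]) (use disj in blast)

text \<open>The condition is \<open>x \<notin> points S\<close> instead of
  \<open>x \<in> points T\<close> because \<open>good\<close> asserts the tip count for every
  number, also for those that name no point.\<close>

private lemma connected_right: "x \<notin> points S \<Longrightarrow>
    (x, y) \<in> connected_by (edges U \<sigma>) \<longleftrightarrow> (x, y) \<in> connected_by (edges T (right \<sigma>))"
  unfolding edges_beside Un_commute[of "edges S _"]
  by (rule connected_Un[OF edges_points[OF T r] edges_points[OF S l]]) (use disj in blast)+

private lemma comp_left: "x \<in> points S \<Longrightarrow> comp U \<sigma> x = comp S (left \<sigma>) x"
  unfolding comp_def using connected_left by blast

private lemma comp_right: "x \<notin> points S \<Longrightarrow> comp U \<sigma> x = comp T (right \<sigma>) x"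
  unfolding comp_def using connected_right by blast

private lemma comp_in_points: "good V \<Longrightarrow> \<tau> \<in> states V \<Longrightarrow> x \<in> points V \<Longrightarrow> comp V \<tau> x \<subseteq> points V"
proof -
  assume V: "good V" "\<tau> \<in> states V" "x \<in> points V"
  have "y \<in> points V" if "(x, y) \<in> connected_by (edges V \<tau>)" for y
    using that by (induction rule: connected_induct) (use V edges_points[OF V(1,2)] in blast)+
  then show ?thesis by (auto simp: comp_def)
qed

private lemma tips_left: "x \<in> points S \<Longrightarrow>
    comp U \<sigma> x \<inter> bpoints U = comp S (left \<sigma>) x \<inter> bpoints S \<and>
    comp U \<sigma> x \<inter> cuts U \<sigma> = comp S (left \<sigma>) x \<inter> cuts S (left \<sigma>)"
  unfolding bpoints_beside cuts_beside
  using comp_left comp_in_points[OF S l] bpoints_points[of T] cuts_points[OF T] disj by blast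

private lemma tips_right: "x \<notin> points S \<Longrightarrow>
    comp U \<sigma> x \<inter> bpoints U = comp T (right \<sigma>) x \<inter> bpoints T \<and>
    comp U \<sigma> x \<inter> cuts U \<sigma> = comp T (right \<sigma>) x \<inter> cuts T (right \<sigma>)"
proof -
  assume x: "x \<notin> points S"
  have "comp U \<sigma> x \<inter> points S = {}"
  proof (rule equals0I)
    fix y assume y: "y \<in> comp U \<sigma> x \<inter> points S"
    then have "(y, x) \<in> connected_by (edges U \<sigma>)" by (auto simp: comp_def connected_sym)
    then have "x \<in> comp S (left \<sigma>) y" using connected_left y by (auto simp: comp_def)
    then show False using comp_in_points[OF S l] x y by blast
  qed
  then show ?thesis
    unfolding bpoints_beside cuts_beside comp_right[OF x]
    using bpoints_points[of S] cuts_points[OF S] by blast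
qed

lemma tip_count_beside: "tip_count U \<sigma> x = 0 \<or> tip_count U \<sigma> x = 2"
proof (cases "x \<in> points S")
  case True
  then show ?thesis using goodD(6)[OF S l, of x] tips_left[OF True] by (simp add: tip_count_def)
next
  case False
  then show ?thesis using goodD(6)[OF T r, of x] tips_right[OF False] by (simp add: tip_count_def)
qed

lemma has_loop_beside: "has_loop U \<sigma> \<longleftrightarrow> has_loop S (left \<sigma>) \<or> has_loop T (right \<sigma>)"
proof -
  have "x \<notin> points S" if "x \<in> points T" for x using that disj by blast
  then show ?thesis
    unfolding has_loop_def points_beside Int_Un_distrib bex_Un
    using tips_left tips_right by (simp cong: bex_cong)
qed

lemma state_matching_beside:
  "state_matching U \<sigma> = state_matching S (left \<sigma>) \<union> shift (length (bd S)) (state_matching T (right \<sigma>))"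
proof (intro equalityI subrelI)
  let ?m = "length (bd S)"
  have nthS: "fst (bd U ! i) = fst (bd S ! i) \<and> fst (bd S ! i) \<in> points S" if "i < ?m" for i
    using that bpoints_points[of S] nth_mem[OF that] by (auto simp: beside_simps nth_append bpoints_def)
  have nthT: "fst (bd U ! i) = fst (bd T ! (i - ?m)) \<and> fst (bd T ! (i - ?m)) \<in> points T"
    if "\<not> i < ?m" "i < length (bd U)" for i
  proof -
    have "i - ?m < length (bd T)" using that by (simp add: beside_simps)
    from nth_mem[OF this] show ?thesis
      using that bpoints_points[of T] by (auto simp: beside_simps nth_append bpoints_def)
  qed
  have ST: "(x, y) \<notin> connected_by (edges U \<sigma>)" if "x \<in> points S" "y \<in> points T" for x y
    using connected_left[OF that(1)] comp_in_points[OF S l that(1)] that(2) disj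
    by (auto simp: comp_def)
  fix i j
  {
    assume ij: "(i, j) \<in> state_matching U \<sigma>"
    then have lt: "i < length (bd U)" "j < length (bd U)" "i \<noteq> j"
      and c: "(fst (bd U ! i), fst (bd U ! j)) \<in> connected_by (edges U \<sigma>)"
      by (auto simp: state_matching_def)
    consider "i < ?m" "j < ?m" | "\<not> i < ?m" "\<not> j < ?m"
      using ST nthS nthT lt c connected_sym[OF c] by metis
    then show "(i, j) \<in> state_matching S (left \<sigma>) \<union> shift ?m (state_matching T (right \<sigma>))"
    proof cases
      case 1
      then have "(i, j) \<in> state_matching S (left \<sigma>)"
        using lt c nthS connected_left by (simp add: state_matching_def)
      then show ?thesis by blast
    next
      case 2
      have "fst (bd T ! (i - ?m)) \<notin> points S" using nthT[OF 2(1) lt(1)] disj by blast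
      then have "(i - ?m, j - ?m) \<in> state_matching T (right \<sigma>)"
        using 2 lt c nthT[OF 2(1) lt(1)] nthT[OF 2(2) lt(2)] connected_right
        by (auto simp: state_matching_def beside_simps)
      then show ?thesis using 2 by (simp add: in_shift)
    qed
  next
    assume "(i, j) \<in> state_matching S (left \<sigma>) \<union> shift ?m (state_matching T (right \<sigma>))"
    then consider "(i, j) \<in> state_matching S (left \<sigma>)"
      | "?m \<le> i" "?m \<le> j" "(i - ?m, j - ?m) \<in> state_matching T (right \<sigma>)"
      by (auto simp: in_shift)
    then show "(i, j) \<in> state_matching U \<sigma>"
    proof cases
      case 1
      then show ?thesis using nthS connected_left by (auto simp: state_matching_def beside_simps)
    next
      case 2
      then have lt: "i < length (bd U)" "j < length (bd U)"
        by (auto simp: state_matching_def beside_simps)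
      have "fst (bd T ! (i - ?m)) \<notin> points S" using nthT[OF _ lt(1)] 2 disj by auto
      then show ?thesis
        using 2 lt nthT[OF _ lt(1)] nthT[OF _ lt(2)] connected_right
        by (auto simp: state_matching_def)
    qed
  }
qed

end

lemma good_beside: "good U"
  unfolding good_def
proof (intro conjI ballI allI)
  show "distinct (map fst (bd U))"
    using goodD(3)[OF S] goodD(3)[OF T] disj bpoints_points[of S] bpoints_points[of T]
    by (auto simp: beside_simps bpoints_def)
  fix \<sigma> assume \<sigma>: "\<sigma> \<in> states U"
  show "tip_count U \<sigma> x = 0 \<or> tip_count U \<sigma> x = 2" for x by (rule tip_count_beside[OF \<sigma>])
  show "state_matching U \<sigma> \<in> matchings (length (bd U))"
    using juxt_matching[OF goodD(5)[OF S] goodD(5)[OF T]] left_right_states[OF \<sigma>]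
    unfolding state_matching_beside[OF \<sigma>] by (simp add: beside_simps)
qed (use goodD[OF S] goodD[OF T] in \<open>auto simp: points_beside beside_simps\<close>)

lemma coefficient_beside: "coefficient U \<sigma> = coefficient S (left \<sigma>) * coefficient T (right \<sigma>)"
proof -
  have "coefficient U \<sigma> = (\<Prod>c\<in>crossings S. crossing_vec (csign c) (\<sigma> c)) * (\<Prod>c\<in>crossings T. crossing_vec (csign c) (\<sigma> c))"
    unfolding coefficient_def beside_simps
    using goodD(2)[OF S] goodD(2)[OF T] crossings_disj by (rule prod.union_disjoint)
  then show ?thesis unfolding coefficient_def left_def right_def by simp
qed

lemma juxt_zero: "juxt m 0 k w = 0" "juxt m v k 0 = 0"
  by (simp_all add: juxt_def zero_fun_def vscale_def fun_eq_iff sum_fun_apply)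

text \<open>A state of the combined diagram is a pair of states, and coefficients, loops and
  matchings split accordingly. The double sum is then collected by bilinearity of
  \<open>juxt\<close>.\<close>

lemma Delta_beside: "Delta U = juxt (length (bd S)) (Delta S) (length (bd T)) (Delta T)"
proof -
  let ?m = "length (bd S)" and ?k = "length (bd T)"
  have summand: "state_diagram U \<sigma> = juxt ?m (state_diagram S (left \<sigma>)) ?k (state_diagram T (right \<sigma>))"
    if \<sigma>: "\<sigma> \<in> states U" for \<sigma>
    using has_loop_beside[OF \<sigma>] state_matching_beside[OF \<sigma>] left_right_states[OF \<sigma>]
      goodD(5)[OF S] goodD(5)[OF T] juxt_basis
    by (simp add: state_diagram_eq juxt_zero)
  \<comment> \<open>In the form \<open>juxt_eq\<close>, linearity is immediate in the first
    argument. For the second one it is used that the first argument is zero or a single basis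
    vector.\<close>
  have inner: "juxt ?m (state_diagram S \<sigma>) ?k (\<Sum>\<tau>\<in>A. b \<tau> \<odot> w \<tau>) =
      (\<Sum>\<tau>\<in>A. b \<tau> \<odot> juxt ?m (state_diagram S \<sigma>) ?k (w \<tau>))"
    if "\<sigma> \<in> states S" for \<sigma> A b and w :: "'b \<Rightarrow> vec"
  proof (cases "has_loop S \<sigma>")
    case True
    then show ?thesis by (simp only: state_diagram_eq juxt_zero vec.scale_zero_right sum.neutral_const if_True)
  next
    case False
    then show ?thesis
      using goodD(5)[OF S that]
      by (simp only: state_diagram_eq juxt_eq extend_basis extend_sum extend_scale if_False)
  qed
  have "Delta U = (\<Sum>\<sigma>\<in>states U. (coefficient S (left \<sigma>) * coefficient T (right \<sigma>)) \<odot>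
      juxt ?m (state_diagram S (left \<sigma>)) ?k (state_diagram T (right \<sigma>)))"
    unfolding Delta_eq coefficient_beside using summand by (intro sum.cong) simp_all
  also have "\<dots> = (\<Sum>(\<sigma>, \<tau>)\<in>states S \<times> states T. (coefficient S \<sigma> * coefficient T \<tau>) \<odot>
      juxt ?m (state_diagram S \<sigma>) ?k (state_diagram T \<tau>))"
  proof (rule sum.reindex_bij_witness[of _
      "\<lambda>(\<sigma>, \<tau>) c. if c \<in> crossings S then \<sigma> c else \<tau> c" "\<lambda>\<sigma>. (left \<sigma>, right \<sigma>)"])
    fix \<sigma> assume \<sigma>: "\<sigma> \<in> states U"
    show "(case (left \<sigma>, right \<sigma>) of (\<sigma>, \<tau>) \<Rightarrow> \<lambda>c. if c \<in> crossings S then \<sigma> c else \<tau> c) = \<sigma>"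
      using \<sigma> by (auto simp: fun_eq_iff left_def right_def states_def beside_simps PiE_iff extensional_def)
    show "(left \<sigma>, right \<sigma>) \<in> states S \<times> states T" using left_right_states[OF \<sigma>] by simp
  next
    fix p assume p: "p \<in> states S \<times> states T"
    obtain \<sigma> \<tau> where st: "p = (\<sigma>, \<tau>)" "\<sigma> \<in> states S" "\<tau> \<in> states T" using p by auto
    let ?\<rho> = "\<lambda>c. if c \<in> crossings S then \<sigma> c else \<tau> c"
    show "(left (case p of (\<sigma>, \<tau>) \<Rightarrow> \<lambda>c. if c \<in> crossings S then \<sigma> c else \<tau> c),
        right (case p of (\<sigma>, \<tau>) \<Rightarrow> \<lambda>c. if c \<in> crossings S then \<sigma> c else \<tau> c)) = p"
      using st crossings_disj
      by (auto simp: fun_eq_iff left_def right_def states_def PiE_iff extensional_def restrict_def)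
    show "(case p of (\<sigma>, \<tau>) \<Rightarrow> \<lambda>c. if c \<in> crossings S then \<sigma> c else \<tau> c) \<in> states U"
      using st by (auto simp: states_def beside_simps PiE_iff extensional_def)
  qed simp
  also have "\<dots> = (\<Sum>\<sigma>\<in>states S. coefficient S \<sigma> \<odot> (\<Sum>\<tau>\<in>states T. coefficient T \<tau> \<odot>
      juxt ?m (state_diagram S \<sigma>) ?k (state_diagram T \<tau>)))"
    by (simp only: sum.cartesian_product[symmetric] vec.scale_sum_right vec.scale_scale)
  also have "\<dots> = (\<Sum>\<sigma>\<in>states S. coefficient S \<sigma> \<odot> juxt ?m (state_diagram S \<sigma>) ?k (Delta T))"
    unfolding Delta_eq[of T] by (intro sum.cong refl arg_cong[where f = "(\<odot>) _"] inner[symmetric])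
  also have "\<dots> = juxt ?m (Delta S) ?k (Delta T)"
    unfolding Delta_eq[of S] juxt_eq by (simp only: extend_sum extend_scale)
  finally show ?thesis .
qed

end

subsection \<open>Moving the basepoint and joining\<close>

lemma move_simps: "arcs (move_basepoint T) = arcs T" "crossings (move_basepoint T) = crossings T"
    "bd (move_basepoint T) = rotate1 (bd T)" "bpoints (move_basepoint T) = bpoints T"
    "points (move_basepoint T) = points T" "edges (move_basepoint T) \<sigma> = edges T \<sigma>"
    "cuts (move_basepoint T) \<sigma> = cuts T \<sigma>" "states (move_basepoint T) = states T"
    "comp (move_basepoint T) \<sigma> x = comp T \<sigma> x" "tip_count (move_basepoint T) \<sigma> x = tip_count T \<sigma> x"
    "has_loop (move_basepoint T) \<sigma> = has_loop T \<sigma>" "coefficient (move_basepoint T) \<sigma> = coefficient T \<sigma>"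
  by (simp_all add: move_basepoint_def bpoints_def points_def edges_def cuts_def states_def comp_def
      tip_count_def has_loop_def coefficient_def)

lemma state_matching_move:
  assumes "good T" "\<sigma> \<in> states T"
  shows "state_matching (move_basepoint T) \<sigma> = turn (length (bd T)) (state_matching T \<sigma>)"
proof (rule sym, rule matching_eqI[OF turn_matching[OF goodD(5)[OF assms]]])
  let ?n = "length (bd T)"
  show "state_matching (move_basepoint T) \<sigma> \<subseteq> {..<?n} \<times> {..<?n}"
    by (auto simp: state_matching_def move_simps)
  fix i j assume ij: "i < ?n" "j < ?n"
  have "(i + 1) mod ?n = (j + 1) mod ?n \<longleftrightarrow> i = j"
  proof -
    have "(k + 1) mod ?n = (if k + 1 = ?n then 0 else k + 1)" if "k < ?n" for k
      using that by simp
    from this[OF ij(1)] this[OF ij(2)] show ?thesis by simp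
  qed
  moreover have "(i + 1) mod ?n < ?n" "(j + 1) mod ?n < ?n" 
    by (rule mod_less_divisor, use ij in linarith)+
  moreover have "(i, j) \<in> turn ?n (state_matching T \<sigma>) \<longleftrightarrow>
      ((i + 1) mod ?n, (j + 1) mod ?n) \<in> state_matching T \<sigma>"
    using in_turn_power[OF goodD(5)[OF assms] ij, of 1] by simp
  ultimately show "(i, j) \<in> turn ?n (state_matching T \<sigma>) \<longleftrightarrow> (i, j) \<in> state_matching (move_basepoint T) \<sigma>"
    using ij by (simp only: state_matching_def move_simps nth_rotate1 length_rotate1 mem_Collect_eq
        case_prod_conv simp_thms Suc_eq_plus1)
qed

lemma good_move: "good T \<Longrightarrow> good (move_basepoint T)"
  unfolding good_def[of "move_basepoint T"] move_simps
  using goodD[of T] state_matching_move[of T] turn_matching by (simp add: rotate1_map[symmetric])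

lemma Delta_move:
  assumes "good T"
  shows "Delta (move_basepoint T) = rot (length (bd T)) (Delta T)"
proof -
  have "state_diagram (move_basepoint T) \<sigma> = rot (length (bd T)) (state_diagram T \<sigma>)"
    if "\<sigma> \<in> states T" for \<sigma>
    using goodD(5)[OF assms that]
    by (simp only: state_diagram_eq move_simps state_matching_move[OF assms that] rot_basis
        rot_eq extend_zero extend_basis split: if_split) simp
  then show ?thesis
    unfolding Delta_eq move_simps
    by (simp only: rot_eq extend_sum extend_scale cong: sum.cong)
qed

locale joinable_tangle =
  fixes T :: tangle
  assumes good: "good T" and joinable: "joinable T"
begin

definition "p = fst (bd T ! 0)"

definition "r = fst (bd T ! 1)"
abbreviation "n \<equiv> length (bd T)"
abbreviation "T' \<equiv> join_first T"

lemma two: "2 \<le> n"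
  using joinable by (simp add: joinable_def)

lemma join_simps: "bd T' = drop 2 (bd T)" "crossings T' = crossings T"
    "arcs T' = insert (p, r) (arcs T) \<or> arcs T' = insert (r, p) (arcs T)"
    "states T' = states T" "cuts T' \<sigma> = cuts T \<sigma>" "coefficient T' \<sigma> = coefficient T \<sigma>"
  by (simp_all add: join_first_def Let_def p_def r_def states_def cuts_def coefficient_def)

lemma neq: "p \<noteq> r"
proof -
  obtain x y zs where "bd T = x # y # zs"
    using two by (cases "bd T"; cases "tl (bd T)") auto
  then show ?thesis using goodD(3)[OF good] by (auto simp: p_def r_def)
qed

lemma pr_bpoints: "p \<in> bpoints T" "r \<in> bpoints T"
  using two by (auto simp: p_def r_def bpoints_def intro!: imageI nth_mem)

lemma bpoints_join: "bpoints T' = bpoints T - {p, r}"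
proof -
  obtain x y zs where bd: "bd T = x # y # zs"
    using two by (cases "bd T"; cases "tl (bd T)") auto
  then show ?thesis
    using goodD(3)[OF good] by (auto simp: bpoints_def join_simps p_def r_def)
qed

lemma points_join: "points T' = points T"
proof -
  have b: "bpoints T' \<union> {p, r} = bpoints T" using pr_bpoints bpoints_join by blast
  have f: "Field (arcs T') = Field (arcs T) \<union> {p, r}" using join_simps(3) by auto
  have P: "points V = bpoints V \<union> Field (arcs V) \<union> (\<Union>c\<in>crossings V. set (ports c))" for V
    by (simp add: points_def bpoints_def)
  have "points T' = (bpoints T' \<union> {p, r}) \<union> Field (arcs T) \<union> (\<Union>c\<in>crossings T. set (ports c))"
    unfolding P[of T'] f join_simps by (simp only: Un_ac)
  then show ?thesis unfolding b P[of T] .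
qed

lemma connected_join:
  "(x, y) \<in> connected_by (edges T' \<sigma>) \<longleftrightarrow> (x, y) \<in> connected_by (edges T \<sigma>) \<or>
     (x, p) \<in> connected_by (edges T \<sigma>) \<and> (r, y) \<in> connected_by (edges T \<sigma>) \<or>
     (x, r) \<in> connected_by (edges T \<sigma>) \<and> (p, y) \<in> connected_by (edges T \<sigma>)"
proof -
  have "edges T' \<sigma> = insert (p, r) (edges T \<sigma>) \<or> edges T' \<sigma> = insert (r, p) (edges T \<sigma>)"
    using join_simps(3) by (auto simp: edges_def join_simps(2))
  then show ?thesis
    using connected_insert[of x y p r "edges T \<sigma>"] connected_insert_commute[of p r] by auto
qed

context
  fixes \<sigma> assumes \<sigma>: "\<sigma> \<in> states T"
begin

private abbreviation "C \<equiv> comp T \<sigma>"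
private abbreviation "linked \<equiv> (p, r) \<in> connected_by (edges T \<sigma>)"

private lemma in_comp: "y \<in> C x \<longleftrightarrow> (x, y) \<in> connected_by (edges T \<sigma>)"
  by (simp add: comp_def)

private lemma comp_eq: "y \<in> C x \<Longrightarrow> C y = C x"
  unfolding in_comp set_eq_iff by (blast intro: connected_trans connected_sym)

private lemma comp_self: "x \<in> C x"
  by (simp add: comp_def)

private lemma comp_join: "comp T' \<sigma> x = (if p \<in> C x \<or> r \<in> C x then C p \<union> C r else C x)"
proof -
  have "comp T' \<sigma> x = C x \<union> (if p \<in> C x then C r else {}) \<union> (if r \<in> C x then C p else {})"
    by (auto simp: comp_def connected_join)
  moreover have "C x = C p" if "p \<in> C x" using comp_eq[OF that] by simp
  moreover have "C x = C r" if "r \<in> C x" using comp_eq[OF that] by simp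
  ultimately show ?thesis by auto
qed

private lemma finite_b: "finite (bpoints T)"
  by (simp add: bpoints_def)

private lemma finite_c: "finite (cuts T \<sigma>)"
  using cuts_points[OF good] goodD(1)[OF good] finite_subset by blast

private lemma count_p: "x \<in> bpoints T \<Longrightarrow> tip_count T \<sigma> x = 2"
proof -
  assume "x \<in> bpoints T"
  then have "x \<in> C x \<inter> bpoints T" using comp_self by blast
  then have "card (C x \<inter> bpoints T) \<noteq> 0" using finite_b by (auto simp: card_eq_0_iff)
  then show ?thesis using goodD(6)[OF good \<sigma>, of x] by (simp add: tip_count_def)
qed

text \<open>If \<open>p\<close> and \<open>r\<close> lie in one component, they exhaust the two tips
  that the invariant allows it, so joining them leaves none.\<close>

private lemma connected_tips: "linked \<Longrightarrow> C p \<inter> bpoints T' = {} \<and> C p \<inter> cuts T \<sigma> = {}"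
proof -
  assume "linked"
  then have "{p, r} \<subseteq> C p \<inter> bpoints T" using pr_bpoints comp_self in_comp by blast
  moreover have "card {p, r} = 2" using neq by simp
  ultimately have "2 \<le> card (C p \<inter> bpoints T)"
    using card_mono[of "C p \<inter> bpoints T" "{p, r}"] finite_b by auto
  then have c: "card (C p \<inter> bpoints T) = 2" "card (C p \<inter> cuts T \<sigma>) = 0"
    using count_p[OF pr_bpoints(1)] by (auto simp: tip_count_def)
  then have "{p, r} = C p \<inter> bpoints T"
    using \<open>{p, r} \<subseteq> _\<close> \<open>card {p, r} = 2\<close> finite_b by (intro card_subset_eq) auto
  then show ?thesis using c(2) finite_c unfolding bpoints_join by auto
qed

text \<open>Two components with two tips each lose one tip each and are merged, which leaves two
  tips.\<close>

private lemma disconnected_count: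
  assumes "\<not> linked" and x: "p \<in> C x \<or> r \<in> C x"
  shows "tip_count T' \<sigma> x = 2"
proof -
  have disj: "C p \<inter> C r = {}"
    using assms(1) comp_eq comp_self in_comp by blast
  have "r \<notin> C p" "p \<notin> C r" using disj comp_self by blast+
  then have "C p \<inter> bpoints T' = C p \<inter> bpoints T - {p}" "C r \<inter> bpoints T' = C r \<inter> bpoints T - {r}"
    unfolding bpoints_join by auto
  then have "card (C p \<inter> bpoints T') = card (C p \<inter> bpoints T) - 1"
    "card (C r \<inter> bpoints T') = card (C r \<inter> bpoints T) - 1"
    using comp_self pr_bpoints by (simp_all add: card_Diff_singleton)
  moreover have "0 < card (C p \<inter> bpoints T)" "0 < card (C r \<inter> bpoints T)"
    using comp_self pr_bpoints finite_b by (auto simp: card_gt_0_iff)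
  moreover have "card ((C p \<union> C r) \<inter> bpoints T') = card (C p \<inter> bpoints T') + card (C r \<inter> bpoints T')"
    unfolding Int_Un_distrib2 using disj finite_b bpoints_join
    by (intro card_Un_disjoint) auto
  moreover have "card ((C p \<union> C r) \<inter> cuts T \<sigma>) = card (C p \<inter> cuts T \<sigma>) + card (C r \<inter> cuts T \<sigma>)"
    unfolding Int_Un_distrib2 using disj finite_c by (intro card_Un_disjoint) auto
  ultimately show ?thesis
    using count_p[OF pr_bpoints(1)] count_p[OF pr_bpoints(2)] x
    by (simp add: tip_count_def comp_join join_simps)
qed

private lemma other_comp:
  assumes "\<not> (p \<in> C x \<or> r \<in> C x)"
  shows "comp T' \<sigma> x = C x" "C x \<inter> bpoints T' = C x \<inter> bpoints T"
  using assms by (auto simp: comp_join bpoints_join)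

lemma tip_count_join: "tip_count T' \<sigma> x = 0 \<or> tip_count T' \<sigma> x = 2"
proof (cases "p \<in> C x \<or> r \<in> C x")
  case x: True
  show ?thesis
  proof (cases "linked")
    case True
    then have "C p \<union> C r = C p" using comp_eq[of r p] in_comp by simp
    then show ?thesis
      using connected_tips[OF True] x by (simp add: tip_count_def comp_join join_simps)
  qed (use disconnected_count x in blast)
next
  case False
  then show ?thesis
    using other_comp[OF False] goodD(6)[OF good \<sigma>, of x] by (simp add: tip_count_def join_simps)
qed

lemma has_loop_join: "has_loop T' \<sigma> \<longleftrightarrow> has_loop T \<sigma> \<or> (0, 1) \<in> state_matching T \<sigma>"
proof -
  have c: "(0, 1) \<in> state_matching T \<sigma> \<longleftrightarrow> linked"
    using two by (auto simp: state_matching_def p_def r_def)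
  show ?thesis
  proof (cases "linked")
    case True
    then have "comp T' \<sigma> p = C p" using comp_eq[of r p] in_comp comp_self[of p] by (simp add: comp_join)
    then have "has_loop T' \<sigma>"
      using connected_tips[OF True] pr_bpoints bpoints_points[of T]
      unfolding has_loop_def points_join join_simps by blast
    then show ?thesis using True c by blast
  next
    case False
    have "comp T' \<sigma> x \<inter> (bpoints T' \<union> cuts T \<sigma>) = {} \<longleftrightarrow> C x \<inter> (bpoints T \<union> cuts T \<sigma>) = {}" for x
    proof (cases "p \<in> C x \<or> r \<in> C x")
      case True
      then have "tip_count T' \<sigma> x = 2" by (rule disconnected_count[OF False])
      then have "comp T' \<sigma> x \<inter> (bpoints T' \<union> cuts T \<sigma>) \<noteq> {}"
        unfolding tip_count_def join_simps Int_Un_distrib by (rule_tac notI) simp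
      then show ?thesis using True pr_bpoints by blast
    next
      case False
      then show ?thesis using other_comp[OF False] by (simp add: Int_Un_distrib)
    qed
    then show ?thesis using False c unfolding has_loop_def points_join join_simps by simp
  qed
qed

lemma state_matching_join:
  assumes "(0, 1) \<notin> state_matching T \<sigma>"
  shows "state_matching T' \<sigma> = joined (state_matching T \<sigma>)"
proof -
  have nc: "\<not> linked" using assms two by (auto simp: state_matching_def p_def r_def)
  have "(i, j) \<in> state_matching T' \<sigma> \<longleftrightarrow> (i, j) \<in> joined (state_matching T \<sigma>)" for i j
  proof -
    let ?x = "fst (bd T ! (i + 2))" and ?y = "fst (bd T ! (j + 2))"
    have "(i, j) \<in> state_matching T' \<sigma> \<longleftrightarrow> i + 2 < n \<and> j + 2 < n \<and> i \<noteq> j \<and>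
        (?x, ?y) \<in> connected_by (edges T' \<sigma>)"
      using two by (auto simp: state_matching_def join_simps add.commute)
    \<comment> \<open>In the last two alternatives \<open>i \<noteq> j\<close> is automatic:
      otherwise one boundary point would be connected to both \<open>p\<close> and \<open>r\<close>,
      which are not linked.\<close>
    also have "\<dots> \<longleftrightarrow> i + 2 < n \<and> j + 2 < n \<and> (i \<noteq> j \<and> (?x, ?y) \<in> connected_by (edges T \<sigma>) \<or>
        (?x, p) \<in> connected_by (edges T \<sigma>) \<and> (r, ?y) \<in> connected_by (edges T \<sigma>) \<or>
        (?x, r) \<in> connected_by (edges T \<sigma>) \<and> (p, ?y) \<in> connected_by (edges T \<sigma>))"
      using nc connected_trans[of r ?x "edges T \<sigma>" p] connected_trans[of p ?x "edges T \<sigma>" r]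
        connected_sym[of r p "edges T \<sigma>"] connected_sym[of ?x p "edges T \<sigma>"]
        connected_sym[of ?x r "edges T \<sigma>"]
      unfolding connected_join by auto
    also have "\<dots> \<longleftrightarrow> (i, j) \<in> joined (state_matching T \<sigma>)"
      using two by (auto simp: joined_def state_matching_def p_def r_def)
    finally show ?thesis .
  qed
  then show ?thesis by auto
qed

end

lemma good_join: "good T'"
  unfolding good_def
proof (intro conjI ballI allI)
  show "distinct (map fst (bd T'))"
    using goodD(3)[OF good] by (simp add: join_simps drop_map[symmetric])
  fix \<sigma> assume "\<sigma> \<in> states T'"
  then have \<sigma>: "\<sigma> \<in> states T" by (simp add: join_simps)
  show "tip_count T' \<sigma> x = 0 \<or> tip_count T' \<sigma> x = 2" for x by (rule tip_count_join[OF \<sigma>])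
  show "state_matching T' \<sigma> \<in> matchings (length (bd T'))"
  proof -
    let ?M = "state_matching T \<sigma>"
    have n2: "n = length (bd T') + 2" using two by (simp add: join_simps)
    have M: "?M \<in> matchings (length (bd T') + 2)" using goodD(5)[OF good \<sigma>] n2 by simp
    show ?thesis
    proof (cases "(0, 1) \<in> ?M")
      case False
      then show ?thesis using state_matching_join[OF \<sigma> False] joined_matching[OF M] by simp
    next
      case True
      then have pr: "(p, r) \<in> connected_by (edges T \<sigma>)"
        by (simp add: state_matching_def p_def r_def)
      \<comment> \<open>This state has a closed loop and contributes zero, but \<open>good\<close>
        asks for a matching in every state. The new arc adds no connection, so the old matching is
        merely restricted.\<close>
      have "(x, y) \<in> connected_by (edges T' \<sigma>) \<longleftrightarrow> (x, y) \<in> connected_by (edges T \<sigma>)" for x y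
        unfolding connected_join using pr connected_trans connected_sym by blast
      then have eq: "(i, j) \<in> state_matching T' \<sigma> \<longleftrightarrow> (i + 2, j + 2) \<in> ?M" for i j
        using two by (auto simp: state_matching_def join_simps add.commute)
      show ?thesis
      proof (rule matchingsI)
        fix i j assume "(i, j) \<in> state_matching T' \<sigma>"
        then show "i < length (bd T') \<and> j < length (bd T') \<and> i \<noteq> j \<and> (j, i) \<in> state_matching T' \<sigma>"
          unfolding eq using matchings_less[OF M] matchings_neq[OF M] matchings_sym[OF M] by fastforce
      next
        fix i j k assume "(i, j) \<in> state_matching T' \<sigma>" "(i, k) \<in> state_matching T' \<sigma>"
        then show "j = k" unfolding eq using matchings_unique[OF M] by fastforce
      next
        fix a b c d assume "(a, b) \<in> state_matching T' \<sigma>" "(c, d) \<in> state_matching T' \<sigma>"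
          "a < c" "c < b" "b < d"
        then show False unfolding eq using matchings_noncrossing[OF M, of "a + 2" "b + 2" "c + 2" "d + 2"] by simp
      qed
    qed
  qed
qed (use goodD[OF good] in \<open>auto simp: points_join join_simps\<close>)

text \<open>The operation acts on each state separately. Old loops persist, and a new loop arises
  exactly in the case in which \<open>join_matching\<close> is zero.\<close>

lemma Delta_join: "Delta T' = join n (Delta T)"
proof -
  have "state_diagram T' \<sigma> = join n (state_diagram T \<sigma>)" if \<sigma>: "\<sigma> \<in> states T" for \<sigma>
  proof (cases "has_loop T \<sigma>")
    case True
    then show ?thesis
      using has_loop_join[OF \<sigma>] by (simp only: state_diagram_eq join_eq extend_zero simp_thms if_True)
  next
    case False
    then show ?thesis
      using has_loop_join[OF \<sigma>] state_matching_join[OF \<sigma>] join_basis[OF goodD(5)[OF good \<sigma>]]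
      by (simp add: state_diagram_eq join_matching_eq)
  qed
  then show ?thesis
    unfolding Delta_eq join_simps
    by (simp only: join_eq extend_sum extend_scale cong: sum.cong)
qed

end

lemma planar_good: "planar T \<Longrightarrow> good T"
proof (induction rule: planar.induct)
  case (3 sw se ne nw s)
  then show ?case by (rule good_crossing)
next
  case (4 S T)
  then interpret beside_tangles S T by unfold_locales
  show ?case by (rule good_beside)
next
  case (6 T)
  then interpret joinable_tangle T by unfold_locales
  show ?case by (rule good_join)
qed (auto intro: good_empty good_strand good_move)

lemma Delta_closed: "good T \<Longrightarrow> Delta T \<in> diagram_space (length (bd T))"
  unfolding Delta_eq
  by (intro diagram_space_sum diagram_space_scale)
    (auto simp: state_diagram_eq diagram_space_zero goodD(5) basis_in_diagram_space)

section \<open>Diagrams stored as different graphs\<close>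

text \<open>\<open>same_diagram\<close> compares ends and the strands between them, not points.
  Connectivity in a state is therefore expressed by alternating strands without crossings with
  connections inside crossings, which no longer mentions the names of points.\<close>

definition end_relation :: "tangle \<Rightarrow> (crossing \<Rightarrow> matching) \<Rightarrow> (crossing tend \<times> crossing tend) set" where
  "end_relation T \<sigma> =
     {(e, e'). e \<in> ends T \<and> e' \<in> ends T \<and> (location T e, location T e') \<in> connected_by (arcs T)} \<union>
     {(Corner c i, Corner c j) | c i j. c \<in> crossings T \<and> (i, j) \<in> \<sigma> c}"

definition tip_ends :: "tangle \<Rightarrow> (crossing \<Rightarrow> matching) \<Rightarrow> crossing tend set" where
  "tip_ends T \<sigma> = Boundary ` {..<length (bd T)} \<union>
     {Corner c k | c k. c \<in> crossings T \<and> k < 4 \<and> k \<notin> Domain (\<sigma> c)}"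

lemma tip_ends_subset: "tip_ends T \<sigma> \<subseteq> ends T"
  by (auto simp: tip_ends_def ends_def)

lemma location_tip_ends: "location T ` tip_ends T \<sigma> = bpoints T \<union> cuts T \<sigma>"
proof -
  have "location T ` Boundary ` {..<length (bd T)} = bpoints T"
  proof -
    have "set (bd T) = (\<lambda>i. bd T ! i) ` {..<length (bd T)}" by (auto simp: set_conv_nth)
    then show ?thesis by (simp add: bpoints_def image_image)
  qed
  moreover have "location T ` {Corner c k | c k. c \<in> crossings T \<and> k < 4 \<and> k \<notin> Domain (\<sigma> c)} = cuts T \<sigma>"
    by (force simp: cuts_def)
  ultimately show ?thesis by (simp add: tip_ends_def image_Un)
qed

lemma location_ends:
  assumes "good T"
  shows "e \<in> ends T \<Longrightarrow> location T e \<in> points T"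
proof -
  assume "e \<in> ends T"
  then consider i where "e = Boundary i" "i < length (bd T)"
    | c k where "e = Corner c k" "c \<in> crossings T" "k < 4"
    by (auto simp: ends_def)
  then show ?thesis
  proof cases
    case 1
    then have "fst (bd T ! i) \<in> bpoints T" by (simp add: bpoints_def)
    then show ?thesis using 1 bpoints_points by auto
  next
    case 2
    then show ?thesis using port_point goodD(4)[OF assms] by simp
  qed
qed

context
  fixes T \<sigma> assumes T: "good T" and \<sigma>: "\<sigma> \<in> states T"
begin

lemma end_relation_ends: "end_relation T \<sigma> \<subseteq> ends T \<times> ends T"
  using states_less[OF \<sigma>] by (auto simp: end_relation_def ends_def)

private lemma arcs_edges: "(x, y) \<in> connected_by (arcs T) \<Longrightarrow> (x, y) \<in> connected_by (edges T \<sigma>)"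
  by (erule connected_mono) (auto simp: edges_def)

lemma end_relation_connected:
  "(e, e') \<in> (end_relation T \<sigma>)\<^sup>* \<Longrightarrow> (location T e, location T e') \<in> connected_by (edges T \<sigma>)"
proof (induction rule: rtrancl_induct)
  case (step e' e'')
  have "(location T e', location T e'') \<in> connected_by (edges T \<sigma>)"
  proof -
    consider "(location T e', location T e'') \<in> connected_by (arcs T)"
      | c i j where "e' = Corner c i" "e'' = Corner c j" "c \<in> crossings T" "(i, j) \<in> \<sigma> c"
      using step.hyps(2) by (auto simp: end_relation_def)
    then show ?thesis
    proof cases
      case 2
      then have "(location T e', location T e'') \<in> edges T \<sigma>" by (auto simp: edges_def)
      then show ?thesis by (rule connected_edge)
    qed (rule arcs_edges)
  qed
  then show ?case by (rule connected_trans[OF step.IH])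
qed simp

text \<open>A walk through points is followed by remembering the last end that it passed; from there
  on it runs along arcs only.\<close>

lemma connected_end_relation:
  assumes "(location T e, x) \<in> connected_by (edges T \<sigma>)" and e: "e \<in> ends T"
  shows "\<exists>e'\<in>ends T. (e, e') \<in> (end_relation T \<sigma>)\<^sup>* \<and> (location T e', x) \<in> connected_by (arcs T)"
  using assms(1)
proof (induction rule: connected_induct)
  case refl
  show ?case using e by (intro bexI[of _ e]) auto
next
  have move: "\<exists>e'\<in>ends T. (e, e') \<in> (end_relation T \<sigma>)\<^sup>* \<and> (location T e', z) \<in> connected_by (arcs T)"
    if IH: "\<exists>e'\<in>ends T. (e, e') \<in> (end_relation T \<sigma>)\<^sup>* \<and> (location T e', y) \<in> connected_by (arcs T)"
    and yz: "(y, z) \<in> connected_by (arcs T) \<or> (\<exists>c i j. y = ports c ! i \<and> z = ports c ! j \<and>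
      c \<in> crossings T \<and> (i, j) \<in> \<sigma> c)" for y z
  proof -
    obtain e' where e': "e' \<in> ends T" "(e, e') \<in> (end_relation T \<sigma>)\<^sup>*" "(location T e', y) \<in> connected_by (arcs T)"
      using IH by blast
    from yz show ?thesis
    proof (elim disjE exE conjE)
      assume "(y, z) \<in> connected_by (arcs T)"
      then show ?thesis using e' connected_trans[OF e'(3)] by blast
    next
      fix c i j assume c: "y = ports c ! i" "z = ports c ! j" "c \<in> crossings T" "(i, j) \<in> \<sigma> c"
      have ij: "i < 4" "j < 4" using states_less[OF \<sigma> c(3,4)] by auto
      then have "(e', Corner c i) \<in> end_relation T \<sigma>"
        using e' c by (auto simp: end_relation_def ends_def)
      moreover have "(Corner c i, Corner c j) \<in> end_relation T \<sigma>"
        using c by (auto simp: end_relation_def)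
      ultimately have "(e, Corner c j) \<in> (end_relation T \<sigma>)\<^sup>*"
        using e'(2) by (meson rtrancl.rtrancl_into_rtrancl)
      then show ?thesis using c ij by (intro bexI[of _ "Corner c j"]) (auto simp: ends_def)
    qed
  qed
  {
    case (step y z)
    have "(y, z) \<in> connected_by (arcs T) \<or> (\<exists>c i j. y = ports c ! i \<and> z = ports c ! j \<and>
      c \<in> crossings T \<and> (i, j) \<in> \<sigma> c)"
      using step.hyps(2) connected_edge[of y z "arcs T"] unfolding edges_def by blast
    then show ?case by (rule move[OF step.IH])
  next
    case (back_step y z)
    have "(j, i) \<in> \<sigma> c" if "c \<in> crossings T" "(i, j) \<in> \<sigma> c" for c i j
      using \<sigma> that matchings_sym unfolding states_def by (blast dest: PiE_mem)
    then have "(y, z) \<in> connected_by (arcs T) \<or> (\<exists>c i j. y = ports c ! i \<and> z = ports c ! j \<and>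
      c \<in> crossings T \<and> (i, j) \<in> \<sigma> c)"
      using back_step.hyps(2) connected_sym[OF connected_edge[of z y "arcs T"]] unfolding edges_def by blast
    then show ?case by (rule move[OF back_step.IH])
  }
qed

lemma connected_iff_end_relation:
  assumes "e \<in> ends T" "e' \<in> ends T"
  shows "(location T e, location T e') \<in> connected_by (edges T \<sigma>) \<longleftrightarrow> (e, e') \<in> (end_relation T \<sigma>)\<^sup>*"
proof
  assume "(location T e, location T e') \<in> connected_by (edges T \<sigma>)"
  then obtain e'' where e'': "e'' \<in> ends T" "(e, e'') \<in> (end_relation T \<sigma>)\<^sup>*"
    "(location T e'', location T e') \<in> connected_by (arcs T)"
    using connected_end_relation assms(1) by blast
  then have "(e'', e') \<in> end_relation T \<sigma>" using assms(2) by (auto simp: end_relation_def)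
  then show "(e, e') \<in> (end_relation T \<sigma>)\<^sup>*" using e''(2) by simp
qed (rule end_relation_connected)

lemma state_matching_ends: "state_matching T \<sigma> = {(i, j). i < length (bd T) \<and> j < length (bd T) \<and>
    i \<noteq> j \<and> (Boundary i, Boundary j) \<in> (end_relation T \<sigma>)\<^sup>*}"
proof -
  have "(fst (bd T ! i), fst (bd T ! j)) \<in> connected_by (edges T \<sigma>) \<longleftrightarrow>
      (Boundary i, Boundary j) \<in> (end_relation T \<sigma>)\<^sup>*" if "i < length (bd T)" "j < length (bd T)" for i j
    using connected_iff_end_relation[of "Boundary i" "Boundary j"] that by (simp add: ends_def)
  then show ?thesis unfolding state_matching_def by auto
qed

text \<open>A closed component of a state either meets no end, and then it is a free loop of the
  diagram itself, or it contains a class of ends without tips. Both kinds are preserved by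
  \<open>same_diagram\<close>.\<close>

lemma has_loop_ends: "has_loop T \<sigma> \<longleftrightarrow>
    free_loops T \<noteq> {} \<or> (\<exists>e\<in>ends T. \<forall>t\<in>tip_ends T \<sigma>. (e, t) \<notin> (end_relation T \<sigma>)\<^sup>*)"
proof
  assume "has_loop T \<sigma>"
  then obtain x where x: "x \<in> points T" "comp T \<sigma> x \<inter> location T ` tip_ends T \<sigma> = {}"
    unfolding has_loop_def location_tip_ends by blast
  show "free_loops T \<noteq> {} \<or> (\<exists>e\<in>ends T. \<forall>t\<in>tip_ends T \<sigma>. (e, t) \<notin> (end_relation T \<sigma>)\<^sup>*)"
  proof (cases "connected_by (arcs T) `` {x} \<inter> location T ` ends T = {}")
    case True
    then show ?thesis using x(1) unfolding free_loops_def by blast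
  next
    case False
    then obtain e where e: "e \<in> ends T" "(x, location T e) \<in> connected_by (arcs T)" by blast
    have "(e, t) \<notin> (end_relation T \<sigma>)\<^sup>*" if "t \<in> tip_ends T \<sigma>" for t
    proof
      assume "(e, t) \<in> (end_relation T \<sigma>)\<^sup>*"
      then have "location T t \<in> comp T \<sigma> x"
        using connected_trans[OF arcs_edges[OF e(2)] end_relation_connected] by (simp add: comp_def)
      then show False using x(2) that by blast
    qed
    then show ?thesis using e(1) by blast
  qed
next
  assume "free_loops T \<noteq> {} \<or> (\<exists>e\<in>ends T. \<forall>t\<in>tip_ends T \<sigma>. (e, t) \<notin> (end_relation T \<sigma>)\<^sup>*)"
  then show "has_loop T \<sigma>"
  proof
    assume "free_loops T \<noteq> {}"
    then obtain x where x: "x \<in> points T" "connected_by (arcs T) `` {x} \<inter> location T ` ends T = {}"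
      unfolding free_loops_def by blast
    have port: "ports c ! i \<in> location T ` ends T" if "c \<in> crossings T" "(i, j) \<in> \<sigma> c \<or> (j, i) \<in> \<sigma> c" for c i j
      using that states_less[OF \<sigma>] by (intro image_eqI[of _ _ "Corner c i"]) (auto simp: ends_def)
    \<comment> \<open>A connection inside a crossing touches ends, which a free loop avoids. So a
      free loop is not enlarged by any state.\<close>
    have arc: "(y, z) \<in> arcs T" if "(y, z) \<in> edges T \<sigma>" "(x, y) \<in> connected_by (arcs T) \<or> (x, z) \<in> connected_by (arcs T)" for y z
      using that x(2) port unfolding edges_def by blast
    have "(x, y) \<in> connected_by (arcs T)" if "(x, y) \<in> connected_by (edges T \<sigma>)" for y
      using that
    proof (induction rule: connected_induct)
      case (step y z)
      then show ?case using connected_trans[OF step.IH connected_edge] arc by blast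
    next
      case (back_step y z)
      then show ?case using connected_trans[OF back_step.IH connected_sym[OF connected_edge]] arc by blast
    qed simp
    then have "comp T \<sigma> x \<inter> location T ` tip_ends T \<sigma> = {}"
      using x(2) tip_ends_subset unfolding comp_def by blast
    then show ?thesis using x(1) unfolding has_loop_def location_tip_ends by blast
  next
    assume "\<exists>e\<in>ends T. \<forall>t\<in>tip_ends T \<sigma>. (e, t) \<notin> (end_relation T \<sigma>)\<^sup>*"
    then obtain e where e: "e \<in> ends T" "\<And>t. t \<in> tip_ends T \<sigma> \<Longrightarrow> (e, t) \<notin> (end_relation T \<sigma>)\<^sup>*"
      by blast
    have "location T t \<notin> comp T \<sigma> (location T e)" if "t \<in> tip_ends T \<sigma>" for t
      using e(2)[OF that] connected_iff_end_relation[OF e(1)] tip_ends_subset that by (auto simp: comp_def)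
    then have "comp T \<sigma> (location T e) \<inter> location T ` tip_ends T \<sigma> = {}" by blast
    then show ?thesis
      using location_ends[OF T e(1)] unfolding has_loop_def location_tip_ends by blast
  qed
qed

end

lemma rtrancl_image_iff:
  assumes R: "R \<subseteq> A \<times> A" and R': "R' \<subseteq> F ` A \<times> F ` A" and inj: "inj_on F A"
    and iff: "\<And>a b. a \<in> A \<Longrightarrow> b \<in> A \<Longrightarrow> (F a, F b) \<in> R' \<longleftrightarrow> (a, b) \<in> R"
    and a: "a \<in> A" and b: "b \<in> A"
  shows "(F a, F b) \<in> R'\<^sup>* \<longleftrightarrow> (a, b) \<in> R\<^sup>*"
proof
  assume "(F a, F b) \<in> R'\<^sup>*"
  then have "\<exists>c\<in>A. F b = F c \<and> (a, c) \<in> R\<^sup>*"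
  proof (induction rule: rtrancl_induct)
    case (step y z)
    then obtain c d where "c \<in> A" "y = F c" "(a, c) \<in> R\<^sup>*" "d \<in> A" "z = F d" using R' by blast
    then have "(c, d) \<in> R" using iff step.hyps(2) by simp
    then have "(a, d) \<in> R\<^sup>*" using \<open>(a, c) \<in> R\<^sup>*\<close> by simp
    then show ?case using \<open>d \<in> A\<close> \<open>z = F d\<close> by blast
  qed (use a in auto)
  then show "(a, b) \<in> R\<^sup>*" using inj b by (metis inj_onD)
next
  assume "(a, b) \<in> R\<^sup>*"
  then show "(F a, F b) \<in> R'\<^sup>*"
  proof (induction rule: rtrancl_induct)
    case (step y z)
    then have "(F y, F z) \<in> R'" using iff R by blast
    then show ?case using step.IH by simp
  qed simp
qed

text \<open>Free loops are compared by cardinality, and infinite sets have cardinality 0 too. With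
  finiteness the comparison decides whether a free loop exists; if so, every state is zero.\<close>

lemma finite_free_loops: "good T \<Longrightarrow> finite (free_loops T)"
  unfolding free_loops_def
  by (rule finite_subset[of _ "(\<lambda>x. connected_by (arcs T) `` {x}) ` points T"]) (auto dest: goodD(1))

text \<open>The bijection \<open>f\<close> of the crossings carries states to states with the same
  coefficients. It also transports the relation on ends, hence the matching, the tips and the
  existence of a loop.\<close>

theorem Delta_same_diagram:
  assumes T: "good T" and T': "good T'" and same: "same_diagram T T'"
  shows "Delta T = Delta T'"
proof -
  obtain f where bij: "bij_betw f (crossings T) (crossings T')"
    and sign: "\<And>c. c \<in> crossings T \<Longrightarrow> csign (f c) = csign c"
    and conn: "\<And>e e'. e \<in> ends T \<Longrightarrow> e' \<in> ends T \<Longrightarrow>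
      (location T e, location T e') \<in> connected_by (arcs T) \<longleftrightarrow>
      (location T' (map_tend f e), location T' (map_tend f e')) \<in> connected_by (arcs T')"
    using same unfolding same_diagram_def by blast
  have bd: "length (bd T) = length (bd T')"
    using same unfolding same_diagram_def by (metis length_map)
  have loops: "free_loops T = {} \<longleftrightarrow> free_loops T' = {}"
    using same finite_free_loops[OF T] finite_free_loops[OF T'] unfolding same_diagram_def
    by (metis card_0_eq)
  let ?F = "map_tend f"
  have F: "?F ` ends T = ends T'"
  proof -
    have "?F ` Boundary ` {..<length (bd T)} = Boundary ` {..<length (bd T')}"
      by (simp add: image_image bd)
    moreover have "?F ` {Corner c k | c k. c \<in> crossings T \<and> k < 4} = {Corner c k | c k. c \<in> f ` crossings T \<and> k < 4}"
      by (force simp: image_iff)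
    moreover have "f ` crossings T = crossings T'" using bij by (simp add: bij_betw_def)
    ultimately show ?thesis unfolding ends_def image_Un by simp
  qed
  have f_inj: "f c = f d \<longleftrightarrow> c = d" if "c \<in> crossings T" "d \<in> crossings T" for c d
    using bij that unfolding bij_betw_def inj_on_def by blast
  have inj: "inj_on ?F (ends T)"
  proof (rule inj_onI)
    fix e e' assume "e \<in> ends T" "e' \<in> ends T" "?F e = ?F e'"
    then show "e = e'" by (cases e; cases e') (auto simp: ends_def f_inj)
  qed
  \<comment> \<open>States are extensional functions, so the transported ones are restricted to the
    crossings.\<close>
  let ?push = "\<lambda>\<sigma>. \<lambda>c\<in>crossings T'. \<sigma> (inv_into (crossings T) f c)"
  let ?pull = "\<lambda>\<sigma>. \<lambda>c\<in>crossings T. \<sigma> (f c)"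
  have f_mem: "f c \<in> crossings T'" if "c \<in> crossings T" for c
    using bij that by (auto simp: bij_betw_def)
  have f_surj: "\<exists>d\<in>crossings T. f d = c" if "c \<in> crossings T'" for c
    using bij that unfolding bij_betw_def by (metis imageE)
  have inv_f: "inv_into (crossings T) f (f c) = c" if "c \<in> crossings T" for c
    using bij that by (simp add: bij_betw_def)
  have inv_mem: "inv_into (crossings T) f c \<in> crossings T \<and> f (inv_into (crossings T) f c) = c"
    if "c \<in> crossings T'" for c
    using bij that by (auto simp: bij_betw_def inv_into_into f_inv_into_f)
  have state: "state_diagram T \<sigma> = state_diagram T' \<sigma>' \<and> coefficient T \<sigma> = coefficient T' \<sigma>'"
    if \<sigma>: "\<sigma> \<in> states T" and \<sigma>': "\<sigma>' \<in> states T'" and eq: "\<And>c. c \<in> crossings T \<Longrightarrow> \<sigma>' (f c) = \<sigma> c" for \<sigma> \<sigma>'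
  proof -
    have iff: "(?F e, ?F e') \<in> end_relation T' \<sigma>' \<longleftrightarrow> (e, e') \<in> end_relation T \<sigma>"
      if e: "e \<in> ends T" "e' \<in> ends T" for e e'
    proof -
      have "(\<exists>c i j. ?F e = Corner c i \<and> ?F e' = Corner c j \<and> c \<in> crossings T' \<and> (i, j) \<in> \<sigma>' c) \<longleftrightarrow>
          (\<exists>c i j. e = Corner c i \<and> e' = Corner c j \<and> c \<in> crossings T \<and> (i, j) \<in> \<sigma> c)"
        using e by (cases e; cases e') (auto simp: ends_def f_inj f_mem eq)
      moreover have "?F e \<in> ends T'" "?F e' \<in> ends T'" using e F by blast+
      ultimately show ?thesis using e conn[OF e] unfolding end_relation_def by auto
    qed
    have star: "(?F e, ?F e') \<in> (end_relation T' \<sigma>')\<^sup>* \<longleftrightarrow> (e, e') \<in> (end_relation T \<sigma>)\<^sup>*"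
      if "e \<in> ends T" "e' \<in> ends T" for e e'
      using rtrancl_image_iff[OF end_relation_ends[OF T \<sigma>] _ inj iff that]
        end_relation_ends[OF T' \<sigma>'] F by simp
    have tips: "?F ` tip_ends T \<sigma> = tip_ends T' \<sigma>'"
    proof -
      have "?F ` Boundary ` {..<length (bd T)} = Boundary ` {..<length (bd T')}"
        by (simp add: image_image bd)
      moreover have "?F ` {Corner c k | c k. c \<in> crossings T \<and> k < 4 \<and> k \<notin> Domain (\<sigma> c)} =
          {Corner c k | c k. c \<in> crossings T' \<and> k < 4 \<and> k \<notin> Domain (\<sigma>' c)}" (is "?A = ?B")
      proof (intro equalityI subsetI)
        fix e assume "e \<in> ?A"
        then show "e \<in> ?B" using f_mem eq by auto
      next
        fix e assume "e \<in> ?B"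
        then obtain c k where c: "e = Corner c k" "c \<in> crossings T'" "k < 4" "k \<notin> Domain (\<sigma>' c)" by blast
        then obtain d where "d \<in> crossings T" "f d = c" using f_surj by blast
        then show "e \<in> ?A" using c eq[of d] by (intro image_eqI[of _ _ "Corner d k"]) auto
      qed
      ultimately show ?thesis unfolding tip_ends_def image_Un by simp
    qed
    have "(Boundary i, Boundary j) \<in> (end_relation T' \<sigma>')\<^sup>* \<longleftrightarrow> (Boundary i, Boundary j) \<in> (end_relation T \<sigma>)\<^sup>*"
      if "i < length (bd T)" "j < length (bd T)" for i j
      using star[of "Boundary i" "Boundary j"] that by (simp add: ends_def)
    then have "state_matching T \<sigma> = state_matching T' \<sigma>'"
      unfolding state_matching_ends[OF T \<sigma>] state_matching_ends[OF T' \<sigma>'] bd by auto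
    moreover have "has_loop T \<sigma> = has_loop T' \<sigma>'"
    proof -
      have "(e, t) \<in> (end_relation T \<sigma>)\<^sup>* \<longleftrightarrow> (?F e, ?F t) \<in> (end_relation T' \<sigma>')\<^sup>*"
        if "e \<in> ends T" "t \<in> tip_ends T \<sigma>" for e t
        using star[OF that(1)] tip_ends_subset that(2) by blast
      then have "(\<exists>e\<in>ends T. \<forall>t\<in>tip_ends T \<sigma>. (e, t) \<notin> (end_relation T \<sigma>)\<^sup>*) \<longleftrightarrow>
          (\<exists>e\<in>?F ` ends T. \<forall>t\<in>?F ` tip_ends T \<sigma>. (e, t) \<notin> (end_relation T' \<sigma>')\<^sup>*)"
        by simp
      then show ?thesis
        unfolding has_loop_ends[OF T \<sigma>] has_loop_ends[OF T' \<sigma>'] loops F tips by simp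
    qed
    moreover have "coefficient T \<sigma> = coefficient T' \<sigma>'"
      unfolding coefficient_def prod.reindex_bij_betw[OF bij, symmetric]
      by (intro prod.cong) (simp_all add: sign eq)
    ultimately show ?thesis by (simp add: state_diagram_eq)
  qed
  show ?thesis
    unfolding Delta_eq
  proof (rule sum.reindex_bij_witness[of _ ?pull ?push])
    fix \<sigma> assume \<sigma>: "\<sigma> \<in> states T"
    show "?pull (?push \<sigma>) = \<sigma>"
      using \<sigma> by (auto simp: fun_eq_iff f_mem inv_f states_def PiE_iff extensional_def restrict_def)
    show push: "?push \<sigma> \<in> states T'"
      using \<sigma> inv_mem by (auto simp: states_def PiE_iff extensional_def)
    show "coefficient T' (?push \<sigma>) \<odot> state_diagram T' (?push \<sigma>) = coefficient T \<sigma> \<odot> state_diagram T \<sigma>"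
      using state[OF \<sigma> push] by (simp add: f_mem inv_f)
  next
    fix \<sigma> assume \<sigma>: "\<sigma> \<in> states T'"
    show "?push (?pull \<sigma>) = \<sigma>"
      using \<sigma> inv_mem by (auto simp: fun_eq_iff states_def PiE_iff extensional_def restrict_def)
    show "?pull \<sigma> \<in> states T"
      using \<sigma> f_mem by (auto simp: states_def PiE_iff extensional_def)
  qed
qed

section \<open>Local relations\<close>

lemma bd_fill: "bd (fill C L) = bd C"
  by (simp add: fill_def)

lemma points_fill: "points (fill C L) \<subseteq> points C \<union> points L"
  by (auto simp: fill_def points_def Field_def)

lemma fill_base: "bd L = H \<Longrightarrow> fill (Tangle H {} {}) L = L"
  by (cases L) (simp add: fill_def)

lemma fill_beside: "fill (beside C T) L = beside (fill C L) T"
  by (simp add: fill_def beside_def Un_ac)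

lemma fill_move: "fill (move_basepoint C) L = move_basepoint (fill C L)"
  by (simp add: fill_def move_basepoint_def)

lemma fill_join: "fill (join_first C) L = join_first (fill C L)"
  by (simp add: fill_def join_first_def Let_def)

lemma joinable_fill: "joinable (fill C L) = joinable C"
  by (simp add: joinable_def bd_fill)

lemma points_beside_eq: "points (beside S T) = points S \<union> points T"
  by (auto simp: points_def beside_def Field_def)

lemma points_join_subset: "joinable C \<Longrightarrow> points C \<subseteq> points (join_first C)"
proof -
  assume "joinable C"
  then obtain x y zs where "bd C = x # y # zs"
    unfolding joinable_def by (cases "bd C"; cases "tl (bd C)") auto
  then show ?thesis by (auto simp: points_def join_first_def Let_def Field_def)
qed

lemma surrounding_points: "surrounding H C \<Longrightarrow> fst ` set H \<subseteq> points C"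
proof (induction rule: surrounding.induct)
  case 1
  then show ?case by (auto simp: points_def)
next
  case (2 C T)
  then show ?case by (auto simp: points_beside_eq)
next
  case (3 C)
  then show ?case by (simp add: move_simps)
next
  case (4 C)
  then show ?case using points_join_subset by blast
qed

text \<open>The points shared with \<open>L\<close> lie on the small circle \<open>H\<close>, which
  belongs to \<open>C\<close>. So a disk beside \<open>C\<close> stays disjoint from the filling,
  and the condition on shared points passes to the smaller surrounding.\<close>

lemma fill_disjoint:
  assumes "surrounding H C" "points C \<inter> points T = {}" "points (beside C T) \<inter> points L \<subseteq> fst ` set H"
  shows "points (fill C L) \<inter> points T = {}" "points C \<inter> points L \<subseteq> fst ` set H"
  using surrounding_points[OF assms(1)] assms(2,3) points_fill[of C L]
  unfolding points_beside_eq by blast+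

lemma fill_planar:
  assumes "surrounding H C" "planar L" "bd L = H" "points C \<inter> points L \<subseteq> fst ` set H"
  shows "planar (fill C L)"
  using assms(1,4)
proof (induction rule: surrounding.induct)
  case 1
  then show ?case using fill_base[OF assms(3)] assms(2) by simp
next
  case (2 C T)
  note d = fill_disjoint[OF 2(1,3) 2(5)]
  show ?case unfolding fill_beside by (rule planar.intros(4)[OF 2(4)[OF d(2)] 2(2) d(1)])
next
  case (3 C)
  then show ?case unfolding fill_move by (intro planar.intros(5)) (simp add: move_simps)
next
  case (4 C)
  then show ?case unfolding fill_join using points_join_subset[OF 4(2)]
    by (intro planar.intros(6)) (auto simp: joinable_fill)
qed

text \<open>Every operation of the surrounding turns the scalars of a filled disk into combinations
  whose factors do not depend on the filling, so a linear relation that holds at every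
  \<open>S\<close> persists. The factor is a scalar of the disk placed beside it, or the sign of a
  rotation; a join takes the difference of the relations at two sets.\<close>

lemma fill_relation:
  assumes "surrounding H C"
    and L: "\<And>i. i \<in> I \<Longrightarrow> planar (L i)" "\<And>i. i \<in> I \<Longrightarrow> bd (L i) = H"
      "\<And>i. i \<in> I \<Longrightarrow> points C \<inter> points (L i) \<subseteq> fst ` set H"
    and rel: "\<And>S. S \<subseteq> {..<length H} \<Longrightarrow> (\<Sum>i\<in>I. a i * Phi (length H) (Delta (L i)) S) = 0"
  shows "S \<subseteq> {..<length (bd C)} \<Longrightarrow> (\<Sum>i\<in>I. a i * Phi (length (bd C)) (Delta (fill C (L i))) S) = 0"
  using assms(1) L(3)
proof (induction arbitrary: S rule: surrounding.induct)
  case 1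
  have "(\<Sum>i\<in>I. a i * Phi (length H) (Delta (fill (Tangle H {} {}) (L i))) S) =
      (\<Sum>i\<in>I. a i * Phi (length H) (Delta (L i)) S)"
    by (intro sum.cong) (simp_all add: fill_base L)
  then show ?case using rel 1 by simp
next
  case (2 C T)
  obtain A B where AB: "A \<subseteq> {..<length (bd C)}" "B \<subseteq> {..<length (bd T)}"
    "S = A \<union> (+) (length (bd C)) ` B"
    using split_subset[of S "length (bd C)" "length (bd T)"] 2(5) by (auto simp: beside_def)
  have D: "Delta (fill (beside C T) (L i)) =
      juxt (length (bd C)) (Delta (fill C (L i))) (length (bd T)) (Delta T)" if i: "i \<in> I" for i
  proof -
    note d = fill_disjoint[OF 2(1,3) 2(6)[OF i]]
    have "good (fill C (L i))" "good T"
      using planar_good fill_planar[OF 2(1) L(1)[OF i] L(2)[OF i] d(2)] 2(2) by auto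
    then interpret beside_tangles "fill C (L i)" T using d(1) by unfold_locales
    show ?thesis unfolding fill_beside using Delta_beside by (simp add: bd_fill)
  qed
  have "(\<Sum>i\<in>I. a i * Phi (length (bd C)) (Delta (fill C (L i))) A) = 0"
    using 2(4)[OF AB(1)] fill_disjoint(2)[OF 2(1,3) 2(6)] by blast
  then have "(\<Sum>i\<in>I. a i * (Phi (length (bd C)) (Delta (fill C (L i))) A * Phi (length (bd T)) (Delta T) B)) = 0"
    by (simp only: mult.assoc[symmetric] sum_distrib_right[symmetric] mult_zero_left)
  then show ?case
    using D AB by (simp add: beside_def Phi_juxt)
next
  case (3 C)
  obtain S' where S': "S' \<subseteq> {..<length (bd C)}" "S = cycle (length (bd C)) ` S'"
    using cycle_subset[of S "length (bd C)"] 3(3) by (auto simp: move_simps)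
  have D: "Delta (fill (move_basepoint C) (L i)) = rot (length (bd C)) (Delta (fill C (L i)))"
    if i: "i \<in> I" for i
    unfolding fill_move
    using Delta_move[OF planar_good[OF fill_planar[OF 3(1) L(1)[OF i] L(2)[OF i]]]] 3(4)[OF i]
    by (simp add: bd_fill move_simps)
  let ?c = "if 0 \<in> S' then (- 1) ^ ((card S' - 1) div 2) else 1 :: scalar"
  have "(\<Sum>i\<in>I. a i * Phi (length (bd C)) (Delta (fill C (L i))) S') = 0"
    using 3(2)[OF S'(1)] 3(4) by (simp add: move_simps)
  then have "(\<Sum>i\<in>I. a i * (?c * Phi (length (bd C)) (Delta (fill C (L i))) S')) = 0"
    by (simp only: mult.left_commute[of _ ?c] sum_distrib_left[symmetric] mult_zero_right)
  moreover have "(\<Sum>i\<in>I. a i * Phi (length (bd C)) (Delta (fill (move_basepoint C) (L i))) S) =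
      (\<Sum>i\<in>I. a i * (?c * Phi (length (bd C)) (Delta (fill C (L i))) S'))"
    unfolding S'(2) by (intro sum.cong refl) (simp only: D Phi_rot[OF S'(1)])
  ultimately show ?case by (simp add: move_simps)
next
  case (4 C)
  let ?n = "length (bd C) - 2"
  have n: "length (bd C) = ?n + 2" using 4(2) unfolding joinable_def by linarith
  have "length (bd (join_first C)) = ?n" by (simp add: join_first_def Let_def)
  then have S: "S \<subseteq> {..<?n}" using 4(4) by simp
  have sub: "points C \<inter> points (L i) \<subseteq> fst ` set H" if "i \<in> I" for i
    using 4(5)[OF that] points_join_subset[OF 4(2)] by blast
  have D: "Delta (fill (join_first C) (L i)) = join (?n + 2) (Delta (fill C (L i)))" if i: "i \<in> I" for i
  proof -
    interpret joinable_tangle "fill C (L i)"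
      using planar_good[OF fill_planar[OF 4(1) L(1)[OF i] L(2)[OF i] sub[OF i]]] 4(2)
      by unfold_locales (simp_all add: joinable_fill)
    show ?thesis unfolding fill_join using Delta_join n by (simp add: bd_fill)
  qed
  have "(+) 2 ` S \<subseteq> {..<?n + 2}" "{0, 1} \<union> (+) 2 ` S \<subseteq> {..<?n + 2}" using S by auto
  then have z: "(\<Sum>i\<in>I. a i * Phi (?n + 2) (Delta (fill C (L i))) ((+) 2 ` S)) = 0"
    "(\<Sum>i\<in>I. a i * Phi (?n + 2) (Delta (fill C (L i))) ({0, 1} \<union> (+) 2 ` S)) = 0"
    using 4(3)[of "(+) 2 ` S"] 4(3)[of "{0, 1} \<union> (+) 2 ` S"] sub n by metis+
  have "(\<Sum>i\<in>I. a i * Phi ?n (Delta (fill (join_first C) (L i))) S) =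
    (\<Sum>i\<in>I. a i * Phi (?n + 2) (Delta (fill C (L i))) ((+) 2 ` S)) -
    (\<Sum>i\<in>I. a i * Phi (?n + 2) (Delta (fill C (L i))) ({0, 1} \<union> (+) 2 ` S))"
    unfolding sum_subtractf[symmetric] right_diff_distrib[symmetric]
    by (intro sum.cong refl) (simp only: D Phi_join[OF S])
  then show ?case using z by (simp add: join_first_def Let_def)
qed

text \<open>The passage from scalars back to congruence: the relation is carried through the
  surrounding at every \<open>S\<close>, and \<open>Phi_kernel\<close> is applied once, to the whole
  combination.\<close>

theorem local_relation:
  assumes L: "\<And>i. i \<in> I \<Longrightarrow> planar (L i)" "\<And>i. i \<in> I \<Longrightarrow> bd (L i) = H" "\<And>i. i \<in> I \<Longrightarrow> fits C (L i)"
    and "finite I" "I \<noteq> {}"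
    and T: "\<And>i. i \<in> I \<Longrightarrow> same_diagram (T i) (fill C (L i))" "\<And>i. i \<in> I \<Longrightarrow> tangle_diagram n (T i)"
    and rel: "\<And>S. S \<subseteq> {..<length H} \<Longrightarrow> (\<Sum>i\<in>I. a i * Phi (length H) (Delta (L i)) S) = 0"
  shows "(\<Sum>i\<in>I. a i \<odot> Delta (T i)) \<in> vec.span {u. saddle_insertion (2 * n) u}"
proof -
  obtain i0 where i0: "i0 \<in> I" using assms(5) by blast
  have surr: "surrounding H C" using L(2,3)[OF i0] by (simp add: fits_def)
  have sub: "points C \<inter> points (L i) \<subseteq> fst ` set H" if "i \<in> I" for i
    using L(2,3)[OF that] by (simp add: fits_def)
  have planar: "planar (fill C (L i))" if "i \<in> I" for i
    using fill_planar[OF surr L(1,2)[OF that] sub[OF that]] .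
  have len: "length (bd C) = 2 * n"
    using T(1,2)[OF i0] unfolding same_diagram_def tangle_diagram_def bd_fill by (metis length_map)
  have D: "Delta (T i) = Delta (fill C (L i))" if "i \<in> I" for i
    using Delta_same_diagram[OF _ _ T(1)[OF that]] planar_good planar[OF that] T(2)[OF that]
    by (simp add: tangle_diagram_def)
  have "(\<Sum>i\<in>I. a i \<odot> Delta (fill C (L i))) \<in> vec.span {u. saddle_insertion (2 * n) u}"
  proof (rule Phi_kernel)
    show "(\<Sum>i\<in>I. a i \<odot> Delta (fill C (L i))) \<in> diagram_space (2 * n)"
      using Delta_closed[OF planar_good[OF planar]] len
      by (intro diagram_space_sum diagram_space_scale) (simp add: bd_fill)
    fix S assume "S \<subseteq> {..<2 * n}"
    then show "Phi (2 * n) (\<Sum>i\<in>I. a i \<odot> Delta (fill C (L i))) S = 0"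
      using fill_relation[OF surr L(1,2) sub rel] len by (simp only: Phi_sum Phi_scale)
  qed
  then show ?thesis using D by (simp cong: sum.cong)
qed

section \<open>Evaluation on words\<close>

text \<open>Words list the endpoints in order. Rotations and joins then act at the ends of lists,
  and the scalars of a local picture become a finite table that can be evaluated by cases.\<close>

definition trues :: "bool list \<Rightarrow> nat set" where
  "trues w = {i. i < length w \<and> w ! i}"

lemma trues_subset: "trues w \<subseteq> {..<length w}"
  by (auto simp: trues_def)

lemma trues_Nil [simp]: "trues [] = {}"
  by (simp add: trues_def)

lemma trues_append: "trues (u @ w) = trues u \<union> (+) (length u) ` trues w"
proof (intro equalityI subsetI)
  fix i assume i: "i \<in> trues (u @ w)"
  show "i \<in> trues u \<union> (+) (length u) ` trues w"
  proof (cases "i < length u")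
    case False
    then have "i = length u + (i - length u)" "i - length u \<in> trues w"
      using i by (auto simp: trues_def nth_append)
    then show ?thesis by blast
  qed (use i in \<open>auto simp: trues_def nth_append\<close>)
qed (auto simp: trues_def nth_append)

lemma trues_Cons: "trues (b # w) = (if b then insert 0 (Suc ` trues w) else Suc ` trues w)"
  using trues_append[of "[b]" w] by (auto simp: trues_def)

lemma finite_trues [simp]: "finite (trues w)"
  by (simp add: trues_def)

lemma card_trues: "card (trues w) = length (filter id w)"
proof (induction w)
  case (Cons b w)
  have "0 \<notin> Suc ` trues w" by blast
  then show ?case using Cons by (simp add: trues_Cons card_image)
qed simp

lemma trues_of_set:
  assumes "S \<subseteq> {..<k}"
  obtains w where "length w = k" "trues w = S"
  by (rule that[of "map (\<lambda>i. i \<in> S) [0..<k]"]) (use assms in \<open>auto simp: trues_def\<close>)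

text \<open>
  The word \<open>w\<close> describes the set of the endpoints that are occupied by dotted strands. A dotted
  strand that is moved past the basepoint passes all the other dotted endpoints, and a closed dotted
  loop is \<open>- 1\<close>.
\<close>

definition word_juxt :: "nat \<Rightarrow> (bool list \<Rightarrow> 'a) \<Rightarrow> (bool list \<Rightarrow> 'a) \<Rightarrow> bool list \<Rightarrow> 'a::comm_ring_1" where
  "word_juxt m f g w = f (take m w) * g (drop m w)"

definition word_rot :: "(bool list \<Rightarrow> 'a) \<Rightarrow> bool list \<Rightarrow> 'a::comm_ring_1" where
  "word_rot f w = (if last w then (- 1) ^ (length (filter id (butlast w)) div 2) else 1) *
     f (last w # butlast w)"

definition word_join :: "(bool list \<Rightarrow> 'a) \<Rightarrow> bool list \<Rightarrow> 'a::comm_ring_1" where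
  "word_join f w = f (False # False # w) - f (True # True # w)"

text \<open>Planarity is included, so that the rules for \<open>evaluates\<close> assemble a local
  picture and compute its table at the same time.\<close>

definition evaluates :: "tangle \<Rightarrow> (bool list \<Rightarrow> scalar) \<Rightarrow> bool" where
  "evaluates T f \<longleftrightarrow> planar T \<and>
     (\<forall>w. length w = length (bd T) \<longrightarrow> Phi (length (bd T)) (Delta T) (trues w) = f w)"

lemma evaluates_cong:
  "evaluates T f \<Longrightarrow> T = T' \<Longrightarrow> (\<And>w. length w = length (bd T') \<Longrightarrow> f w = f' w) \<Longrightarrow> evaluates T' f'"
  by (simp add: evaluates_def)

lemma evaluates_juxt:
  assumes eS: "evaluates (Tangle B A C) f" and eT: "evaluates (Tangle B' A' C') g"
    and dis: "points (Tangle B A C) \<inter> points (Tangle B' A' C') = {}"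
  shows "evaluates (Tangle (B @ B') (A \<union> A') (C \<union> C')) (word_juxt (length B) f g)"
proof -
  let ?S = "Tangle B A C" and ?T = "Tangle B' A' C'"
  interpret beside_tangles ?S ?T
    using eS eT dis by unfold_locales (auto simp: evaluates_def planar_good)
  have U: "Tangle (B @ B') (A \<union> A') (C \<union> C') = beside ?S ?T" by (simp add: beside_def)
  show ?thesis
    unfolding evaluates_def U
  proof (intro conjI allI impI)
    show "planar (beside ?S ?T)"
      by (intro planar.intros(4)) (use eS eT dis in \<open>simp_all add: evaluates_def\<close>)
    fix w :: "bool list" assume w: "length w = length (bd (beside ?S ?T))"
    have t: "trues w = trues (take (length B) w) \<union> (+) (length B) ` trues (drop (length B) w)"
    proof -
      have "length (take (length B) w) = length B" using w by (simp add: beside_def)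
      then show ?thesis using trues_append[of "take (length B) w" "drop (length B) w"]
        by (simp only: append_take_drop_id)
    qed
    have len: "length (take (length B) w) = length B" "length (drop (length B) w) = length B'"
      using w by (auto simp: beside_def)
    have "Phi (length B + length B') (Delta (beside ?S ?T)) (trues w) =
        Phi (length B) (Delta ?S) (trues (take (length B) w)) *
        Phi (length B') (Delta ?T) (trues (drop (length B) w))"
      unfolding Delta_beside t
      using Phi_juxt[of "trues (take (length B) w)" "length B" "trues (drop (length B) w)" "length B'"]
        trues_subset[of "take (length B) w"] trues_subset[of "drop (length B) w"] len by simp
    then show "Phi (length (bd (beside ?S ?T))) (Delta (beside ?S ?T)) (trues w) =
        word_juxt (length B) f g w"
      using eS eT len by (simp add: evaluates_def word_juxt_def beside_def)
  qed
qed

lemma evaluates_rot: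
  assumes T: "evaluates (Tangle (x # B) A C) f"
  shows "evaluates (Tangle (B @ [x]) A C) (word_rot f)"
proof -
  let ?T = "Tangle (x # B) A C"
  have U: "Tangle (B @ [x]) A C = move_basepoint ?T" by (simp add: move_basepoint_def)
  have good: "good ?T" using T by (simp add: evaluates_def planar_good)
  show ?thesis
    unfolding evaluates_def U
  proof (intro conjI allI impI)
    show "planar (move_basepoint ?T)" using T by (auto simp: evaluates_def intro: planar.intros)
    let ?n = "Suc (length B)"
    fix w :: "bool list" assume "length w = length (bd (move_basepoint ?T))"
    then have len: "length w = ?n" by (simp add: move_simps)
    then obtain u b where w: "w = u @ [b]" "length u = length B"
      by (metis append_butlast_last_id length_append_singleton length_greater_0_conv old.nat.inject zero_less_Suc)
    \<comment> \<open>The endpoint that has moved is the last letter \<open>b\<close> of the new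
      word and was the first letter of the old one.\<close>
    have "trues w = cycle ?n ` trues (b # u)"
    proof -
      have "cycle ?n ` Suc ` trues u = trues u" unfolding image_image by (simp add: cycle_def)
      moreover have "cycle ?n 0 = length B" by (simp add: cycle_def)
      ultimately show ?thesis
        unfolding w(1) trues_append trues_Cons using w(2) by simp
    qed
    moreover have "trues (b # u) \<subseteq> {..<?n}" using trues_subset[of "b # u"] w(2) by simp
    moreover have "Delta (move_basepoint ?T) = rot ?n (Delta ?T)" using Delta_move[OF good] by simp
    ultimately have "Phi ?n (Delta (move_basepoint ?T)) (trues w) =
        (if 0 \<in> trues (b # u) then (- 1) ^ ((card (trues (b # u)) - 1) div 2) else 1) *
        Phi ?n (Delta ?T) (trues (b # u))"
      by (simp only: Phi_rot)
    moreover have "0 \<in> trues (b # u) \<longleftrightarrow> b" by (auto simp: trues_Cons)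
    moreover have "card (trues (b # u)) - 1 = length (filter id u)" if b
      using that by (simp add: card_trues)
    moreover have "Phi ?n (Delta ?T) (trues (b # u)) = f (b # u)"
      using T w(2) by (simp add: evaluates_def)
    ultimately show "Phi (length (bd (move_basepoint ?T))) (Delta (move_basepoint ?T)) (trues w) = word_rot f w"
      by (simp add: w(1) word_rot_def move_simps)
  qed
qed

lemma evaluates_join_first:
  assumes T: "evaluates T f" and j: "joinable T"
  shows "evaluates (join_first T) (word_join f)"
proof -
  interpret joinable_tangle T using T j by unfold_locales (auto simp: evaluates_def planar_good)
  show ?thesis
    unfolding evaluates_def
  proof (intro conjI allI impI)
    show "planar (join_first T)" using T j by (auto simp: evaluates_def intro: planar.intros)
    fix w :: "bool list" assume w: "length w = length (bd (join_first T))"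
    have n: "length (bd T) = length w + 2" using w two by (simp add: join_simps)
    have t: "trues (False # False # w) = (+) 2 ` trues w" "trues (True # True # w) = {0, 1} \<union> (+) 2 ` trues w"
      by (auto simp: trues_Cons image_image)
    have "Phi (length w) (Delta (join_first T)) (trues w) =
        Phi (length w + 2) (Delta T) ((+) 2 ` trues w) - Phi (length w + 2) (Delta T) ({0, 1} \<union> (+) 2 ` trues w)"
      unfolding Delta_join n by (rule Phi_join[OF trues_subset])
    also have "\<dots> = word_join f w"
    proof -
      have "f u = Phi (length w + 2) (Delta T) (trues u)" if "length u = length w + 2" for u
        using T n that by (simp add: evaluates_def)
      from this[of "False # False # w"] this[of "True # True # w"] show ?thesis
        unfolding word_join_def t by simp
    qed
    finally show "Phi (length (bd (join_first T))) (Delta (join_first T)) (trues w) = word_join f w"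
      using w by simp
  qed
qed

definition word_strand :: "bool list \<Rightarrow> 'a::comm_ring_1" where
  "word_strand w = (if w = [False, False] \<or> w = [True, True] then 1 else 0)"

lemma evaluates_strand:
  assumes "a \<noteq> b"
  shows "evaluates (Tangle [entry d a, exit d b] {arc d a b} {}) word_strand"
proof -
  have base: "evaluates (Tangle [(a, Inward), (b, Outward)] {(a, b)} {}) word_strand" if "a \<noteq> b" for a b
    unfolding evaluates_def
  proof (intro conjI allI impI)
    show "planar (Tangle [(a, Inward), (b, Outward)] {(a, b)} {})" by (rule planar.intros(2)[OF that])
    fix w :: "bool list" assume w: "length w = length (bd (Tangle [(a, Inward), (b, Outward)] {(a, b)} {}))"
    have "Phi 2 (basis (link 0 1)) (trues w) = word_strand w"
    proof -
      obtain x y where xy: "w = [x, y]" using w by (auto simp: length_Suc_conv)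
      have mem: "i \<in> trues [x, y] \<longleftrightarrow> i = 0 \<and> x \<or> i = 1 \<and> y" for i by (auto simp: trues_Cons)
      have "trues w = {} \<longleftrightarrow> \<not> x \<and> \<not> y" "trues w = {0, 1} \<longleftrightarrow> x \<and> y"
        unfolding xy set_eq_iff mem by auto
      moreover have "trues w \<subseteq> {..<2}" using trues_subset[of w] xy by (simp add: numeral_2_eq_2)
      ultimately show ?thesis using xy by (simp add: Phi_basis[OF link01, simplified] weight_link01[simplified] word_strand_def)
    qed
    then show "Phi (length (bd (Tangle [(a, Inward), (b, Outward)] {(a, b)} {})))
        (Delta (Tangle [(a, Inward), (b, Outward)] {(a, b)} {})) (trues w) = word_strand w"
      unfolding Delta_strand[OF that] by (simp add: numeral_2_eq_2)
  qed
  show ?thesis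
  proof (cases d)
    case True
    then show ?thesis using base[OF assms] by (simp add: entry_def exit_def arc_def)
  next
    case False
    show ?thesis
      \<comment> \<open>A strand that enters at \<open>b\<close> and leaves at \<open>a\<close> is
        the standard strand rotated once. Two dotted endpoints give the sign
        \<open>(- 1) ^ (1 div 2)\<close>, which is 1.\<close>
      by (rule evaluates_cong[OF evaluates_rot[OF base[OF assms[symmetric]]]])
        (use False in \<open>auto simp: entry_def exit_def arc_def word_rot_def word_strand_def length_Suc_conv\<close>)
  qed
qed

subsection \<open>Crossings\<close>

text \<open>The letters stand for SW, SE, NE, NW, and \<open>p\<close> for the inverse of
  \<open>q\<close>. An entry sums the coefficients in \<open>crossing_vec\<close>, with weights, of
  the diagrams in which the chosen endpoints are those of some strands. All four dotted endpoints
  give a sign, as the strands NW-SW and NE-SE are nested seen from the basepoint. Nonzero entries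
  have equally many dots at the bottom and at the top, the pattern of the six-vertex model.\<close>

definition word_crossing :: "'a \<Rightarrow> 'a \<Rightarrow> bool \<Rightarrow> bool list \<Rightarrow> 'a::comm_ring_1" where
  "word_crossing q p pos w =
    (if w = [True, True, True, True] then - (if pos then q else p)
     else if w = [False, False, False, False] then - (if pos then p else q)
     else if w = [True, False, False, True] then (if pos then q - p else 0)
     else if w = [False, True, True, False] then (if pos then 0 else p - q)
     else if w = [False, True, False, True] then q
     else if w = [True, False, True, False] then p else 0)"

lemma weight_link:
  assumes "i < j"
  shows "weight (link i j) S = (if S = {} \<or> S = {i, j} then 1 else 0)"
proof -
  have c: "covers (link i j) S \<longleftrightarrow> S = {} \<or> S = {i, j}"
    using assms by (auto simp: covers_def link_def)
  have o: "opens (link i j) {i, j} = {i}" "opens (link i j) {} = {}"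
    using assms by (auto simp: opens_def link_def)
  have "{i, j} \<inter> {..<i} = {}" using assms by auto
  then show ?thesis by (auto simp: weight_def c o)
qed

lemma weight_nested:
  "weight (link 0 3 \<union> link 1 2) S =
    (if S = {} \<or> S = {0, 3} \<or> S = {1, 2} then 1 else if S = {0, 1, 2, 3} then - 1 else 0)"
proof -
  let ?M = "link 0 3 \<union> link 1 2"
  have c: "covers ?M S \<longleftrightarrow> S = {} \<or> S = {0, 3} \<or> S = {1, 2} \<or> S = {0, 1, 2, 3}"
  proof
    assume cov: "covers ?M S"
    have "S \<subseteq> {0, 1, 2, 3}" using cov by (auto simp: covers_def link_def)
    moreover have "0 \<in> S \<longleftrightarrow> 3 \<in> S" "1 \<in> S \<longleftrightarrow> 2 \<in> S" using cov by (auto simp: covers_def link_def)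
    ultimately show "S = {} \<or> S = {0, 3} \<or> S = {1, 2} \<or> S = {0, 1, 2, 3}"
      by (cases "0 \<in> S"; cases "1 \<in> S") auto
  qed (auto simp: covers_def link_def)
  have o: "opens ?M {} = {}" "opens ?M {0, 3} = {0}" "opens ?M {1, 2} = {1}" "opens ?M {0, 1, 2, 3} = {0, 1}"
    by (auto simp: opens_def link_def)
  have i: "{1, 2} \<inter> {..<1::nat} = {}" "{0, 1, 2, 3} \<inter> {..<1::nat} = {0}" by auto
  \<comment> \<open>The outer strand starts at rank 0 and the inner one at rank 1.\<close>
  have e: "(\<Prod>k\<in>{0, 1::nat}. (- 1) ^ card ({0, 1, 2, 3} \<inter> {..<k}) :: scalar) = - 1"
    by (subst prod.insert) (simp_all add: i[simplified])
  have ne: "{0, 1, 2, 3 :: nat} \<noteq> {0, 3}" "{0, 1, 2, 3 :: nat} \<noteq> {1, 2}"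
  proof -
    have "1 \<in> {0, 1, 2, 3 :: nat} \<and> 1 \<notin> {0, 3 :: nat}" "0 \<in> {0, 1, 2, 3 :: nat} \<and> 0 \<notin> {1, 2 :: nat}"
      by simp_all
    then show "{0, 1, 2, 3 :: nat} \<noteq> {0, 3}" "{0, 1, 2, 3 :: nat} \<noteq> {1, 2}" by blast+
  qed
  consider "S = {}" | "S = {0, 3}" | "S = {1, 2}" | "S = {0, 1, 2, 3}" | "\<not> covers ?M S"
    using c by blast
  then show ?thesis
  proof cases
    case 4
    then have "weight ?M S = - 1" unfolding weight_def using c o(4) e by simp
    then show ?thesis unfolding 4 using ne by simp
  next
    case 5
    then show ?thesis using c by (simp add: weight_def)
  next
    case 1
    then show ?thesis using c by (simp add: weight_def o(1)[simplified])
  next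
    case 2
    then have "weight ?M S = 1" unfolding weight_def using c o(2) by simp
    then show ?thesis using 2 by simp
  next
    case 3
    then have "weight ?M S = 1" unfolding weight_def using c o(3) i(1) by simp
    then show ?thesis using 3 by simp
  qed
qed

lemma trues_4_eq:
  assumes "X \<subseteq> {0, 1, 2, 3}"
  shows "trues [a, b, c, d] = X \<longleftrightarrow>
    (a \<longleftrightarrow> 0 \<in> X) \<and> (b \<longleftrightarrow> 1 \<in> X) \<and> (c \<longleftrightarrow> 2 \<in> X) \<and> (d \<longleftrightarrow> 3 \<in> X)"
proof -
  have mem: "i \<in> trues [a, b, c, d] \<longleftrightarrow> i = 0 \<and> a \<or> i = 1 \<and> b \<or> i = 2 \<and> c \<or> i = 3 \<and> d" for i
    by (auto simp: trues_Cons)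
  show ?thesis
  proof
    assume "trues [a, b, c, d] = X"
    then show "(a \<longleftrightarrow> 0 \<in> X) \<and> (b \<longleftrightarrow> 1 \<in> X) \<and> (c \<longleftrightarrow> 2 \<in> X) \<and> (d \<longleftrightarrow> 3 \<in> X)"
      using mem[of 0] mem[of 1] mem[of 2] mem[of 3] by simp
  next
    assume R: "(a \<longleftrightarrow> 0 \<in> X) \<and> (b \<longleftrightarrow> 1 \<in> X) \<and> (c \<longleftrightarrow> 2 \<in> X) \<and> (d \<longleftrightarrow> 3 \<in> X)"
    have "i \<in> trues [a, b, c, d] \<longleftrightarrow> i \<in> X" for i
      unfolding mem using R assms by blast
    then show "trues [a, b, c, d] = X" by blast
  qed
qed

lemma Phi_crossing_vec:
  assumes "length w = 4"
  shows "Phi 4 (crossing_vec s) (trues w) = word_crossing qvar (inverse qvar) (s = Pos) w"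
proof -
  obtain a b c d where w: "w = [a, b, c, d]" using assms by (auto simp: length_Suc_conv eval_nat_numeral)
  have l: "link 3 0 = link 0 3" "link 2 1 = link 1 2" "link 3 1 = link 1 3"
    by (simp_all only: link_commute)
  have M: "link 0 3 \<union> link 1 2 \<in> matchings 4" "link 1 3 \<in> matchings 4" "link 1 2 \<in> matchings 4"
    "link 0 2 \<in> matchings 4" "link 0 3 \<in> matchings 4" "{} \<in> matchings 4"
    by (rule matchingsI; auto simp: link_def)+
  have t: "trues w = {} \<longleftrightarrow> w = [False, False, False, False]"
    "trues w = {0, 3} \<longleftrightarrow> w = [True, False, False, True]"
    "trues w = {1, 2} \<longleftrightarrow> w = [False, True, True, False]"
    "trues w = {0, 2} \<longleftrightarrow> w = [True, False, True, False]"
    "trues w = {1, 3} \<longleftrightarrow> w = [False, True, False, True]"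
    "trues w = {0, 1, 2, 3} \<longleftrightarrow> w = [True, True, True, True]"
    unfolding w by (subst trues_4_eq; simp)+
  have less: "0 < (3::nat)" "1 < (2::nat)" "0 < (2::nat)" "1 < (3::nat)" by simp_all
  show ?thesis
    unfolding crossing_vec_def l Phi_add Phi_diff Phi_scale
    unfolding Phi_basis[OF M(1)] Phi_basis[OF M(2)] Phi_basis[OF M(3)] Phi_basis[OF M(4)]
      Phi_basis[OF M(5)] Phi_basis[OF M(6)] weight_nested weight_link[OF less(1)] weight_link[OF less(2)]
      weight_link[OF less(3)] weight_link[OF less(4)] weight_empty_matching t word_crossing_def
    by (cases s) auto
qed

lemma evaluates_crossing_tangle:
  assumes "distinct [sw, se, ne, nw]"
  shows "evaluates (crossing_tangle s sw se ne nw) (word_crossing qvar (inverse qvar) (s = Pos))"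
  unfolding evaluates_def
proof (intro conjI allI impI)
  show "planar (crossing_tangle s sw se ne nw)" by (rule planar.intros(3)[OF assms])
  fix w :: "bool list" assume "length w = length (bd (crossing_tangle s sw se ne nw))"
  moreover have "length (bd (crossing_tangle s sw se ne nw)) = 4" by (simp add: crossing_tangle_def)
  ultimately show "Phi (length (bd (crossing_tangle s sw se ne nw)))
      (Delta (crossing_tangle s sw se ne nw)) (trues w) = word_crossing qvar (inverse qvar) (s = Pos) w"
    using Phi_crossing_vec Delta_crossing[OF assms] by simp
qed

subsection \<open>Words of crossings and Reidemeister moves\<close>

text \<open>
  The table for \<open>cross over d0 d1\<close> is that of \<open>word_crossing\<close>, turned by \<open>word_rot\<close>.
\<close>

definition word_cross :: "'a \<Rightarrow> 'a \<Rightarrow> bool \<Rightarrow> bool \<Rightarrow> bool \<Rightarrow> bool list \<Rightarrow> 'a::comm_ring_1" where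
  "word_cross q p over d0 d1 w =
    (if d0 = d1 then
       (if w = [True, True, True, True] then - (if over then q else p)
        else if w = [False, False, False, False] then - (if over then p else q)
        else if w = [d0, \<not> d0, \<not> d0, d0] then (if over then q - p else 0)
        else if w = [\<not> d0, d0, d0, \<not> d0] then (if over then 0 else p - q)
        else if w = [False, True, False, True] then q
        else if w = [True, False, True, False] then p else 0)
     else
       (if w = [True, True, True, True] then (if over then p else q)
        else if w = [False, False, False, False] then - (if over then q else p)
        else if w = [d1, d1, d0, d0] then (if over then 0 else q - p)
        else if w = [d0, d0, d1, d1] then (if over then p - q else 0)
        else if w = [True, False, True, False] then q
        else if w = [False, True, False, True] then p else 0))"

lemma length_4: "length w = 4 \<Longrightarrow> \<exists>a b c d. w = [a, b, c, d]"
  by (auto simp: length_Suc_conv eval_nat_numeral)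

text \<open>When the basepoint has passed \<open>p0\<close>, the strand on \<open>p1\<close>,
  \<open>p3\<close> comes first and keeps its direction, and the other one comes second and is
  reversed. As \<open>over\<close> refers to the first strand, it is negated.\<close>

lemma word_rot_cross:
  "length w = 4 \<Longrightarrow> word_rot (word_cross q p over d0 d1) w = word_cross q p (\<not> over) d1 (\<not> d0) w"
proof -
  assume "length w = 4"
  then obtain a b c d where w: "w = [a, b, c, d]" using length_4 by blast
  show ?thesis
    unfolding w by (cases a; cases b; cases c; cases d; cases d0; cases d1)
      (simp_all add: word_rot_def word_cross_def)
qed

lemma evaluates_rot_cross:
  assumes "evaluates (Tangle [x, y, z, t] A C) (word_cross qvar p over d0 d1)"
  shows "evaluates (Tangle [y, z, t, x] A C) (word_cross qvar p (\<not> over) d1 (\<not> d0))"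
  by (rule evaluates_cong[OF evaluates_rot[OF assms]]) (simp_all add: word_rot_cross)

text \<open>In the four cases the ports of \<open>cross\<close> start at \<open>p0\<close>,
  \<open>p3\<close>, \<open>p1\<close> and \<open>p2\<close>, so 0, 1, 3 and 2 rotations put
  \<open>p0\<close> in front.\<close>

lemma evaluates_cross:
  assumes "distinct [p0, p1, p2, p3]"
  shows "evaluates (Tangle [entry d0 p0, entry d1 p1, exit d0 p2, exit d1 p3] {}
      {cross over d0 d1 p0 p1 p2 p3}) (word_cross qvar (inverse qvar) over d0 d1)"
proof -
  have base: "evaluates (Tangle [(sw, Inward), (se, Inward), (ne, Outward), (nw, Outward)] {}
      {Crossing s [sw, se, ne, nw]}) (word_cross qvar (inverse qvar) (s = Pos) True True)"
    if "distinct [sw, se, ne, nw]" for s sw se ne nw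
  proof (rule evaluates_cong[OF evaluates_crossing_tangle[OF that]])
    fix w :: "bool list"
    show "word_crossing qvar (inverse qvar) (s = Pos) w = word_cross qvar (inverse qvar) (s = Pos) True True w"
      by (simp add: word_crossing_def word_cross_def)
  qed (simp add: crossing_tangle_def)
  have s: "((if over then Pos else Neg) = Pos) = over" "((if over then Neg else Pos) = Pos) = (\<not> over)"
    by simp_all
  show ?thesis
  proof (cases d0; cases d1)
    assume "d0" "d1"
    then show ?thesis
      using base[of p0 p1 p2 p3 "if over then Pos else Neg", unfolded s] assms
      by (simp add: entry_def exit_def)
  next
    assume "d0" "\<not> d1"
    have "distinct [p3, p0, p1, p2]" using assms by auto
    from evaluates_rot_cross[OF base[OF this, of "if over then Neg else Pos", unfolded s]]
    show ?thesis using \<open>d0\<close> \<open>\<not> d1\<close> by (simp add: entry_def exit_def)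
  next
    assume "\<not> d0" "d1"
    have "distinct [p1, p2, p3, p0]" using assms by auto
    from evaluates_rot_cross[OF evaluates_rot_cross[OF evaluates_rot_cross[OF
          base[OF this, of "if over then Neg else Pos", unfolded s]]]]
    show ?thesis using \<open>\<not> d0\<close> \<open>d1\<close> by (simp add: entry_def exit_def)
  next
    assume "\<not> d0" "\<not> d1"
    have "distinct [p2, p3, p0, p1]" using assms by auto
    from evaluates_rot_cross[OF evaluates_rot_cross[OF
          base[OF this, of "if over then Pos else Neg", unfolded s]]]
    show ?thesis using \<open>\<not> d0\<close> \<open>\<not> d1\<close> by (simp add: entry_def exit_def)
  qed
qed

text \<open>Three rotations bring the adjacent pair of inner endpoints to the front, five more bring
  together both ends of the remaining inner strand, and two return to the basepoint.\<close>

definition word_R2 :: "(bool list \<Rightarrow> 'a) \<Rightarrow> (bool list \<Rightarrow> 'a) \<Rightarrow> bool list \<Rightarrow> 'a::comm_ring_1" where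
  "word_R2 f g = word_rot (word_rot (word_join (word_rot (word_rot (word_rot (word_rot (word_rot
     (word_join (word_rot (word_rot (word_rot (word_juxt 4 f g))))))))))))"

text \<open>The left strand is rotated so that the juxtaposition is listed as NW, SW, SE, NE. One
  more rotation gives the order of a crossing.\<close>

definition word_parallel :: "bool list \<Rightarrow> 'a::comm_ring_1" where
  "word_parallel = word_rot (word_juxt 2 (word_rot word_strand) word_strand)"

text \<open>Tables take values in any commutative ring with \<open>q * p = 1\<close>, so the finite
  check is polynomial arithmetic and no fractions occur.\<close>

lemma word_R2_identity:
  fixes q p :: "'a::comm_ring_1"
  assumes "q * p = 1" "length w = 4"
  shows "word_R2 (word_cross q p over d0 d1) (word_cross q p (\<not> over) d1 d0) w = word_parallel w"
proof -
  obtain a b c d where w: "w = [a, b, c, d]" using assms(2) by (auto simp: length_Suc_conv eval_nat_numeral)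
  have qp: "p * q = 1" "q * (p * x) = x" "p * (q * x) = x" for x
    using assms(1) by (simp_all add: mult.assoc[symmetric] mult.commute[of p q])
  note qp = qp assms(1)
  show ?thesis
    unfolding w word_R2_def word_parallel_def
    by (cases over; cases d0; cases d1; cases a; cases b; cases c; cases d)
      (simp_all add: word_rot_def word_juxt_def word_join_def word_strand_def word_cross_def qp algebra_simps)
qed

text \<open>Three crossings around a triangle: \<open>f\<close> and \<open>g\<close> are joined
  along one side, then \<open>g\<close> and \<open>h\<close>, and the last join closes the triangle
  between \<open>h\<close> and \<open>f\<close>.\<close>

definition word_R3 :: "(bool list \<Rightarrow> 'a) \<Rightarrow> (bool list \<Rightarrow> 'a) \<Rightarrow> (bool list \<Rightarrow> 'a) \<Rightarrow> bool list \<Rightarrow> 'a::comm_ring_1" where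
  "word_R3 f g h = word_join (word_rot (word_rot (word_join (word_rot (word_rot (word_rot (word_rot (word_rot (word_juxt 6 (word_rot (word_rot (word_rot (word_join (word_rot (word_rot (word_rot (word_juxt 4 f g)))))))) h)))))))))"

text \<open>
  In a state sum all words that occur are even, so that the labels of two of the three inner
  strands are determined by the third one.
\<close>

definition even_supported :: "(bool list \<Rightarrow> 'a::zero) \<Rightarrow> bool" where
  "even_supported f \<longleftrightarrow> (\<forall>a b c d. (a \<noteq> b) \<noteq> (c \<noteq> d) \<longrightarrow> f [a, b, c, d] = 0)"

text \<open>\<open>x\<close>, \<open>y\<close>, \<open>z\<close> label the sides between
  \<open>f\<close> and \<open>g\<close>, \<open>g\<close> and \<open>h\<close>, \<open>h\<close> and
  \<open>f\<close>. Evenness of \<open>g\<close> and \<open>f\<close> determines \<open>y\<close>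
  and \<open>z\<close>, so two of eight terms remain. The sign collects the factors of the three
  joins and of the rotations.\<close>

lemma word_R3_eq:
  fixes f g h :: "bool list \<Rightarrow> 'a::comm_ring_1"
  assumes "even_supported f" "even_supported g" "even_supported h"
  defines "t \<equiv> \<lambda>a b c d e k x. let y = ((c \<noteq> d) \<noteq> x); z = ((a \<noteq> b) \<noteq> x) in
      (if z \<and> (c \<noteq> ((x \<and> (a \<noteq> c)) \<noteq> ((y \<and> (c \<noteq> e)) \<noteq> (x \<and> y)))) then - 1 else 1) *
      (f [z, a, b, x] * g [x, c, d, y] * h [y, e, k, z])"
  shows "word_R3 f g h [a, b, c, d, e, k] = t a b c d e k False + t a b c d e k True"
proof -
  have even: "(a \<noteq> b) \<noteq> (c \<noteq> d) \<Longrightarrow> F [a, b, c, d] = 0" if "even_supported F" for F :: "bool list \<Rightarrow> 'a" and a b c d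
    by (rule that[unfolded even_supported_def, rule_format])
  note even = even[OF assms(1)] even[OF assms(2)] even[OF assms(3)]
  \<comment> \<open>The signs of the rotations stay folded until the terms with odd words have been
    removed.\<close>
  define sg :: "bool list \<Rightarrow> 'a" where
    "sg w = (if last w then (- 1) ^ (length (filter id (butlast w)) div 2) else 1)" for w
  have rot: "word_rot F w = sg w * F (last w # butlast w)" for F w
    by (simp add: word_rot_def sg_def)
  show ?thesis
    unfolding word_R3_def
    by (simp add: rot word_juxt_def word_join_def;
        cases a; cases b; cases c; cases d; cases e; cases k; simp add: even t_def Let_def; (simp add: sg_def)?)
qed

lemma word_cross_even: "even_supported (word_cross q p over d0 d1)"
  unfolding even_supported_def
proof (intro allI)
  fix a b c d
  show "(a \<noteq> b) \<noteq> (c \<noteq> d) \<longrightarrow> word_cross q p over d0 d1 [a, b, c, d] = 0"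
    by (cases a; cases b; cases c; cases d; cases d0; cases d1) (simp_all add: word_cross_def)
qed

text \<open>The two excluded patterns of \<open>o01\<close>, \<open>o02\<close>, \<open>o12\<close>
  are the cyclic ones, which no order of heights produces. The outer rotation on the right accounts
  for reading that triangle from the boundary endpoint listed last.\<close>

lemma word_R3_identity:
  fixes q p :: "'a::comm_ring_1"
  assumes "q * p = 1"
    and height: "\<not> (o01 \<and> o12 \<and> \<not> o02)" "\<not> (\<not> o01 \<and> \<not> o12 \<and> o02)"
    and "length w = 6"
  shows "word_R3 (word_cross q p (\<not> o01) (\<not> d1) d0) (word_cross q p o02 d0 d2)
      (word_cross q p (\<not> o12) d2 (\<not> d1)) w =
    word_rot (word_R3 (word_cross q p o02 (\<not> d0) (\<not> d2)) (word_cross q p (\<not> o12) (\<not> d2) d1)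
      (word_cross q p (\<not> o01) d1 (\<not> d0))) w"
proof -
  obtain a b c d e k where w: "w = [a, b, c, d, e, k]"
    using assms(4) by (auto simp: length_Suc_conv eval_nat_numeral)
  have qp: "p * q = 1" "q * (p * x) = x" "p * (q * x) = x" for x
    using assms(1) by (simp_all add: mult.assoc[symmetric] mult.commute[of p q])
  note qp = qp assms(1)
  have rot: "word_rot F [a, b, c, d, e, k] =
      (if k then (- 1) ^ (length (filter id [a, b, c, d, e]) div 2) else 1) * F [k, a, b, c, d, e]"
    for F :: "bool list \<Rightarrow> 'a" by (simp add: word_rot_def)
  note expand = word_R3_eq[OF word_cross_even word_cross_even word_cross_even]
  show ?thesis
    unfolding w rot expand
    using height
    by (cases d0; cases d1; cases d2; cases a; cases b; cases c; cases d; cases e; cases k;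
        simp add: word_cross_def split del: if_split;
        cases o01; cases o02; cases o12; simp add: qp algebra_simps)
qed

section \<open>The moves\<close>

lemma points_Tangle: "points (Tangle B A C) = fst ` set B \<union> Field A \<union> (\<Union>c\<in>C. set (ports c))"
  by (simp add: points_def)

lemma set_ports_cross [simp]: "set (ports (cross over d0 d1 p0 p1 p2 p3)) = {p0, p1, p2, p3}"
  by (cases d0; cases d1) auto

lemma fst_entry_exit [simp]: "fst (entry d x) = x" "fst (exit d x) = x"
  by (simp_all add: entry_def exit_def)

lemma snd_entry_exit [simp]: "snd (entry d x) \<noteq> snd (exit d y)" "snd (exit d x) \<noteq> snd (entry d y)"
  by (simp_all add: entry_def exit_def)

definition joint :: "nat \<times> dir \<Rightarrow> nat \<times> dir \<Rightarrow> nat \<times> nat" where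
  "joint x y = (if snd x = Outward then (fst x, fst y) else (fst y, fst x))"

lemma joint_arc: "joint (exit d u) (entry d v) = arc d u v" "joint (entry d v) (exit d u) = arc d u v"
  by (simp_all add: joint_def entry_def exit_def arc_def)

lemma Field_joint: "Field (insert (joint x y) A) = insert (fst x) (insert (fst y) (Field A))"
  by (auto simp: joint_def)

lemma evaluates_joint:
  assumes "evaluates (Tangle (x # y # B) A C) f" "snd x \<noteq> snd y"
  shows "evaluates (Tangle B (insert (joint x y) A) C) (word_join f)"
  by (rule evaluates_cong[OF evaluates_join_first[OF assms(1)]])
    (use assms(2) in \<open>auto simp: joinable_def join_first_def joint_def Let_def\<close>)

lemma evaluates_R2:
  assumes f: "evaluates (Tangle [a, b, x, y] {} C) f" and g: "evaluates (Tangle [y', x', c, d] {} D) g"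
    and disj: "points (Tangle [a, b, x, y] {} C) \<inter> points (Tangle [y', x', c, d] {} D) = {}"
    and dirs: "snd x \<noteq> snd x'" "snd y \<noteq> snd y'"
  shows "evaluates (Tangle [a, b, c, d] {joint x x', joint y y'} (C \<union> D)) (word_R2 f g)"
proof -
  from evaluates_juxt[OF f g disj]
  have "evaluates (Tangle [a, b, x, y, y', x', c, d] {} (C \<union> D)) (word_juxt 4 f g)"
    by (simp add: eval_nat_numeral)
  note this [THEN evaluates_rot, simplified, THEN evaluates_rot, simplified, THEN evaluates_rot, simplified]
  from evaluates_joint[OF this dirs(2)]
  have "evaluates (Tangle [x', c, d, a, b, x] {joint y y'} (C \<union> D))
      (word_join (word_rot (word_rot (word_rot (word_juxt 4 f g)))))" .
  note this [THEN evaluates_rot, simplified, THEN evaluates_rot, simplified, THEN evaluates_rot, simplified,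
      THEN evaluates_rot, simplified, THEN evaluates_rot, simplified]
  from evaluates_joint[OF this dirs(1)]
  have "evaluates (Tangle [c, d, a, b] {joint x x', joint y y'} (C \<union> D)) (word_join (word_rot (word_rot (word_rot (word_rot
      (word_rot (word_join (word_rot (word_rot (word_rot (word_juxt 4 f g)))))))))))" .
  note this [THEN evaluates_rot, simplified, THEN evaluates_rot, simplified]
  then show ?thesis unfolding word_R2_def .
qed

text \<open>Each crossing is listed from one side of the triangle to the next, with its outer
  corners in the middle, so that the corners to be joined become neighbours.\<close>

lemma evaluates_R3:
  assumes f: "evaluates (Tangle [z, a, b, x] {} C) f" and g: "evaluates (Tangle [x', c, d, y] {} D) g"
    and h: "evaluates (Tangle [y', e, k, z'] {} E) h"
    and disj: "points (Tangle [z, a, b, x] {} C) \<inter> points (Tangle [x', c, d, y] {} D) = {}"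
      "(points (Tangle [z, a, b, x] {} C) \<union> points (Tangle [x', c, d, y] {} D)) \<inter>
        points (Tangle [y', e, k, z'] {} E) = {}"
    and dirs: "snd x \<noteq> snd x'" "snd y \<noteq> snd y'" "snd z' \<noteq> snd z"
  shows "evaluates (Tangle [a, b, c, d, e, k] {joint x x', joint y y', joint z' z} (C \<union> D \<union> E))
    (word_R3 f g h)"
proof -
  from evaluates_juxt[OF f g disj(1)]
  have "evaluates (Tangle [z, a, b, x, x', c, d, y] {} (C \<union> D)) (word_juxt 4 f g)"
    by (simp add: eval_nat_numeral)
  note this [THEN evaluates_rot, simplified, THEN evaluates_rot, simplified, THEN evaluates_rot, simplified]
  from evaluates_joint[OF this dirs(1)]
  have "evaluates (Tangle [c, d, y, z, a, b] {joint x x'} (C \<union> D))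
      (word_join (word_rot (word_rot (word_rot (word_juxt 4 f g)))))" .
  note fg = this [THEN evaluates_rot, simplified, THEN evaluates_rot, simplified, THEN evaluates_rot, simplified]
  have "points (Tangle [z, a, b, c, d, y] {joint x x'} (C \<union> D)) \<subseteq>
      points (Tangle [z, a, b, x] {} C) \<union> points (Tangle [x', c, d, y] {} D)"
    by (auto simp: points_Tangle Field_joint)
  then have "points (Tangle [z, a, b, c, d, y] {joint x x'} (C \<union> D)) \<inter> points (Tangle [y', e, k, z'] {} E) = {}"
    using disj(2) by blast
  from evaluates_juxt[OF fg h this]
  have "evaluates (Tangle [z, a, b, c, d, y, y', e, k, z'] {joint x x'} (C \<union> D \<union> E))
      (word_juxt 6 (word_rot (word_rot (word_rot (word_join (word_rot (word_rot (word_rot (word_juxt 4 f g)))))))) h)"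
    by (simp add: eval_nat_numeral)
  note this [THEN evaluates_rot, simplified, THEN evaluates_rot, simplified, THEN evaluates_rot, simplified,
      THEN evaluates_rot, simplified, THEN evaluates_rot, simplified]
  from evaluates_joint[OF this dirs(2)]
  have "evaluates (Tangle [e, k, z', z, a, b, c, d] {joint y y', joint x x'} (C \<union> D \<union> E)) (word_join
      (word_rot (word_rot (word_rot (word_rot (word_rot (word_juxt 6 (word_rot (word_rot (word_rot
        (word_join (word_rot (word_rot (word_rot (word_juxt 4 f g)))))))) h)))))))" .
  note this [THEN evaluates_rot, simplified, THEN evaluates_rot, simplified]
  from evaluates_joint[OF this dirs(3)]
  show ?thesis
    unfolding word_R3_def by (simp add: insert_commute)
qed

lemma evaluates_parallel:
  assumes "distinct [a0, a1, b0, b1]"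
  shows "evaluates (Tangle [entry d0 a0, entry d1 a1, exit d1 b1, exit d0 b0]
    {arc d0 a0 b0, arc d1 a1 b1} {}) word_parallel"
proof -
  have "a0 \<noteq> b0" "a1 \<noteq> b1" using assms by auto
  from evaluates_juxt[OF evaluates_rot[OF evaluates_strand[OF this(1)], simplified] evaluates_strand[OF this(2)], of d0 d1]
  have "evaluates (Tangle [exit d0 b0, entry d0 a0, entry d1 a1, exit d1 b1] {arc d0 a0 b0, arc d1 a1 b1} {})
      (word_juxt 2 (word_rot word_strand) word_strand)"
    using assms by (simp add: points_Tangle arc_def insert_commute numeral_2_eq_2)
  from evaluates_rot[OF this] show ?thesis by (simp add: word_parallel_def)
qed

section \<open>Checking the local relations on their tables\<close>

lemma saddle_cong_sym: "saddle_cong m v w \<Longrightarrow> saddle_cong m w v"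
  unfolding saddle_cong_def using vec.span_neg[of "v - w" "{u. saddle_insertion m u}"]
  by (simp only: minus_diff_eq)

lemma pair_relation:
  assumes same: "identical_except [L, L'] [T, T']" and T: "tangle_diagram n T" "tangle_diagram n T'"
    and bd: "bd L = bd L'" and ev: "evaluates L f" "evaluates L' g"
    and rel: "\<And>w. length w = length (bd L) \<Longrightarrow> g w = c * f w"
  shows "saddle_cong (2 * n) (Delta T') (c \<odot> Delta T)"
proof -
  obtain C where C: "fits C L" "fits C L'" "same_diagram T (fill C L)" "same_diagram T' (fill C L')"
    using same by (auto simp: identical_except_def)
  let ?a = "\<lambda>b. if b then 1 else - c" and ?L = "\<lambda>b. if b then L' else L" and ?T = "\<lambda>b. if b then T' else T"
  have "(\<Sum>i\<in>UNIV. ?a i \<odot> Delta (?T i)) \<in> vec.span {u. saddle_insertion (2 * n) u}"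
  proof (rule local_relation[where L = ?L and H = "bd L" and C = C])
    fix S assume "S \<subseteq> {..<length (bd L)}"
    then obtain w where w: "length w = length (bd L)" "trues w = S" by (rule trues_of_set)
    have "Phi (length (bd L)) (Delta L) S = f w" "Phi (length (bd L)) (Delta L') S = g w"
      using ev w bd unfolding evaluates_def by auto
    then show "(\<Sum>i\<in>UNIV. ?a i * Phi (length (bd L)) (Delta (?L i)) S) = 0"
      using rel[OF w(1)] by (simp add: UNIV_bool)
  qed (use C T bd ev in \<open>auto simp: evaluates_def split: if_splits\<close>)
  moreover have "(\<Sum>i\<in>UNIV. ?a i \<odot> Delta (?T i)) = Delta T' - c \<odot> Delta T"
    by (simp add: UNIV_bool fun_eq_iff)
  ultimately show ?thesis unfolding saddle_cong_def by simp
qed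

lemma qvar_inverse: "qvar * inverse qvar = 1"
proof -
  have "qvar \<noteq> 0" by (simp add: qvar_def Zero_fract_def eq_fract)
  then show ?thesis by simp
qed

lemma skein_relation:
  assumes same: "skein_triple Tp Tm T0" and T: "tangle_diagram n Tp" "tangle_diagram n Tm" "tangle_diagram n T0"
  shows "saddle_cong (2 * n) (Delta Tp - Delta Tm) ((qvar - inverse qvar) \<odot> Delta T0)"
proof -
  obtain sw se ne nw where dist: "distinct [sw, se, ne, nw]" and id: "identical_except
       [crossing_tangle Pos sw se ne nw, crossing_tangle Neg sw se ne nw,
        Tangle [(sw, Inward), (se, Inward), (ne, Outward), (nw, Outward)] {(sw, nw), (se, ne)} {}]
       [Tp, Tm, T0]"
    using same unfolding skein_triple_def by blast
  let ?H = "[(sw, Inward), (se, Inward), (ne, Outward), (nw, Outward)]"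
  let ?L = "\<lambda>i::nat. if i = 0 then crossing_tangle Pos sw se ne nw else
    if i = 1 then crossing_tangle Neg sw se ne nw else Tangle ?H {(sw, nw), (se, ne)} {}"
  let ?T = "\<lambda>i::nat. if i = 0 then Tp else if i = 1 then Tm else T0"
  let ?a = "\<lambda>i::nat. if i = 0 then 1 else if i = 1 then - 1 else - (qvar - inverse qvar)"
  obtain C where "fits C (?L 0)" "fits C (?L 1)" "fits C (?L 2)" "same_diagram Tp (fill C (?L 0))"
    "same_diagram Tm (fill C (?L 1))" "same_diagram T0 (fill C (?L 2))"
    using id by (auto simp: identical_except_def)
  then have C: "fits C (?L i)" "same_diagram (?T i) (fill C (?L i))" for i by simp_all
  \<comment> \<open>\<open>evaluates_parallel\<close> names the upper endpoints by strands, left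
    strand first, hence NW before NE.\<close>
  have "distinct [sw, se, nw, ne]" using dist by auto
  from evaluates_parallel[OF this, of True True]
  have ev0: "evaluates (?L 2) word_parallel" by (simp add: entry_def exit_def arc_def)
  note ev1 = evaluates_crossing_tangle[OF dist, of Pos] and ev2 = evaluates_crossing_tangle[OF dist, of Neg]
  have "(\<Sum>i\<in>{0, 1, 2}. ?a i \<odot> Delta (?T i)) \<in> vec.span {u. saddle_insertion (2 * n) u}"
  proof (rule local_relation[where L = ?L and H = ?H and C = C])
    fix S assume "S \<subseteq> {..<length ?H}"
    then obtain w where w: "length w = length ?H" "trues w = S" by (rule trues_of_set)
    have "Phi 4 (Delta (?L 0)) S = word_crossing qvar (inverse qvar) True w"
      "Phi 4 (Delta (?L 1)) S = word_crossing qvar (inverse qvar) False w"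
      "Phi 4 (Delta (?L 2)) S = word_parallel w"
      using ev0 ev1 ev2 w unfolding evaluates_def by (auto simp: crossing_tangle_def eval_nat_numeral)
    \<comment> \<open>The tables of the two signs differ only at the four words supported by the two
      upward strands, by the weight there times the difference of \<open>qvar\<close> and its
      inverse.\<close>
    moreover have "word_crossing qvar (inverse qvar) True w = word_crossing qvar (inverse qvar) False w
      + (qvar - inverse qvar) * word_parallel w"
    proof -
      obtain a b c d where "w = [a, b, c, d]" using w(1) length_4[of w] by auto
      then show ?thesis
        by (cases a; cases b; cases c; cases d)
          (simp_all add: word_crossing_def word_parallel_def word_rot_def word_juxt_def word_strand_def)
    qed
    ultimately show "(\<Sum>i\<in>{0, 1, 2}. ?a i * Phi (length ?H) (Delta (?L i)) S) = 0"
      by (simp add: eval_nat_numeral algebra_simps)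
  qed (use C T ev0 ev1 ev2 in \<open>auto simp: evaluates_def crossing_tangle_def\<close>)
  moreover have "(\<Sum>i\<in>{0, 1, 2}. ?a i \<odot> Delta (?T i)) = Delta Tp - Delta Tm - (qvar - inverse qvar) \<odot> Delta T0"
    by (simp add: fun_eq_iff algebra_simps)
  ultimately show ?thesis unfolding saddle_cong_def by (simp only:)
qed

lemma reidemeister_II_relation:
  assumes "reidemeister_II T T'" "tangle_diagram n T" "tangle_diagram n T'"
  shows "saddle_cong (2 * n) (Delta T) (Delta T')"
proof -
  obtain d0 d1 over a0 a1 b0 b1 u0 u1 v0 v1 where dist: "distinct [a0, a1, b0, b1, u0, u1, v0, v1]"
    and id: "identical_except
          [Tangle [entry d0 a0, entry d1 a1, exit d1 b1, exit d0 b0] {arc d0 a0 b0, arc d1 a1 b1} {},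
           Tangle [entry d0 a0, entry d1 a1, exit d1 b1, exit d0 b0] {arc d0 u0 v0, arc d1 u1 v1}
             {cross over d0 d1 a0 a1 u0 u1, cross (\<not> over) d1 d0 v1 v0 b1 b0}] [T, T']"
    using assms(1) unfolding reidemeister_II_def Let_def by blast
  have "distinct [a0, a1, b0, b1]" "distinct [a0, a1, u0, u1]" "distinct [v1, v0, b1, b0]" using dist by auto
  note ev = evaluates_parallel[OF this(1), of d0 d1] evaluates_cross[OF this(2), of d0 d1 over]
    evaluates_cross[OF this(3), of d1 d0 "\<not> over"]
  have "evaluates (Tangle [entry d0 a0, entry d1 a1, exit d1 b1, exit d0 b0] {arc d0 u0 v0, arc d1 u1 v1}
      {cross over d0 d1 a0 a1 u0 u1, cross (\<not> over) d1 d0 v1 v0 b1 b0})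
      (word_R2 (word_cross qvar (inverse qvar) over d0 d1) (word_cross qvar (inverse qvar) (\<not> over) d1 d0))"
    using dist evaluates_R2[OF ev(2,3)] by (simp add: points_Tangle joint_arc insert_commute)
  from pair_relation[OF id assms(2,3) _ ev(1) this, of 1]
  have "saddle_cong (2 * n) (Delta T') (1 \<odot> Delta T)"
    by (simp add: word_R2_identity[OF qvar_inverse])
  then show ?thesis by (simp only: vec.scale_one saddle_cong_sym)
qed

lemma reidemeister_III_relation:
  assumes "reidemeister_III T T'" "tangle_diagram n T" "tangle_diagram n T'"
  shows "saddle_cong (2 * n) (Delta T) (Delta T')"
proof -
  obtain d0 d1 d2 and h0 h1 h2 :: nat and a0 a1 a2 b0 b1 b2 u0 u1 u2 v0 v1 v2 where
    dist: "distinct [a0, a1, a2, b0, b1, b2, u0, u1, u2, v0, v1, v2]" "distinct [h0, h1, h2]"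
    and id: "identical_except
      [Tangle [entry d0 a0, entry d1 a1, entry d2 a2, exit d0 b0, exit d1 b1, exit d2 b2]
         {arc d0 u0 v0, arc d1 u1 v1, arc d2 u2 v2}
         {cross (h0 > h1) d0 d1 a0 a1 u0 u1, cross (h0 > h2) d0 d2 v0 a2 b0 u2,
          cross (h1 > h2) d1 d2 v1 v2 b1 b2},
       Tangle [entry d0 a0, entry d1 a1, entry d2 a2, exit d0 b0, exit d1 b1, exit d2 b2]
         {arc d0 u0 v0, arc d1 u1 v1, arc d2 u2 v2}
         {cross (h1 > h2) d1 d2 a1 a2 u1 u2, cross (h0 > h2) d0 d2 a0 v2 u0 b2,
          cross (h0 > h1) d0 d1 v0 v1 b0 b1}] [T, T']"
    using assms(1) unfolding reidemeister_III_def Let_def by blast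
  let ?q = qvar and ?p = "inverse qvar"
  define o01 o02 o12 where o: "o01 = (h0 > h1)" "o02 = (h0 > h2)" "o12 = (h1 > h2)"
  have height: "\<not> (o01 \<and> o12 \<and> \<not> o02)" "\<not> (\<not> o01 \<and> \<not> o12 \<and> o02)"
    using dist(2) by (auto simp: o)
  have d: "distinct [a0, a1, u0, u1]" "distinct [v0, a2, b0, u2]" "distinct [v1, v2, b1, b2]"
    "distinct [a1, a2, u1, u2]" "distinct [a0, v2, u0, b2]" "distinct [v0, v1, b0, b1]"
    using dist(1) by auto
  note rot = evaluates_rot_cross
  \<comment> \<open>Every crossing is turned until its list begins and ends with corners on the
    triangle, as \<open>evaluates_R3\<close> expects. The table changes with each turn by
    \<open>evaluates_rot_cross\<close>.\<close>
  note e1 = rot[OF rot[OF rot[OF evaluates_cross[OF d(1), of d0 d1 o01]]], simplified]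
  note e2 = evaluates_cross[OF d(2), of d0 d2 o02]
  note e3 = rot[OF evaluates_cross[OF d(3), of d1 d2 o12]]
  note e4 = rot[OF rot[OF evaluates_cross[OF d(5), of d0 d2 o02]], simplified]
  note e5 = rot[OF rot[OF rot[OF evaluates_cross[OF d(4), of d1 d2 o12]]], simplified]
  note e6 = rot[OF evaluates_cross[OF d(6), of d0 d1 o01]]
  let ?H = "[entry d0 a0, entry d1 a1, entry d2 a2, exit d0 b0, exit d1 b1, exit d2 b2]"
    and ?A = "{arc d0 u0 v0, arc d1 u1 v1, arc d2 u2 v2}"
  have ev1: "evaluates (Tangle ?H ?A {cross o01 d0 d1 a0 a1 u0 u1, cross o02 d0 d2 v0 a2 b0 u2,
      cross o12 d1 d2 v1 v2 b1 b2})
    (word_R3 (word_cross ?q ?p (\<not> o01) (\<not> d1) d0) (word_cross ?q ?p o02 d0 d2)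
      (word_cross ?q ?p (\<not> o12) d2 (\<not> d1)))"
    using dist(1) evaluates_R3[OF e1 e2 e3] by (simp add: points_Tangle joint_arc insert_commute)
  \<comment> \<open>This triangle comes out with \<open>b2\<close> in front, and one further
    rotation yields the common boundary \<open>?H\<close>.\<close>
  have "evaluates (Tangle [exit d2 b2, entry d0 a0, entry d1 a1, entry d2 a2, exit d0 b0, exit d1 b1] ?A
      {cross o12 d1 d2 a1 a2 u1 u2, cross o02 d0 d2 a0 v2 u0 b2, cross o01 d0 d1 v0 v1 b0 b1})
    (word_R3 (word_cross ?q ?p o02 (\<not> d0) (\<not> d2)) (word_cross ?q ?p (\<not> o12) (\<not> d2) d1)
      (word_cross ?q ?p (\<not> o01) d1 (\<not> d0)))"
    using dist(1) evaluates_R3[OF e4 e5 e6] by (simp add: points_Tangle joint_arc insert_commute)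
  from evaluates_rot[OF this]
  have ev2: "evaluates (Tangle ?H ?A
      {cross o12 d1 d2 a1 a2 u1 u2, cross o02 d0 d2 a0 v2 u0 b2, cross o01 d0 d1 v0 v1 b0 b1})
    (word_rot (word_R3 (word_cross ?q ?p o02 (\<not> d0) (\<not> d2)) (word_cross ?q ?p (\<not> o12) (\<not> d2) d1)
      (word_cross ?q ?p (\<not> o01) d1 (\<not> d0))))"
    by simp
  from pair_relation[OF id[folded o] assms(2,3) _ ev1 ev2, of 1]
  have "saddle_cong (2 * n) (Delta T') (1 \<odot> Delta T)"
    by (simp add: word_R3_identity[OF qvar_inverse height])
  then show ?thesis by (simp only: vec.scale_one saddle_cong_sym)
qed

lemma kink_clockwise_relation:
  assumes "kink_clockwise T T'" "tangle_diagram n T" "tangle_diagram n T'"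
  shows "saddle_cong (2 * n) (Delta T') (- inverse qvar \<odot> Delta T)"
proof -
  obtain s a b x y where dist: "distinct [a, b, x, y]" and id: "identical_except
       [Tangle [(a, Inward), (b, Outward)] {(a, b)} {},
        Tangle [(a, Inward), (b, Outward)] {(y, x)} {Crossing s [a, x, y, b]}] [T, T']"
    using assms(1) unfolding kink_clockwise_def by blast
  have "a \<noteq> b" "distinct [a, x, y, b]" using dist by auto
  note ev = evaluates_strand[OF this(1), of True] evaluates_crossing_tangle[OF this(2), of s]
  \<comment> \<open>The loop joins the corners SE and NE, which one rotation brings to the
    front.\<close>
  from evaluates_rot[OF ev(2)[unfolded crossing_tangle_def], simplified]
  have "evaluates (Tangle [(b, Outward), (a, Inward)] {(y, x)} {Crossing s [a, x, y, b]})
      (word_join (word_rot (word_crossing qvar (inverse qvar) (s = Pos))))"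
    by (rule evaluates_joint[where x = "(x, Inward)" and y = "(y, Outward)", THEN evaluates_cong])
      (simp_all add: joint_def)
  note ev2 = evaluates_rot[OF this, simplified]
  show ?thesis
  proof (rule pair_relation[OF id assms(2,3) _ _ ev2])
    show "evaluates (Tangle [(a, Inward), (b, Outward)] {(a, b)} {}) word_strand"
      using ev(1) by (simp add: entry_def exit_def arc_def)
    fix w :: "bool list" assume "length w = length (bd (Tangle [(a, Inward), (b, Outward)] {(a, b)} {}))"
    then obtain c d where "w = [c, d]" by (auto simp: length_Suc_conv)
    \<comment> \<open>With \<open>p\<close> the inverse of \<open>q\<close>, the word without dots
      has the value \<open>- p - 0\<close> for a positive and \<open>- q - (p - q)\<close> for a
      negative crossing, so the factor does not depend on the sign.\<close>
    then show "word_rot (word_join (word_rot (word_crossing qvar (inverse qvar) (s = Pos)))) w =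
        - inverse qvar * word_strand w"
      by (cases c; cases d; cases s)
        (simp_all add: word_rot_def word_join_def word_crossing_def word_strand_def)
  qed simp
qed

lemma kink_counterclockwise_relation:
  assumes "kink_counterclockwise T T'" "tangle_diagram n T" "tangle_diagram n T'"
  shows "saddle_cong (2 * n) (Delta T') (- qvar \<odot> Delta T)"
proof -
  obtain s a b x y where dist: "distinct [a, b, x, y]" and id: "identical_except
       [Tangle [(a, Inward), (b, Outward)] {(a, b)} {},
        Tangle [(a, Inward), (b, Outward)] {(y, x)} {Crossing s [x, a, b, y]}] [T, T']"
    using assms(1) unfolding kink_counterclockwise_def by blast
  have "a \<noteq> b" "distinct [x, a, b, y]" using dist by auto
  note ev = evaluates_strand[OF this(1), of True] evaluates_crossing_tangle[OF this(2), of s]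
  \<comment> \<open>The loop joins the corners NW and SW; three rotations bring NW to the front,
    followed by SW.\<close>
  from evaluates_rot[OF evaluates_rot[OF evaluates_rot[OF ev(2)[unfolded crossing_tangle_def], simplified],
        simplified], simplified]
  have ev2: "evaluates (Tangle [(a, Inward), (b, Outward)] {(y, x)} {Crossing s [x, a, b, y]})
      (word_join (word_rot (word_rot (word_rot (word_crossing qvar (inverse qvar) (s = Pos))))))"
    by (rule evaluates_joint[where x = "(y, Outward)" and y = "(x, Inward)", THEN evaluates_cong])
      (simp_all add: joint_def)
  show ?thesis
  proof (rule pair_relation[OF id assms(2,3) _ _ ev2])
    show "evaluates (Tangle [(a, Inward), (b, Outward)] {(a, b)} {}) word_strand"
      using ev(1) by (simp add: entry_def exit_def arc_def)
    fix w :: "bool list" assume "length w = length (bd (Tangle [(a, Inward), (b, Outward)] {(a, b)} {}))"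
    then obtain c d where "w = [c, d]" by (auto simp: length_Suc_conv)
    \<comment> \<open>With \<open>p\<close> the inverse of \<open>q\<close>, the word without dots
      has the value \<open>- p - (q - p)\<close> for a positive and \<open>- q - 0\<close> for a
      negative crossing.\<close>
    then show "word_join (word_rot (word_rot (word_rot (word_crossing qvar (inverse qvar) (s = Pos))))) w =
        - qvar * word_strand w"
      by (cases c; cases d; cases s)
        (simp_all add: word_rot_def word_join_def word_crossing_def word_strand_def)
  qed simp
qed

theorem mainTheorem2:
  fixes n :: nat
  shows
    "(\<forall>T. tangle_diagram n T \<longrightarrow> Delta T \<in> diagram_space (2 * n)) \<and>
     (\<forall>Tp Tm T0. tangle_diagram n Tp \<longrightarrow> tangle_diagram n Tm \<longrightarrow> tangle_diagram n T0 \<longrightarrow>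
        skein_triple Tp Tm T0 \<longrightarrow>
        saddle_cong (2 * n) (Delta Tp - Delta Tm) ((qvar - inverse qvar) \<odot> Delta T0)) \<and>
     (\<forall>T T'. tangle_diagram n T \<longrightarrow> tangle_diagram n T' \<longrightarrow>
        reidemeister_II T T' \<or> reidemeister_III T T' \<longrightarrow>
        saddle_cong (2 * n) (Delta T) (Delta T')) \<and>
     (\<forall>T T'. tangle_diagram n T \<longrightarrow> tangle_diagram n T' \<longrightarrow>
        (kink_clockwise T T' \<longrightarrow>
           saddle_cong (2 * n) (Delta T') (- inverse qvar \<odot> Delta T)) \<and>
        (kink_counterclockwise T T' \<longrightarrow>
           saddle_cong (2 * n) (Delta T') (- qvar \<odot> Delta T)))"
proof (intro conjI allI impI)
  fix T assume "tangle_diagram n T"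
  then show "Delta T \<in> diagram_space (2 * n)"
    using Delta_closed[OF planar_good] unfolding tangle_diagram_def by metis
qed (blast intro: skein_relation reidemeister_II_relation reidemeister_III_relation
    kink_clockwise_relation kink_counterclockwise_relation)+

end
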